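(* Assume the setting, the algorithm and the weights $w_{j,\ell}^i$ described in the context. Suppose the Lipschitz property (constant $L\ge 0$), the three-point property (constants $\gamma_{K,j}\in\mathbb R$, $L_3\ge0$, $p\in[1,2]$, $\theta_A$) and the monotonicity property (constants $\gamma_{G,j},\gamma_{F^*,\ell}\ge0$) hold, with $\gamma_{G,j}+\gamma_{K,j}> 0$ for $j=1,\dots,m$, and suppose that for some $\alpha_y>0$ and $\zeta_\ell\ge0$ (with $\zeta_\ell>0$ if $p>1$) the numbers $$\bar\gamma_{F^*,\ell}:=\begin{cases}\gamma_{F^*,\ell}, & Q_\ell P_{NL}=0,\\ \gamma_{F^*,\ell}-(p-1)\zeta_\ell-\alpha_y, & Q_\ell P_{NL}\neq0,\end{cases}$$ satisfy $\bar\gamma_{F^*,\ell}> 0$ for $\ell=1,\dots,n$. Let $0<\tilde\gamma_{G,j}<\pi_j(\gamma_{G,j}+\gamma_{K,j})$ for all $j$. Let the iterates $u^i=(x^i,y^i)$ be generated by the algorithm with $$\tau_j^{i+1}:=\frac{\tau_j^i}{(1+2\tau_j^i\tilde\gamma_{G,j})\bar\omega},\qquad \sigma_\ell^{i+1}:=\frac{\sigma_\ell^i}{(1+2\sigma_\ell^i\bar\gamma_{F^*,\ell})\bar\omega},$$ $$\bar\omega^i\equiv\bar\omega:=\max\Big\{\max_{j=1,\dots,m}\frac1{1+2\tau_j^0\tilde\gamma_{G,j}},\ \max_{\ell=1,\dots,n}\frac1{1+2\sigma_\ell^0\bar\gamma_{F^*,\ell}}\Big\},$$ where the initial $\tau_j^0,\sigma_\ell^0>0$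 satisfy, for some $0<\delta<\kappa<1$, $\rho_x,\rho_\ell\ge0$, and for all $i\in\mathbb N$, $\ell=1,\dots,n$, $$1-\kappa\ge\Big\|\sum_{j\in S(i)}\sqrt{\tfrac{w_{j,\ell}^i\sigma_\ell^0\tau_j^0}{\pi_j}}\,Q_\ell\nabla K(x^i)P_j\Big\|^2,$$ $$\delta\ge\tau_j^0\Big(\bar L+2(1-\pi_j)(\gamma_{G,j}+\gamma_{K,j})\frac{\gamma_{G,j}+\gamma_{K,j}-\tilde\gamma_{G,j}}{\pi_j(\gamma_{G,j}+\gamma_{K,j})-\tilde\gamma_{G,j}}\Big)\quad (j\in S(i)),$$ where $$\bar L:=L_3+\frac{L}{\bar\omega}\Big(\max_{j=1,\dots,m}\Big(\frac{\bar\omega}{\pi_j}+1\Big)^2\sum_{\ell=1}^n\rho_\ell+\frac{nL}{2\alpha_y}\rho_x^2\Big).$$ Assume moreover for all $i\in\mathbb N$, with $A:=\sum_{j\in S(i)}\pi_j^{-1}P_j$, that $$\mathbb E[\theta_A\mid\mathcal O_{i-1}]\ge p^{-p}\sum_{\ell=1}^n\zeta_\ell^{1-p}\rho_\ell^{2-p}/\bar\omega,$$ $$\mathbb P\big[\|x^{i+1}-\hat x\|\le\rho_x,\ \|Q_\ell(y^{i+1}-\hat y)\|_{P_{NL}}\le\rho_\ell\ (\ell=1,\dots,n)\,\big|\,\mathcal O_{i-1}\big]=1 .$$ Then $\mathbb E[\|P_j(x^N-\hat x)\|^2]$ and $\mathbb E[\|Q_\ell(y^N-\hat y)\|^2]$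 converge to zero at the linear rate $O(\bar\omega^N)$ for all $j\in\{1,\dots,m\}$ and $\ell\in\{1,\dots,n\}$.
   Context: Setting. $X,Y$ are real Hilbert spaces and $K\in C^1(X;Y)$ has derivative $\nabla K(x)$ (a bounded linear operator $X\to Y$) with adjoint $\nabla K(x)^*$. $P_1,\dots,P_m$ on $X$ and $Q_1,\dots,Q_n$ on $Y$ are families of mutually orthogonal orthogonal projections, each family summing to the identity; $x_j:=P_jx$, $y_\ell:=Q_\ell y$. $G_j:X\to(-\infty,\infty]$ and $F_\ell:Y\to(-\infty,\infty]$ are convex, proper, lower semicontinuous, $F_\ell^*$ is the Fenchel conjugate, $G(x):=\sum_jG_j(P_jx)$, $F^*(y):=\sum_\ell F_\ell^*(Q_\ell y)$. $\hat u=(\hat x,\hat y)$ is a critical point: $-\nabla K(\hat x)^*\hat y\in\partial G(\hat x)$ and $K(\hat x)\in\partial F^*(\hat y)$. $Y_L:=\{y\in Y: x\mapsto\langle y,K(x)\rangle\text{ is linear}\}$, $P_{NL}$ is the orthogonal projection onto $Y_{NL}:=Y_L^\perp$. For a positive semidefinite operator $T$, $\|z\|_T:=\sqrt{\langle Tz,z\rangle}$; for general self-adjoint $T$, $\|z\|_T^2:=\langle Tz,z\rangle$; $\langle z,z'\rangle_T:=\langle Tz,z'\rangle$. Convention $0^0=1$. Properties. Lipschitz property: there is a neighbourhood $\mathcal X_K$ of $\hat x$ with $\|\nabla K(x)-\nabla K(x')\|\le L\|x-x'\|$ for $x,x'\in\mathcal X_K$. Three-point property: for a neighbourhood $\mathcal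 X_K$ of $\hat x$, with $\Gamma_K:=\sum_j\gamma_{K,j}P_j$, for every $A=\sum_ja_jP_j$ with $a_j\ge0$ there is $\theta_A\ge0$ such that for all $x,x'\in\mathcal X_K$: $\langle[\nabla K(x)-\nabla K(\hat x)]^*\hat y,x'-\hat x\rangle_A\ge\|x'-\hat x\|^2_{A\Gamma_K}+\theta_A\|K(\hat x)-K(x)-\nabla K(x)(\hat x-x)\|^p-\frac{L_3}{2}\|x'-x\|_A^2$. Monotonicity property: there are neighbourhoods $\mathcal X_G$ of $\hat x$ and $\mathcal Y_{F^*}$ of $\hat y$ such that for every $\hat q\in\partial G(\hat x)$, $x\in\mathcal X_G$, $q\in\partial G(x)$: $\langle q-\hat q,x-\hat x\rangle\ge\sum_j\gamma_{G,j}\|P_j(x-\hat x)\|^2$; and for every $\hat r\in\partial F^*(\hat y)$, $y\in\mathcal Y_{F^*}$, $r\in\partial F^*(y)$: $\langle r-\hat r,y-\hat y\rangle\ge\sum_\ell\gamma_{F^*,\ell}\|Q_\ell(y-\hat y)\|^2$. Probability. $(\Omega,\mathcal O,\mathbb P)$ is a probability space with increasing sub-$\sigma$-algebras $\mathcal O_{-1}\subseteq\mathcal O_0\subseteq\mathcal O_1\subseteq\cdots\subseteq\mathcal O$. $S(i)\subseteq\{1,\dots,m\}$ is an $\mathcal O_i$-measurable random set with $\mathbb P[j\in S(i)\mid\mathcal O_{i-1}]=\pi_j>0$ independent of $i$. Conditions involving random quantities are meant almost surely. Algorithm (full dual updates). Given an initial iterate $(x^0,y^0)\in X\times Y$ and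 step length parameters $\tau_j^i,\sigma_\ell^{i+1},\bar\omega^i>0$, for $i=0,1,2,\dots$ put, for all $j$ and $\ell$, $x_j^{i+1}:=(I+\tau_j^iP_j\partial G_jP_j)^{-1}(x_j^i-\tau_j^iP_j\nabla K(x^i)^*y^i)$ if $j\in S(i)$ and $x_j^{i+1}:=x_j^i$ if $j\notin S(i)$; $\bar x_j^{i+1}:=x_j^{i+1}+\bar\omega^i(x_j^{i+1}-x_j^i)/\pi_j$ if $j\in S(i)$ and $\bar x_j^{i+1}:=x_j^i$ if $j\notin S(i)$; $y_\ell^{i+1}:=(I+\sigma_\ell^{i+1}Q_\ell\partial F_\ell^*Q_\ell)^{-1}(y_\ell^i+\sigma_\ell^{i+1}Q_\ell K(\bar x^{i+1}))$. Here $(I+\tau P_j\partial G_jP_j)^{-1}(v)$ for $v\in P_jX$ is the proximal point, i.e. the minimiser over $z\in P_jX$ of $G_j(z)+\|z-v\|^2/(2\tau)$; similarly for $F_\ell^*$ on $Q_\ell Y$. Weights. $w_{j,\ell,k}=1/w_{j,k,\ell}>0$ ($j\le m$; $\ell,k\le n$) are some fixed numbers, $\bar{\mathcal V}_j^i(\ell):=\{k: Q_\ell\nabla K(x^i)P_j\nabla K(x^i)^*Q_k\ne0,\ j\in S(i)\}$, and $w_{j,\ell}^i:=\sum_{k\in\bar{\mathcal V}_j^i(\ell)}w_{j,\ell,k}$ if $Q_\ell\nabla K(x^i)P_j\ne0$, $w_{j,\ell}^i:=0$ otherwise.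
   Formalization: Added, since the claim fails without it: a.s. for i≥1 the segment from x^i to the extrapolated point x̄^{i+1} and x^{i+1} lie in X_K, x̂+P_j(x^{i+1}-x̂) lies in X_G for j in S(i), and y^{i+1} lies in Y_{F*}. *)

theory Defs
  imports "HOL-Probability.Probability" "HOL-Library.Landau_Symbols"
begin

text \<open>
  Real Hilbert spaces are types of sort \<open>{real_inner, banach}\<close>. The primal blocks \<open>1, \<dots>, m\<close> and the
  dual blocks \<open>1, \<dots>, n\<close> are the elements of finite (hence nonempty) index types \<open>'m\<close> and \<open>'n\<close>.
\<close>

subsection \<open>Operators\<close>

definition orth_resolution :: "('i::finite \<Rightarrow> 'a::real_inner \<Rightarrow>\<^sub>L 'a) \<Rightarrow> bool" where
  "orth_resolution P \<longleftrightarrow>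
     (\<forall>i x. P i (P i x) = P i x) \<and>
     (\<forall>i x y. P i x \<bullet> y = x \<bullet> P i y) \<and>
     (\<forall>i j x. i \<noteq> j \<longrightarrow> P i (P j x) = 0) \<and>
     (\<Sum>i\<in>UNIV. P i) = id_blinfun"

text \<open>The library's \<open>closest_point\<close> is restricted to Heine-Borel spaces. The definite description
  below is meaningful for every closed subspace \<open>V\<close> of a Hilbert space.\<close>

definition orth_proj :: "'a::real_inner set \<Rightarrow> 'a \<Rightarrow> 'a" where
  "orth_proj V x = (THE v. v \<in> V \<and> x - v \<in> orthogonal_comp V)"

definition sqnorm_op :: "('a::real_inner \<Rightarrow> 'a) \<Rightarrow> 'a \<Rightarrow> real" where
  "sqnorm_op T z = T z \<bullet> z"

definition norm_op :: "('a::real_inner \<Rightarrow> 'a) \<Rightarrow> 'a \<Rightarrow> real" where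
  "norm_op T z = sqrt (sqnorm_op T z)"

definition inner_op :: "('a::real_inner \<Rightarrow> 'a) \<Rightarrow> 'a \<Rightarrow> 'a \<Rightarrow> real" where
  "inner_op T z z' = T z \<bullet> z'"

definition Y_L :: "('x::real_inner \<Rightarrow> 'y::real_inner) \<Rightarrow> 'y set" where
  "Y_L K = {y. linear (\<lambda>x. y \<bullet> K x)}"

definition P_NL :: "('x::real_inner \<Rightarrow> 'y::real_inner) \<Rightarrow> 'y \<Rightarrow> 'y" where
  "P_NL K = orth_proj (orthogonal_comp (Y_L K))"

abbreviation adj :: "('x::real_inner \<Rightarrow>\<^sub>L 'y::real_inner) \<Rightarrow> 'y \<Rightarrow> 'x" where
  "adj T \<equiv> adjoint (blinfun_apply T)"

text \<open>Real powers with the convention \<open>0\<^sup>0 = 1\<close>; note that \<open>0 powr 0 = 0\<close> in the library.\<close>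

definition rpow :: "real \<Rightarrow> real \<Rightarrow> real" where
  "rpow a b = (if b = 0 then 1 else a powr b)"

subsection \<open>Convex analysis of extended real-valued functions\<close>

definition convex_fun :: "('a::real_vector \<Rightarrow> ereal) \<Rightarrow> bool" where
  "convex_fun f \<longleftrightarrow> (\<forall>x y. \<forall>t\<in>{0..1::real}.
     f ((1 - t) *\<^sub>R x + t *\<^sub>R y) \<le> ereal (1 - t) * f x + ereal t * f y)"

definition proper_fun :: "('a \<Rightarrow> ereal) \<Rightarrow> bool" where
  "proper_fun f \<longleftrightarrow> (\<forall>x. f x \<noteq> -\<infinity>) \<and> (\<exists>x. f x \<noteq> \<infinity>)"

definition lsc_fun :: "('a::topological_space \<Rightarrow> ereal) \<Rightarrow> bool" where
  "lsc_fun f \<longleftrightarrow> (\<forall>x. f x \<le> Liminf (nhds x) f)"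

definition fenchel_conj :: "('a::real_inner \<Rightarrow> ereal) \<Rightarrow> 'a \<Rightarrow> ereal" where
  "fenchel_conj f y = (SUP x. ereal (y \<bullet> x) - f x)"

definition subdiff :: "('a::real_inner \<Rightarrow> ereal) \<Rightarrow> 'a \<Rightarrow> 'a set" where
  "subdiff f x = {q. \<bar>f x\<bar> \<noteq> \<infinity> \<and> (\<forall>z. f x + ereal (q \<bullet> (z - x)) \<le> f z)}"

definition block_sum :: "('i::finite \<Rightarrow> 'a \<Rightarrow> ereal) \<Rightarrow> ('i \<Rightarrow> 'a::real_inner \<Rightarrow>\<^sub>L 'a) \<Rightarrow> 'a \<Rightarrow> ereal" where
  "block_sum f P x = (\<Sum>i\<in>UNIV. f i (P i x))"

definition prox_point :: "('a::real_inner \<Rightarrow> ereal) \<Rightarrow> 'a set \<Rightarrow> real \<Rightarrow> 'a \<Rightarrow> 'a \<Rightarrow> bool" where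
  "prox_point f V t v z \<longleftrightarrow>
     is_arg_min (\<lambda>z. f z + ereal ((norm (z - v))\<^sup>2 / (2 * t))) (\<lambda>z. z \<in> V) z"

subsection \<open>Local properties at the critical point\<close>

definition three_point_property ::
  "('x::real_inner \<Rightarrow> 'y::real_inner) \<Rightarrow> ('x \<Rightarrow> 'x \<Rightarrow>\<^sub>L 'y) \<Rightarrow> ('m::finite \<Rightarrow> 'x \<Rightarrow>\<^sub>L 'x) \<Rightarrow>
   'x \<Rightarrow> 'y \<Rightarrow> 'x set \<Rightarrow> ('m \<Rightarrow> real) \<Rightarrow> (('x \<Rightarrow>\<^sub>L 'x) \<Rightarrow> real) \<Rightarrow> real \<Rightarrow> real \<Rightarrow> bool" where
  "three_point_property K K' P xh yh XK \<gamma>K \<theta> L3 p \<longleftrightarrow>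
     (\<forall>a. (\<forall>j. 0 \<le> a j) \<longrightarrow>
       (let A = (\<Sum>j\<in>UNIV. a j *\<^sub>R P j); \<Gamma>K = (\<Sum>j\<in>UNIV. \<gamma>K j *\<^sub>R P j)
        in 0 \<le> \<theta> A \<and>
           (\<forall>x\<in>XK. \<forall>x'\<in>XK.
              inner_op A (adj (K' x - K' xh) yh) (x' - xh)
                \<ge> sqnorm_op (A o\<^sub>L \<Gamma>K) (x' - xh)
                   + \<theta> A * norm (K xh - K x - K' x (xh - x)) powr p
                   - L3 / 2 * sqnorm_op A (x' - x))))"

definition monotonicity_property ::
  "('a::real_inner \<Rightarrow> ereal) \<Rightarrow> ('i::finite \<Rightarrow> 'a \<Rightarrow>\<^sub>L 'a) \<Rightarrow> 'a \<Rightarrow> 'a set \<Rightarrow> ('i \<Rightarrow> real) \<Rightarrow> bool" where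
  "monotonicity_property f P xh U \<gamma> \<longleftrightarrow>
     (\<forall>qh\<in>subdiff f xh. \<forall>x\<in>U. \<forall>q\<in>subdiff f x.
        (q - qh) \<bullet> (x - xh) \<ge> (\<Sum>i\<in>UNIV. \<gamma> i * (norm (P i (x - xh)))\<^sup>2))"

subsection \<open>The algorithm with full dual updates\<close>

text \<open>A single trajectory. \<open>xb i\<close> is the extrapolated point with superscript \<open>i\<close>, used for \<open>i \<ge> 1\<close> only.\<close>

definition full_dual_iterates ::
  "('m::finite \<Rightarrow> 'x::real_inner \<Rightarrow> ereal) \<Rightarrow> ('n::finite \<Rightarrow> 'y::real_inner \<Rightarrow> ereal) \<Rightarrow>
   ('x \<Rightarrow> 'y) \<Rightarrow> ('x \<Rightarrow> 'x \<Rightarrow>\<^sub>L 'y) \<Rightarrow> ('m \<Rightarrow> 'x \<Rightarrow>\<^sub>L 'x) \<Rightarrow> ('n \<Rightarrow> 'y \<Rightarrow>\<^sub>L 'y) \<Rightarrow> ('m \<Rightarrow> real) \<Rightarrow>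
   (nat \<Rightarrow> 'm \<Rightarrow> real) \<Rightarrow> (nat \<Rightarrow> 'n \<Rightarrow> real) \<Rightarrow> (nat \<Rightarrow> real) \<Rightarrow>
   (nat \<Rightarrow> 'm set) \<Rightarrow> (nat \<Rightarrow> 'x) \<Rightarrow> (nat \<Rightarrow> 'x) \<Rightarrow> (nat \<Rightarrow> 'y) \<Rightarrow> bool" where
  "full_dual_iterates G F K K' P Q \<pi> \<tau> \<sigma> wb S x xb y \<longleftrightarrow> (\<forall>i.
     (\<forall>j. if j \<in> S i
          then prox_point (G j) (range (P j)) (\<tau> i j)
                 (P j (x i) - \<tau> i j *\<^sub>R P j (adj (K' (x i)) (y i))) (P j (x (Suc i)))
             \<and> P j (xb (Suc i)) = P j (x (Suc i)) + (wb i / \<pi> j) *\<^sub>R (P j (x (Suc i)) - P j (x i))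
          else P j (x (Suc i)) = P j (x i) \<and> P j (xb (Suc i)) = P j (x i)) \<and>
     (\<forall>l. prox_point (fenchel_conj (F l)) (range (Q l)) (\<sigma> (Suc i) l)
            (Q l (y i) + \<sigma> (Suc i) l *\<^sub>R Q l (K (xb (Suc i)))) (Q l (y (Suc i)))))"

text \<open>\<open>V_bar K' P Q S x j l\<close> and \<open>block_weight w K' P Q S x j l\<close> are the index sets and weights at the
  iterate \<open>x\<close> with set \<open>S\<close> of updated primal blocks.\<close>

definition V_bar ::
  "('x::real_inner \<Rightarrow> 'x \<Rightarrow>\<^sub>L 'y::real_inner) \<Rightarrow> ('m \<Rightarrow> 'x \<Rightarrow>\<^sub>L 'x) \<Rightarrow> ('n \<Rightarrow> 'y \<Rightarrow>\<^sub>L 'y) \<Rightarrow>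
   'm set \<Rightarrow> 'x \<Rightarrow> 'm \<Rightarrow> 'n \<Rightarrow> 'n set" where
  "V_bar K' P Q S x j l =
     {k. (\<lambda>y. Q l (K' x (P j (adj (K' x) (Q k y))))) \<noteq> (\<lambda>y. 0) \<and> j \<in> S}"

definition block_weight ::
  "('m \<Rightarrow> 'n \<Rightarrow> 'n \<Rightarrow> real) \<Rightarrow> ('x::real_inner \<Rightarrow> 'x \<Rightarrow>\<^sub>L 'y::real_inner) \<Rightarrow> ('m \<Rightarrow> 'x \<Rightarrow>\<^sub>L 'x) \<Rightarrow>
   ('n \<Rightarrow> 'y \<Rightarrow>\<^sub>L 'y) \<Rightarrow> 'm set \<Rightarrow> 'x \<Rightarrow> 'm \<Rightarrow> 'n \<Rightarrow> real" where
  "block_weight w K' P Q S x j l =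
     (if Q l o\<^sub>L K' x o\<^sub>L P j \<noteq> 0 then \<Sum>k\<in>V_bar K' P Q S x j l. w j l k else 0)"

text \<open>The local properties only carry information inside the neighbourhoods \<open>XK\<close>, \<open>XG\<close>, \<open>YF\<close>, so the
  iterates must stay in them: a trajectory could otherwise rest at another critical point.
  Spelled out for the points at which the properties are evaluated, this asks for the
  segment from \<open>x\<^sup>i\<close> to the extrapolated point to lie in \<open>XK\<close>, for the updated primal blocks to be
  those of points of \<open>XG\<close> and for the dual iterates to lie in \<open>YF\<close>. If \<open>XK\<close>, \<open>XG\<close>
  and \<open>YF\<close> are balls around \<open>xh\<close> and \<open>yh\<close>, it is implied by membership of the iterates and
  extrapolated points; if they are the whole spaces, it is void.
  The initial iterate is not restricted.\<close>

definition stays_in_neighbourhoods ::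
  "('m \<Rightarrow> 'x::real_inner \<Rightarrow>\<^sub>L 'x) \<Rightarrow> 'x \<Rightarrow> 'x set \<Rightarrow> 'x set \<Rightarrow> 'y set \<Rightarrow>
   (nat \<Rightarrow> 'm set) \<Rightarrow> (nat \<Rightarrow> 'x) \<Rightarrow> (nat \<Rightarrow> 'x) \<Rightarrow> (nat \<Rightarrow> 'y) \<Rightarrow> bool" where
  "stays_in_neighbourhoods P xh XK XG YF S x xb y \<longleftrightarrow> (\<forall>i\<ge>1.
     closed_segment (x i) (xb (Suc i)) \<subseteq> XK \<and>
     x (Suc i) \<in> XK \<and>
     (\<forall>j\<in>S i. xh + P j (x (Suc i) - xh) \<in> XG) \<and>
     y (Suc i) \<in> YF)"

definition prob_given :: "'w measure \<Rightarrow> 'w measure \<Rightarrow> ('w \<Rightarrow> bool) \<Rightarrow> 'w \<Rightarrow> real" where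
  "prob_given M H E = real_cond_exp M H (indicat_real {\<omega> \<in> space M. E \<omega>})"

end

theory Submission
  imports Defs
begin

text \<open>
  Testing the implicit step against the critical point with weights \<open>1 / (\<pi>\<^sub>j \<tau>\<^sub>j)\<close> and
  \<open>1 / (\<omega> \<sigma>\<^sub>l)\<close> (where \<open>\<omega>\<close> is \<open>wb\<close>) yields the Lyapunov function
  \<open>U\<^sub>i = \<Sum>\<^sub>j \<parallel>P\<^sub>j (x\<^sup>i - xh)\<parallel>\<^sup>2 / (2 \<pi>\<^sub>j \<tau>\<^sub>j\<^sup>i) + \<Sum>\<^sub>l \<parallel>Q\<^sub>l (y\<^sup>i - yh)\<parallel>\<^sup>2 / (2 \<omega> \<sigma>\<^sub>l\<^bsup>i+1\<^esup>) - \<langle>K'(x\<^sup>i) (x\<^sup>i - xh), y\<^sup>i - yh\<rangle>\<close>.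
  The step length rules turn the strong monotonicity into \<open>E U\<^sub>i\<^sub>+\<^sub>1 \<le> \<omega> E U\<^sub>i\<close> for \<open>i \<ge> 1\<close>; the errors caused by
  the nonlinearity of \<open>K\<close> are absorbed by the three-point term \<open>\<theta>\<close>, by the reduction of \<open>\<gamma>F\<close> to \<open>\<gamma>Fb\<close>
  and by the \<open>\<delta>\<close>-part of the proximal term.
  The bilinear part of \<open>U\<close> is bounded through the sampled operator \<open>A = \<Sum>\<^sub>j\<^sub>\<in>\<^sub>S \<pi>\<^sub>j\<^sup>-\<^sup>1 P\<^sub>j\<close>, whose conditional expectation
  is the identity: the \<open>\<kappa>\<close>-condition controls \<open>K'(x) A\<close> only. Hence \<open>E U\<^sub>N\<close> dominates a fixed multiple
  of the squared distances.
\<close>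

subsection \<open>Orthogonal projections and adjoints in Hilbert spaces\<close>

text \<open>The random choice of primal blocks is the obstacle. A block outside the sampled set does
  not move and yields no strong monotonicity, yet the step length rule asks for the gain \<gamma>Gt
  from every block. Along a single trajectory this debt need not be covered. What a sampled block
  gains beyond \<gamma>Gt is therefore transferred from the new point, which depends on the draw, to
  the old one, which does not, in the amount
  \<open>(1 - \<pi> j) * (\<gamma>G j + \<gamma>K j)\<close>. Surplus and debt then balance in mean
  because \<open>\<gamma>Gt j < \<pi> j * (\<gamma>G j + \<gamma>K j)\<close>. The price of the
  transfer is a multiple of the squared primal step, the origin of the second summand in the
  \<delta>-condition. The dual inequality is divided by \<open>wb\<close> because the extrapolation
  adds \<open>wb\<close> times the sampled primal step: after the division the coupling terms of
  both inequalities match, and the coupling left at the new point carries the same factor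
  \<open>1 / wb\<close> as the new distances, so the bilinear term can join the Lyapunov
  function.\<close>

lemma hilbert_projection_exists:
  fixes W :: "'a::{real_inner, banach} set"
  assumes W: "subspace W" "closed W"
  shows "\<exists>v\<in>W. x - v \<in> orthogonal_comp W"
proof -
  define d where "d = (INF w\<in>W. (norm (x - w))\<^sup>2)"
  define T where "T n = {w\<in>W. (norm (x - w))\<^sup>2 \<le> d + 1 / real (Suc n)}" for n
  have W0: "W \<noteq> {}" using subspace_0[OF W(1)] by auto
  have bdd: "bdd_below ((\<lambda>w. (norm (x - w))\<^sup>2) ` W)" by (intro bdd_belowI[of _ 0]) auto
  have dle: "d \<le> (norm (x - w))\<^sup>2" if "w \<in> W" for w
    unfolding d_def using bdd that by (intro cINF_lower) auto
  \<comment> \<open>Near-minimisers form nested closed sets with diameters tending to 0;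
    completeness gives a common point.\<close>
  have "\<exists>a. \<Inter>(range T) = {a}"
  proof (rule decreasing_closed_nest_sing)
    fix n
    have "T n = W \<inter> (\<lambda>w. (norm (x - w))\<^sup>2) -` {..d + 1 / real (Suc n)}" by (auto simp: T_def)
    then show "closed (T n)"
      by (auto intro!: closed_Int W closed_vimage continuous_intros)
    have "d < d + 1 / real (Suc n)" by simp
    then obtain w where "w \<in> W" "(norm (x - w))\<^sup>2 < d + 1 / real (Suc n)"
      unfolding d_def using cInf_lessD[of "(\<lambda>w. (norm (x - w))\<^sup>2) ` W"] W0 by blast
    then show "T n \<noteq> {}" unfolding T_def by (auto intro: less_imp_le)
  next
    fix m n :: nat assume "m \<le> n"
    then have "1 / real (Suc n) \<le> 1 / real (Suc m)" by (simp add: field_simps)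
    then show "T n \<subseteq> T m" by (auto simp: T_def)
  next
    fix e :: real assume "e > 0"
    then obtain n where n: "4 / e\<^sup>2 < real n" using reals_Archimedean2 by blast
    \<comment> \<open>The midpoint of two near-minimisers lies in \<open>W\<close>, so by the
      parallelogram law the squared diameter of \<open>T n\<close> is at most 4 / (n + 1).\<close>
    have "dist u v < e" if "u \<in> T n" "v \<in> T n" for u v
    proof -
      have uv: "u \<in> W" "v \<in> W" "(norm (x - u))\<^sup>2 \<le> d + 1 / real (Suc n)"
        "(norm (x - v))\<^sup>2 \<le> d + 1 / real (Suc n)" using that by (auto simp: T_def)
      have "(1/2) *\<^sub>R (u + v) \<in> W" using W(1) uv by (intro subspace_scale subspace_add)
      from dle[OF this] have "d \<le> (norm (x - (1/2) *\<^sub>R (u + v)))\<^sup>2" .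
      moreover have "(norm (u - v))\<^sup>2 = 2 * (norm (x - u))\<^sup>2 + 2 * (norm (x - v))\<^sup>2
          - 4 * (norm (x - (1/2) *\<^sub>R (u + v)))\<^sup>2"
        by (simp add: power2_norm_eq_inner algebra_simps inner_commute)
      ultimately have "(norm (u - v))\<^sup>2 \<le> 4 / real (Suc n)" using uv by simp
      also have "\<dots> < e\<^sup>2"
      proof -
        have "4 < e\<^sup>2 * real n" using n \<open>e > 0\<close> by (simp add: field_simps)
        also have "\<dots> \<le> e\<^sup>2 * real (Suc n)" by (intro mult_left_mono) auto
        finally show ?thesis by (simp add: field_simps)
      qed
      finally show ?thesis using \<open>e > 0\<close> by (simp add: dist_norm power2_less_imp_less)
    qed
    then show "\<exists>n. \<forall>u\<in>T n. \<forall>v\<in>T n. dist u v < e" by blast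
  qed
  then obtain a where a: "\<And>n. a \<in> T n" by blast
  have aW: "a \<in> W" using a by (auto simp: T_def)
  have "(norm (x - a))\<^sup>2 \<le> d"
  proof (rule field_le_epsilon)
    fix e :: real assume "e > 0"
    then obtain n where n: "inverse (real (Suc n)) < e" using reals_Archimedean by blast
    have "(norm (x - a))\<^sup>2 \<le> d + 1 / real (Suc n)" using a[of n] by (simp add: T_def)
    then show "(norm (x - a))\<^sup>2 \<le> d + e" using n by (simp add: inverse_eq_divide)
  qed
  then have min: "(norm (x - a))\<^sup>2 \<le> (norm (x - a - w))\<^sup>2" if "w \<in> W" for w
    using dle[of "a + w"] subspace_add[OF W(1) aW that] unfolding diff_diff_add by linarith
  have "w \<bullet> (x - a) = 0" if w: "w \<in> W" for w
  proof (cases "w = 0")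
    case False
    \<comment> \<open>The best approximation of \<open>x - a\<close> by multiples of
      \<open>w\<close>; it cannot improve on 0, which forces orthogonality.\<close>
    define t where "t = w \<bullet> (x - a) / (w \<bullet> w)"
    have "(norm (x - a))\<^sup>2 \<le> (norm (x - a - t *\<^sub>R w))\<^sup>2"
      using W(1) w by (intro min subspace_scale)
    also have "\<dots> = (norm (x - a))\<^sup>2 - 2 * t * (w \<bullet> (x - a)) + t * t * (w \<bullet> w)"
      unfolding power2_norm_eq_inner by (simp add: algebra_simps inner_commute)
    also have "t * t * (w \<bullet> w) = t * (w \<bullet> (x - a))" using False by (simp add: t_def)
    finally have "t * (w \<bullet> (x - a)) \<le> 0" by simp
    then have "(w \<bullet> (x - a))\<^sup>2 / (w \<bullet> w) \<le> 0" by (simp add: t_def power2_eq_square)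
    moreover have "0 < w \<bullet> w" using False by simp
    ultimately have "(w \<bullet> (x - a))\<^sup>2 \<le> 0" by (simp add: divide_le_0_iff)
    then show ?thesis by simp
  qed simp
  with aW show ?thesis by (auto simp: orthogonal_comp_def orthogonal_def intro!: bexI[of _ a])
qed

text \<open>Two candidates differ by a vector that lies both in \<open>V\<close> and in its
  orthogonal complement, so the definite description has a unique witness.\<close>

lemma
  fixes V :: "'a::{real_inner, banach} set"
  assumes "subspace V" "closed V"
  shows orth_proj_in: "orth_proj V x \<in> V"
    and orth_proj_diff: "x - orth_proj V x \<in> orthogonal_comp V"
proof -
  obtain v where v: "v \<in> V" "x - v \<in> orthogonal_comp V"
    using hilbert_projection_exists[OF assms] by blast
  have "u = v" if "u \<in> V" "x - u \<in> orthogonal_comp V" for u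
  proof -
    have "u - v \<in> V" using that v assms by (intro subspace_diff)
    moreover have "(x - v) - (x - u) \<in> orthogonal_comp V"
      by (rule subspace_diff[OF subspace_orthogonal_comp]) (fact that v)+
    ultimately have "(u - v) \<bullet> (u - v) = 0" by (auto simp: orthogonal_comp_def orthogonal_def)
    then show ?thesis by simp
  qed
  then have "orth_proj V x = v" unfolding orth_proj_def using v by (intro the_equality conjI) blast+
  with v show "orth_proj V x \<in> V" "x - orth_proj V x \<in> orthogonal_comp V" by simp_all
qed

text \<open>The orthogonal complement of the kernel is a line, spanned by the component
  \<open>u\<close> of any point outside the kernel; only its scaling has to be found.\<close>

lemma riesz_representation:
  fixes f :: "'a::{real_inner, banach} \<Rightarrow> real"
  assumes f: "bounded_linear f"
  shows "\<exists>v. \<forall>x. f x = x \<bullet> v"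
proof (cases "\<forall>x. f x = 0")
  case True then show ?thesis by (intro exI[of _ 0]) simp
next
  case False
  interpret f: bounded_linear f by fact
  obtain x where x: "f x \<noteq> 0" using False by auto
  let ?W = "{z. f z = 0}"
  have "subspace ?W" by (auto simp: subspace_def f.add f.scaleR f.zero)
  moreover have "closed ?W"
    by (intro closed_Collect_eq f.continuous_on continuous_intros)
  ultimately obtain v where v: "f v = 0" "x - v \<in> orthogonal_comp ?W"
    using hilbert_projection_exists by blast
  define u where "u = x - v"
  have fu: "f u = f x" by (simp add: u_def f.diff v)
  with x have u0: "u \<noteq> 0" by (auto simp: f.zero)
  have "f z = z \<bullet> ((f u / (u \<bullet> u)) *\<^sub>R u)" for z
  proof -
    have "z - (f z / f u) *\<^sub>R u \<in> ?W" using x fu by (simp add: f.diff f.scaleR)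
    then have "(z - (f z / f u) *\<^sub>R u) \<bullet> u = 0"
      using v unfolding u_def orthogonal_comp_def orthogonal_def by blast
    then have "z \<bullet> u = f z / f u * (u \<bullet> u)" by (simp add: inner_diff_left)
    then show ?thesis using x fu u0 by (simp add: field_simps)
  qed
  then show ?thesis by blast
qed

text \<open>\<open>adjoint\<close> is a choice operator: its defining equation holds once some map
  satisfying it is exhibited, and the Riesz representation supplies one.\<close>

lemma adj_works:
  fixes T :: "'x::{real_inner, banach} \<Rightarrow>\<^sub>L 'y::real_inner"
  shows "T u \<bullet> v = u \<bullet> adj T v"
proof -
  have "\<exists>z. \<forall>u. T u \<bullet> v = u \<bullet> z" for v
    by (intro riesz_representation bounded_linear_inner_left_comp blinfun.bounded_linear_right)
  then obtain g where "\<forall>u v. T u \<bullet> v = u \<bullet> g v" by metis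
  then have "adj T = g" by (intro adjoint_unique)
  with \<open>\<forall>u v. _\<close> show ?thesis by simp
qed

lemma adj_works': "adj T v \<bullet> u = v \<bullet> T u"
  for T :: "'x::{real_inner, banach} \<Rightarrow>\<^sub>L 'y::real_inner"
  by (metis adj_works inner_commute)

lemma linear_adj: "linear (adj T)"
  for T :: "'x::{real_inner, banach} \<Rightarrow>\<^sub>L 'y::real_inner"
  by (rule linearI; rule vector_eq_ldot[THEN iffD1])
     (simp_all add: inner_add_right adj_works[symmetric])

lemma adj_diff_blinfun: "adj (T - T') v = adj T v - adj T' v"
  for T T' :: "'x::{real_inner, banach} \<Rightarrow>\<^sub>L 'y::real_inner"
  by (rule vector_eq_ldot[THEN iffD1])
     (simp add: adj_works[symmetric] inner_diff_right blinfun.diff_left inner_diff_left)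

lemma norm_adj_le: "norm (adj T v) \<le> norm T * norm v"
  for T :: "'x::{real_inner, banach} \<Rightarrow>\<^sub>L 'y::real_inner"
proof -
  have "(norm (adj T v))\<^sup>2 = T (adj T v) \<bullet> v" by (simp add: adj_works power2_norm_eq_inner)
  also have "\<dots> \<le> norm (T (adj T v)) * norm v" by (rule norm_cauchy_schwarz)
  also have "\<dots> \<le> (norm T * norm (adj T v)) * norm v"
    by (intro mult_right_mono norm_blinfun) auto
  finally have *: "norm (adj T v) * norm (adj T v) \<le> norm (adj T v) * (norm T * norm v)"
    by (simp add: power2_eq_square mult_ac)
  show ?thesis
  proof (cases "adj T v = 0")
    case False then show ?thesis using * by simp
  qed (simp add: zero_le_mult_iff)
qed

text \<open>Every orthogonal complement is closed, so the projection is available whatever set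
  \<open>Y_L K\<close> is. The last part allows errors orthogonal to \<open>Y_L K\<close> to be
  tested with the projected dual distance only.\<close>

lemma
  fixes K :: "'x::real_inner \<Rightarrow> 'y::{real_inner, banach}"
  shows norm_op_P_NL: "norm_op (P_NL K) v = norm (P_NL K v)"
    and P_NL_symmetric: "P_NL K u \<bullet> v = u \<bullet> P_NL K v"
    and norm_P_NL_le: "norm (P_NL K v) \<le> norm v"
    and inner_P_NL: "r \<in> orthogonal_comp (Y_L K) \<Longrightarrow> r \<bullet> v = r \<bullet> P_NL K v"
proof -
  let ?V = "orthogonal_comp (Y_L K)"
  have "closed ?V"
  proof -
    have "?V = (\<Inter>u\<in>Y_L K. {v. u \<bullet> v = 0})" by (auto simp: orthogonal_comp_def orthogonal_def)
    also have "closed \<dots>" by (intro closed_INT ballI closed_Collect_eq continuous_intros)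
    finally show ?thesis .
  qed
  note V = subspace_orthogonal_comp[of "Y_L K"] this
  have mem: "P_NL K u \<in> ?V" and diff: "u - P_NL K u \<in> orthogonal_comp ?V" for u
    unfolding P_NL_def using orth_proj_in[OF V] orth_proj_diff[OF V] by auto
  have *: "r \<bullet> v = r \<bullet> P_NL K v" if "r \<in> ?V" for r v
  proof -
    have "r \<bullet> (v - P_NL K v) = 0" using that diff[of v]
      by (subst (asm) (2) orthogonal_comp_def) (auto simp: orthogonal_def)
    then show ?thesis by (simp add: inner_diff_right)
  qed
  then show "r \<in> ?V \<Longrightarrow> r \<bullet> v = r \<bullet> P_NL K v" .
  have "P_NL K v \<bullet> v = (norm (P_NL K v))\<^sup>2"
    using *[OF mem, of v v] by (simp add: power2_norm_eq_inner)
  then show "norm_op (P_NL K) v = norm (P_NL K v)" by (simp add: norm_op_def sqnorm_op_def)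
  show "P_NL K u \<bullet> v = u \<bullet> P_NL K v"
    using *[OF mem, of u v] *[OF mem, of v u] by (simp add: inner_commute)
  have "norm (P_NL K v) * norm (P_NL K v) \<le> norm (P_NL K v) * norm v"
    using \<open>P_NL K v \<bullet> v = _\<close> norm_cauchy_schwarz[of "P_NL K v" v] by (simp add: power2_eq_square)
  then show "norm (P_NL K v) \<le> norm v" by (cases "P_NL K v = 0") auto
qed

subsection \<open>Orthogonal resolutions of the identity\<close>

lemma
  assumes "orth_resolution P"
  shows proj_idem: "P i (P i u) = P i u"
    and proj_sym: "P i u \<bullet> v = u \<bullet> P i v"
    and proj_orth: "i \<noteq> j \<Longrightarrow> P i (P j u) = 0"
    and proj_sum: "(\<Sum>i\<in>UNIV. P i u) = u"
proof -
  note * = assms[unfolded orth_resolution_def]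
  show "P i (P i u) = P i u" "P i u \<bullet> v = u \<bullet> P i v" "i \<noteq> j \<Longrightarrow> P i (P j u) = 0" using * by auto
  from * have "blinfun_apply (\<Sum>i\<in>UNIV. P i) u = u" by simp
  then show "(\<Sum>i\<in>UNIV. P i u) = u" by (simp add: blinfun.sum_left)
qed

lemma proj_proj:
  assumes "orth_resolution P"
  shows "P i (P j u) = (if i = j then P j u else 0)"
  using proj_idem[OF assms] proj_orth[OF assms] by auto

lemma proj_scaled_sum:
  assumes "orth_resolution P"
  shows "P i (\<Sum>j\<in>UNIV. c j *\<^sub>R P j u) = c i *\<^sub>R P i u"
proof -
  have "P i (\<Sum>j\<in>UNIV. c j *\<^sub>R P j u) = (\<Sum>j\<in>UNIV. c j *\<^sub>R P i (P j u))"
    by (simp add: blinfun.sum_right blinfun.scaleR_right)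
  also have "\<dots> = (\<Sum>j\<in>UNIV. if i = j then c j *\<^sub>R P j u else 0)"
    by (intro sum.cong refl) (simp add: proj_proj[OF assms])
  finally show ?thesis by simp
qed

lemma proj_inner:
  assumes "orth_resolution P"
  shows "P i u \<bullet> P i v = P i u \<bullet> v" "P i u \<bullet> P i v = u \<bullet> P i v"
  using proj_sym[OF assms] proj_idem[OF assms] by metis+

lemma inner_blocks:
  assumes "orth_resolution P"
  shows "u \<bullet> v = (\<Sum>i\<in>UNIV. P i u \<bullet> P i v)"
proof -
  have "u \<bullet> v = (\<Sum>i\<in>UNIV. P i u) \<bullet> v" by (simp add: proj_sum[OF assms])
  then show ?thesis by (simp add: inner_sum_left proj_inner[OF assms])
qed

lemma norm2_blocks:
  assumes "orth_resolution P"
  shows "(norm u)\<^sup>2 = (\<Sum>i\<in>UNIV. (norm (P i u))\<^sup>2)"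
  using inner_blocks[OF assms, of u u] by (simp add: power2_norm_eq_inner)

lemma eq_by_blocks:
  assumes "orth_resolution P" "\<And>i. P i u = P i v"
  shows "u = v"
proof -
  have "u = (\<Sum>i\<in>UNIV. P i u)" by (rule proj_sum[OF assms(1), symmetric])
  also have "\<dots> = (\<Sum>i\<in>UNIV. P i v)" by (simp only: assms(2))
  also have "\<dots> = v" by (rule proj_sum[OF assms(1)])
  finally show ?thesis .
qed

subsection \<open>Convex functions of blocks\<close>

lemma block_subdiff_iff:
  assumes "orth_resolution P"
  shows "P i q \<in> subdiff (\<lambda>x. f (P i x)) x \<longleftrightarrow> \<bar>f (P i x)\<bar> \<noteq> \<infinity> \<and>
     (\<forall>z. f (P i x) + ereal (P i q \<bullet> (P i z - P i x)) \<le> f (P i z))"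
proof -
  have "P i q \<bullet> (P i z - P i x) = P i q \<bullet> (z - x)" for z
    by (metis blinfun.diff_right proj_inner(1)[OF assms])
  then show ?thesis unfolding subdiff_def by simp
qed

text \<open>For the forward direction the point is changed in one block only; the other summands are
  finite and cancel. Excluding the value -\<infinity> makes every summand of a finite sum
  finite.\<close>

lemma subdiff_block_sum_iff:
  assumes P: "orth_resolution P" and f: "\<And>i x. f i x \<noteq> -\<infinity>"
  shows "q \<in> subdiff (block_sum f P) x \<longleftrightarrow> (\<forall>i. P i q \<in> subdiff (\<lambda>x. f i (P i x)) x)"
proof
  assume q: "q \<in> subdiff (block_sum f P) x"
  have "(\<Sum>i\<in>UNIV. f i (P i x)) \<noteq> \<infinity>" using q by (auto simp: subdiff_def block_sum_def)
  then have fin: "f i (P i x) \<noteq> \<infinity>" for i using sum_Pinfty[of "\<lambda>i. f i (P i x)" UNIV] by auto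
  define a where "a i = real_of_ereal (f i (P i x))" for i
  have a: "f i (P i x) = ereal (a i)" for i
    unfolding a_def using fin f by (intro ereal_real'[symmetric]) auto
  show "\<forall>i. P i q \<in> subdiff (\<lambda>x. f i (P i x)) x"
    unfolding block_subdiff_iff[OF P]
  proof (intro allI conjI)
    fix i z
    show "\<bar>f i (P i x)\<bar> \<noteq> \<infinity>" by (simp add: a)
    define z' where "z' = x + P i (z - x)"
    have Pz: "P k z' = (if k = i then P i z else P k x)" for k
      by (simp add: z'_def blinfun.add_right proj_proj[OF P] blinfun.diff_right)
    have "block_sum f P z' = (\<Sum>k\<in>UNIV. f k (P k z'))" by (simp add: block_sum_def)
    also have "\<dots> = f i (P i z) + (\<Sum>k\<in>UNIV - {i}. f k (P k z'))"
      by (subst sum.remove[of _ i]) (auto simp: Pz)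
    also have "(\<Sum>k\<in>UNIV - {i}. f k (P k z')) = (\<Sum>k\<in>UNIV - {i}. ereal (a k))"
      by (intro sum.cong refl) (auto simp: Pz a)
    finally have z': "block_sum f P z' = f i (P i z) + ereal (sum a (UNIV - {i}))" by simp
    have "block_sum f P x = ereal (sum a UNIV)" by (simp add: block_sum_def a)
    also have "sum a UNIV = a i + sum a (UNIV - {i})" by (rule sum.remove) auto
    finally have x: "block_sum f P x = ereal (a i + sum a (UNIV - {i}))" .
    have "q \<bullet> (z' - x) = P i q \<bullet> (P i z - P i x)"
      by (simp add: z'_def proj_sym[OF P, symmetric] proj_idem[OF P] blinfun.diff_right proj_inner[OF P] inner_diff_right)
    moreover have "block_sum f P x + ereal (q \<bullet> (z' - x)) \<le> block_sum f P z'"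
      using q by (auto simp: subdiff_def)
    ultimately show "f i (P i x) + ereal (P i q \<bullet> (P i z - P i x)) \<le> f i (P i z)"
      unfolding z' x a by (cases "f i (P i z)") (use f in auto)
  qed
next
  assume q: "\<forall>i. P i q \<in> subdiff (\<lambda>x. f i (P i x)) x"
  note * = q[unfolded block_subdiff_iff[OF P]]
  define a where "a i = real_of_ereal (f i (P i x))" for i
  have a: "f i (P i x) = ereal (a i)" for i
    unfolding a_def using * by (intro ereal_real'[symmetric]) auto
  have x: "block_sum f P x = ereal (sum a UNIV)" by (simp add: block_sum_def a)
  have "block_sum f P x + ereal (q \<bullet> (z - x)) \<le> block_sum f P z" for z
  proof -
    have "block_sum f P x + ereal (q \<bullet> (z - x)) = (\<Sum>i\<in>UNIV. ereal (a i + P i q \<bullet> (P i z - P i x)))"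
      unfolding x inner_blocks[OF P, of q] by (simp add: sum.distrib blinfun.diff_right)
    also have "\<dots> \<le> (\<Sum>i\<in>UNIV. f i (P i z))"
      by (intro sum_mono) (use * in \<open>simp add: a flip: plus_ereal.simps(1)\<close>)
    finally show ?thesis by (simp add: block_sum_def)
  qed
  then show "q \<in> subdiff (block_sum f P) x" by (auto simp: subdiff_def x)
qed

text \<open>Monotonicity passes to a single block by testing with a point that differs from
  \<open>xh\<close> in this block only.\<close>

lemma monotonicity_block:
  assumes P: "orth_resolution P" and f: "\<And>i x. f i x \<noteq> -\<infinity>"
    and mono: "monotonicity_property (block_sum f P) P xh U \<gamma>"
    and qh: "qh \<in> subdiff (block_sum f P) xh"
    and q: "P j q \<in> subdiff (\<lambda>x. f j (P j x)) x"
    and U: "xh + P j (x - xh) \<in> U"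
  shows "\<gamma> j * (norm (P j (x - xh)))\<^sup>2 \<le> P j (q - qh) \<bullet> P j (x - xh)"
proof -
  define q' where "q' = qh + P j (q - qh)"
  define x' where "x' = xh + P j (x - xh)"
  have Pq: "P k q' = (if k = j then P j q else P k qh)" for k
    by (simp add: q'_def blinfun.add_right proj_proj[OF P] blinfun.diff_right)
  have Px: "P k x' = (if k = j then P j x else P k xh)" for k
    by (simp add: x'_def blinfun.add_right proj_proj[OF P] blinfun.diff_right)
  have "q' \<in> subdiff (block_sum f P) x'"
    using q qh unfolding subdiff_block_sum_iff[OF P f] block_subdiff_iff[OF P] by (auto simp: Pq Px)
  with mono qh U have "(\<Sum>i\<in>UNIV. \<gamma> i * (norm (P i (x' - xh)))\<^sup>2) \<le> (q' - qh) \<bullet> (x' - xh)"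
    unfolding monotonicity_property_def x'_def by blast
  also have "(\<Sum>i\<in>UNIV. \<gamma> i * (norm (P i (x' - xh)))\<^sup>2) =
      (\<Sum>i\<in>UNIV. if i = j then \<gamma> j * (norm (P j (x - xh)))\<^sup>2 else 0)"
    by (intro sum.cong refl) (simp add: blinfun.diff_right Px)
  finally show ?thesis by (simp add: q'_def x'_def)
qed

lemma scaled_le_imp_nonpos:
  fixes c N :: real
  assumes "\<And>s. 0 < s \<Longrightarrow> s < 1 \<Longrightarrow> c \<le> s * N"
  shows "c \<le> 0"
proof (rule tendsto_lowerbound)
  have "((\<lambda>s. s * N) \<longlongrightarrow> 0 * N) (at_right 0)" by (intro tendsto_intros)
  then show "((\<lambda>s. s * N) \<longlongrightarrow> 0) (at_right 0)" by simp
  show "\<forall>\<^sub>F s in at_right 0. c \<le> s * N"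
    unfolding eventually_at_right_field using assms by (intro exI[of _ 1]) auto
qed simp

text \<open>Moving from \<open>z\<close> by the fraction \<open>s\<close> towards \<open>z'\<close>
  costs only \<open>s * s\<close> in the quadratic part beyond the linear term; dividing by
  \<open>s\<close> and letting it tend to 0 leaves the subgradient inequality relative to
  \<open>V\<close>. The point \<open>u\<close> forces a finite value at the minimiser.\<close>

lemma prox_point_variational:
  fixes f :: "'a::real_inner \<Rightarrow> ereal"
  assumes cvx: "convex_fun f" and f: "\<And>x. f x \<noteq> -\<infinity>" and V: "subspace V"
    and u: "u \<in> V" "f u \<noteq> \<infinity>" and t: "0 < t" and prox: "prox_point f V t v z"
  shows "z \<in> V" "\<bar>f z\<bar> \<noteq> \<infinity>"
    "\<And>z'. z' \<in> V \<Longrightarrow> f z + ereal ((1 / t) *\<^sub>R (v - z) \<bullet> (z' - z)) \<le> f z'"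
proof -
  have z: "z \<in> V" and min: "\<And>z'. z' \<in> V \<Longrightarrow>
      f z + ereal ((norm (z - v))\<^sup>2 / (2 * t)) \<le> f z' + ereal ((norm (z' - v))\<^sup>2 / (2 * t))"
    using prox by (auto simp: prox_point_def is_arg_min_def not_less)
  show "z \<in> V" by fact
  show fz: "\<bar>f z\<bar> \<noteq> \<infinity>" using min[OF u(1)] u(2) f[of z] f[of u] by (cases "f z"; cases "f u") auto
  define a where "a = real_of_ereal (f z)"
  have a: "f z = ereal a" using fz by (simp add: a_def ereal_real')
  fix z' assume z': "z' \<in> V"
  show "f z + ereal ((1 / t) *\<^sub>R (v - z) \<bullet> (z' - z)) \<le> f z'"
  proof (cases "f z'")
    case (real b)
    have "a - b + (v - z) \<bullet> (z' - z) / t \<le> s * ((norm (z' - z))\<^sup>2 / (2 * t))" if s: "0 < s" "s < 1" for s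
    proof -
      let ?w = "(1 - s) *\<^sub>R z + s *\<^sub>R z'"
      have "?w \<in> V" using V z z' by (intro subspace_add subspace_scale)
      from min[OF this] have "ereal (a + (norm (z - v))\<^sup>2 / (2 * t)) \<le> f ?w + ereal ((norm (?w - v))\<^sup>2 / (2 * t))"
        by (simp add: a)
      also have "f ?w \<le> ereal (1 - s) * f z + ereal s * f z'"
        using cvx s by (auto simp: convex_fun_def)
      finally have "a + (norm (z - v))\<^sup>2 / (2 * t) \<le> (1 - s) * a + s * b + (norm (?w - v))\<^sup>2 / (2 * t)"
        by (simp add: a real add_right_mono)
      also have "(norm (?w - v))\<^sup>2 = (norm (z - v))\<^sup>2 - 2 * s * ((v - z) \<bullet> (z' - z)) + s * s * (norm (z' - z))\<^sup>2"
        unfolding power2_norm_eq_inner by (simp add: algebra_simps inner_commute)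
      finally have "s * (a - b + (v - z) \<bullet> (z' - z) / t) \<le> s * (s * ((norm (z' - z))\<^sup>2 / (2 * t)))"
        using t by (simp add: field_simps)
      then show ?thesis by (rule mult_left_le_imp_le) (rule s)
    qed
    then have "a - b + (v - z) \<bullet> (z' - z) / t \<le> 0" by (rule scaled_le_imp_nonpos)
    then show ?thesis by (simp add: a real)
  qed (use f in auto)
qed

text \<open>Adding the variational inequalities of both points leaves their squared distance.
  Uniqueness makes a trajectory a function of the sampled sets.\<close>

lemma prox_point_unique:
  fixes f :: "'a::real_inner \<Rightarrow> ereal"
  assumes "convex_fun f" "\<And>x. f x \<noteq> -\<infinity>" "subspace V" "u \<in> V" "f u \<noteq> \<infinity>" "0 < t"
    and z: "prox_point f V t v z" and z': "prox_point f V t v z'"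
  shows "z = z'"
proof -
  note 1 = prox_point_variational[OF assms(1-6) z] and 2 = prox_point_variational[OF assms(1-6) z']
  have "((1 / t) *\<^sub>R (v - z) \<bullet> (z' - z)) + ((1 / t) *\<^sub>R (v - z') \<bullet> (z - z')) \<le> 0"
    using 1(2) 2(2) 1(3)[OF 2(1)] 2(3)[OF 1(1)] by (cases "f z"; cases "f z'") auto
  also have "((1 / t) *\<^sub>R (v - z) \<bullet> (z' - z)) + ((1 / t) *\<^sub>R (v - z') \<bullet> (z - z')) = (norm (z - z'))\<^sup>2 / t"
    using assms(6) by (simp add: power2_norm_eq_inner algebra_simps inner_commute add_divide_distrib diff_divide_distrib)
  finally show ?thesis using assms(6) by (simp add: divide_le_0_iff)
qed

lemma prox_point_block_subdiff:
  fixes P :: "'i::finite \<Rightarrow> 'a::real_inner \<Rightarrow>\<^sub>L 'a"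
  assumes P: "orth_resolution P" and "convex_fun f" "\<And>x. f x \<noteq> -\<infinity>" "f (P i u) \<noteq> \<infinity>" "0 < t"
    and prox: "prox_point f (range (P i)) t (P i v) (P i z)"
  shows "P i ((1 / t) *\<^sub>R (v - z)) \<in> subdiff (\<lambda>x. f (P i x)) z"
proof -
  have V: "subspace (range (P i))"
    by (intro linear_subspace_image blinfun.bounded_linear_right[THEN bounded_linear.linear] subspace_UNIV)
  note * = prox_point_variational[OF assms(2,3) V rangeI assms(4,5) prox]
  show ?thesis
    unfolding block_subdiff_iff[OF P]
    unfolding blinfun.scaleR_right blinfun.diff_right
    by (intro conjI allI *(2) *(3) rangeI)
qed

lemma convex_fenchel_conj:
  assumes "\<And>x. f x \<noteq> -\<infinity>"
  shows "convex_fun (fenchel_conj f)"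
  unfolding convex_fun_def
proof (intro allI ballI)
  fix u v and t :: real assume t: "t \<in> {0..1}"
  show "fenchel_conj f ((1 - t) *\<^sub>R u + t *\<^sub>R v) \<le> ereal (1 - t) * fenchel_conj f u + ereal t * fenchel_conj f v"
    unfolding fenchel_conj_def[of f "(1 - t) *\<^sub>R u + t *\<^sub>R v"]
  proof (rule SUP_least)
    fix x
    have "ereal (((1 - t) *\<^sub>R u + t *\<^sub>R v) \<bullet> x) - f x =
        ereal (1 - t) * (ereal (u \<bullet> x) - f x) + ereal t * (ereal (v \<bullet> x) - f x)"
    proof (cases "f x")
      case (real a)
      have "((1 - t) *\<^sub>R u + t *\<^sub>R v) \<bullet> x - a = (1 - t) * (u \<bullet> x - a) + t * (v \<bullet> x - a)"
        by (simp add: inner_add_left algebra_simps)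
      then show ?thesis by (simp add: real)
    next
      case PInf
      \<comment> \<open>Both affine values are -\<infinity> here; a zero weight turns one of them
        into 0, but then the other weight is positive.\<close>
      have "0 < t \<or> 0 < 1 - t" using t by auto
      then have "ereal (1 - t) * - \<infinity> + ereal t * - \<infinity> = - \<infinity>" using t by auto
      then show ?thesis by (simp add: PInf)
    qed (use assms in simp)
    also have "\<dots> \<le> ereal (1 - t) * fenchel_conj f u + ereal t * fenchel_conj f v"
      unfolding fenchel_conj_def using t
      by (intro add_mono ereal_mult_left_mono SUP_upper) auto
    finally show "ereal (((1 - t) *\<^sub>R u + t *\<^sub>R v) \<bullet> x) - f x \<le>
      ereal (1 - t) * fenchel_conj f u + ereal t * fenchel_conj f v" .
  qed
qed

lemma fenchel_conj_not_MInf: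
  assumes "f x \<noteq> \<infinity>"
  shows "fenchel_conj f v \<noteq> -\<infinity>"
proof -
  have "ereal (v \<bullet> x) - f x \<le> fenchel_conj f v" unfolding fenchel_conj_def by (intro SUP_upper) auto
  then show ?thesis using assms by (cases "f x") auto
qed

subsection \<open>Taylor remainders and the subspace of linear dual directions\<close>

text \<open>A linear function is its own directional derivative at every base point.\<close>

lemma deriv_along_Y_L:
  fixes K :: "'x::real_inner \<Rightarrow> 'y::real_inner"
  assumes K: "\<And>x. (K has_derivative blinfun_apply (K' x)) (at x)" and u: "u \<in> Y_L K"
  shows "u \<bullet> K' x h = u \<bullet> K h"
proof -
  have lin: "linear (\<lambda>x. u \<bullet> K x)" using u by (simp add: Y_L_def)
  have "((\<lambda>t. u \<bullet> K (x + t *\<^sub>R h)) has_derivative (\<lambda>t. u \<bullet> K' (x + 0 *\<^sub>R h) (t *\<^sub>R h))) (at 0)"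
    by (rule derivative_eq_intros has_derivative_compose[OF _ K] refl | simp)+
  then have "((\<lambda>t. u \<bullet> K (x + t *\<^sub>R h)) has_real_derivative u \<bullet> K' x h) (at 0)"
    by (simp add: has_field_derivative_def blinfun.scaleR_right mult_commute_abs)
  moreover have "(\<lambda>t. u \<bullet> K (x + t *\<^sub>R h)) = (\<lambda>t. u \<bullet> K x + t * (u \<bullet> K h))"
    using linear_add[OF lin] linear_scale[OF lin] by (simp add: fun_eq_iff)
  moreover have "((\<lambda>t. u \<bullet> K x + t * (u \<bullet> K h)) has_real_derivative u \<bullet> K h) (at 0)"
    by (auto intro!: derivative_eq_intros)
  ultimately show ?thesis by (auto dest: DERIV_unique)
qed

text \<open>Together with \<open>deriv_diff_Y_NL\<close> this confines all nonlinear errors to the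
  complement of \<open>Y_L K\<close>, where \<rho> bounds the dual distance.\<close>

lemma taylor_remainder_Y_NL:
  fixes K :: "'x::real_inner \<Rightarrow> 'y::real_inner"
  assumes K: "\<And>x. (K has_derivative blinfun_apply (K' x)) (at x)"
  shows "K z - K x - K' x (z - x) \<in> orthogonal_comp (Y_L K)"
  unfolding orthogonal_comp_def orthogonal_def
proof (intro CollectI ballI)
  fix u assume u: "u \<in> Y_L K"
  then have lin: "linear (\<lambda>x. u \<bullet> K x)" by (simp add: Y_L_def)
  show "u \<bullet> (K z - K x - K' x (z - x)) = 0"
    by (simp add: inner_diff_right deriv_along_Y_L[OF K u] linear_diff[OF lin])
qed

lemma deriv_diff_Y_NL:
  fixes K :: "'x::real_inner \<Rightarrow> 'y::real_inner"
  assumes K: "\<And>x. (K has_derivative blinfun_apply (K' x)) (at x)"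
  shows "K' x h - K' x' h \<in> orthogonal_comp (Y_L K)"
  by (simp add: orthogonal_comp_def orthogonal_def inner_diff_right deriv_along_Y_L[OF K])

text \<open>After testing with \<open>v\<close> and subtracting the quadratic bound, a scalar
  function along the segment remains, whose derivative the Lipschitz property makes
  nonpositive.\<close>

lemma taylor_remainder_inner_le:
  fixes K :: "'x::real_inner \<Rightarrow> 'y::real_inner"
  assumes K: "\<And>x. (K has_derivative blinfun_apply (K' x)) (at x)"
    and L: "L-lipschitz_on U K'" and U: "closed_segment x z \<subseteq> U"
  shows "(K z - K x - K' x (z - x)) \<bullet> v \<le> L / 2 * (norm (z - x))\<^sup>2 * norm v"
proof -
  define h where "h = z - x"
  define g where "g t = (K (x + t *\<^sub>R h) - t *\<^sub>R K' x h) \<bullet> v - L / 2 * t\<^sup>2 * (norm h)\<^sup>2 * norm v" for t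
  have "g 1 \<le> g 0"
  proof (rule DERIV_nonpos_imp_nonincreasing[of 0 1 g])
    fix t :: real assume t: "0 \<le> t" "t \<le> 1"
    let ?y = "x + t *\<^sub>R h"
    have "?y = (1 - t) *\<^sub>R x + t *\<^sub>R z" by (simp add: h_def algebra_simps)
    then have "?y \<in> closed_segment x z" using t by (auto simp: closed_segment_def)
    then have y: "?y \<in> U" "x \<in> U" using U ends_in_segment(1)[of x z] by auto
    have "((\<lambda>t. K (x + t *\<^sub>R h)) has_derivative (\<lambda>s. K' ?y (s *\<^sub>R h))) (at t)"
      by (rule derivative_eq_intros has_derivative_compose[OF _ K] refl | simp)+
    then have "(g has_derivative (\<lambda>s. (K' ?y (s *\<^sub>R h) - s *\<^sub>R K' x h) \<bullet> v
        - L / 2 * (2 * t * s) * (norm h)\<^sup>2 * norm v)) (at t)"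
      unfolding g_def by (auto intro!: derivative_eq_intros simp: fun_eq_iff power2_eq_square algebra_simps)
    then have "(g has_real_derivative ((K' ?y h - K' x h) \<bullet> v - L * t * (norm h)\<^sup>2 * norm v)) (at t)"
      unfolding has_field_derivative_def
      by (rule has_derivative_eq_rhs) (simp add: fun_eq_iff blinfun.scaleR_right algebra_simps)
    moreover have "(K' ?y h - K' x h) \<bullet> v \<le> L * t * (norm h)\<^sup>2 * norm v"
    proof -
      have "(K' ?y h - K' x h) \<bullet> v \<le> norm ((K' ?y - K' x) h) * norm v"
        by (simp add: norm_cauchy_schwarz blinfun.diff_left)
      also have "\<dots> \<le> norm (K' ?y - K' x) * norm h * norm v"
        by (intro mult_right_mono norm_blinfun) auto
      also have "\<dots> \<le> L * (t * norm h) * norm h * norm v"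
        using lipschitz_onD[OF L y] t by (intro mult_right_mono) (auto simp: dist_norm)
      finally show ?thesis by (simp add: power2_eq_square mult_ac)
    qed
    ultimately show "\<exists>y. (g has_real_derivative y) (at t) \<and> y \<le> 0"
      by (intro exI[of _ "(K' ?y h - K' x h) \<bullet> v - L * t * (norm h)\<^sup>2 * norm v"]) simp
  qed simp
  then show ?thesis by (simp add: g_def h_def inner_diff_left)
qed

subsection \<open>Weighted Young inequalities\<close>

lemma inner_young:
  fixes a b :: "'a::real_inner"
  assumes "0 < c"
  shows "a \<bullet> b \<le> c / 2 * (norm a)\<^sup>2 + 1 / (2 * c) * (norm b)\<^sup>2"
proof -
  have "0 \<le> (norm (sqrt c *\<^sub>R a - (1 / sqrt c) *\<^sub>R b))\<^sup>2" by simp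
  also have "\<dots> = c * (norm a)\<^sup>2 - 2 * (a \<bullet> b) + (1 / c) * (norm b)\<^sup>2"
    unfolding power2_norm_eq_inner using assms
    by (simp add: inner_diff_left inner_diff_right inner_commute)
  finally show ?thesis using assms by (simp add: field_simps)
qed

lemma young_real:
  fixes a b c :: real
  assumes "0 < c"
  shows "a * b \<le> c * a\<^sup>2 + b\<^sup>2 / (4 * c)"
proof -
  have "0 \<le> (2 * c * a - b)\<^sup>2 / (4 * c)" using assms by simp
  also have "\<dots> = c * a\<^sup>2 - a * b + b\<^sup>2 / (4 * c)"
    using assms by (simp add: power2_eq_square field_simps)
  finally show ?thesis by simp
qed

text \<open>Only the part \<open>d\<^bsup>2-p\<^esup>\<close> of \<open>d\<close> is estimated by \<open>\<rho>\<close>; this is where \<open>p \<le> 2\<close> enters.\<close>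

lemma young_rpow:
  fixes p r d \<rho> \<zeta> :: real
  assumes p: "1 \<le> p" "p \<le> 2" and \<zeta>: "0 \<le> \<zeta>" "1 < p \<Longrightarrow> 0 < \<zeta>" and d: "0 \<le> d" "d \<le> \<rho>" and r: "0 \<le> r"
  shows "r * d \<le> p powr (- p) * (rpow \<zeta> (1 - p) * rpow \<rho> (2 - p)) * r powr p + (p - 1) * \<zeta> * d\<^sup>2"
proof (cases "p = 1")
  \<comment> \<open>For p = 1 the convention behind \<open>rpow\<close> makes the \<zeta>-factor 1
    even when \<zeta> = 0, and the claim reduces to \<open>d \<le> \<rho>\<close>.\<close>
  case True
  then show ?thesis using d r by (simp add: rpow_def mult.commute mult_right_mono)
next
  case False
  have rpow0: "0 \<le> rpow a b" if "0 \<le> a" for a b using that by (simp add: rpow_def)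
  have p1: "1 < p" using p False by simp
  then have \<zeta>0: "0 < \<zeta>" by (rule \<zeta>(2))
  show ?thesis
  proof (cases "r = 0 \<or> d = 0")
    case True
    then have "r * d = 0" by auto
    also have "0 \<le> p powr (- p) * (rpow \<zeta> (1 - p) * rpow \<rho> (2 - p)) * r powr p + (p - 1) * \<zeta> * d\<^sup>2"
      using rpow0 d \<zeta>0 p1 by (intro add_nonneg_nonneg mult_nonneg_nonneg) auto
    finally show ?thesis .
  next
    case False
    with d r have pos: "0 < r" "0 < d" "0 < \<rho>" by auto
    have \<rho>2: "rpow \<rho> (2 - p) = \<rho> powr (2 - p)" and \<zeta>1: "rpow \<zeta> (1 - p) = \<zeta> powr (1 - p)"
      using pos p1 by (auto simp: rpow_def)
    \<comment> \<open>Chosen so that Young's inequality with weights 1 / p and (p - 1) / p returns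
      exactly the two terms of the claim; the powers of p and \<zeta> cancel in
      \<open>a * b powr (p - 1)\<close>.\<close>
    define a where "a = p powr (1 - p) * \<zeta> powr (1 - p) * \<rho> powr (2 - p) * r powr p"
    define b where "b = p * \<zeta> * d\<^sup>2"
    have ab: "0 < a" "0 < b" using pos \<zeta>0 p1 by (auto simp: a_def b_def)
    have "(r * d) powr p = r powr p * d powr (2 - p) * d powr (2 * (p - 1))"
      using pos by (simp add: powr_mult algebra_simps flip: powr_add)
    also have "\<dots> \<le> r powr p * \<rho> powr (2 - p) * d powr (2 * (p - 1))"
      using pos p d by (intro mult_right_mono mult_left_mono powr_mono2) auto
    also have "\<dots> = a * b powr (p - 1)"
    proof -
      have "d\<^sup>2 powr (p - 1) = d powr (2 * (p - 1))"
        using pos by (simp add: powr_powr flip: powr_numeral)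
      then have "b powr (p - 1) = p powr (p - 1) * \<zeta> powr (p - 1) * d powr (2 * (p - 1))"
        using \<zeta>0 p1 by (simp add: b_def powr_mult)
      moreover have "p powr (1 - p) * p powr (p - 1) = 1" "\<zeta> powr (1 - p) * \<zeta> powr (p - 1) = 1"
        using p1 \<zeta>0 by (simp_all flip: powr_add)
      ultimately show ?thesis unfolding a_def by (simp add: mult_ac)
    qed
    finally have "((r * d) powr p) powr (1 / p) \<le> (a * b powr (p - 1)) powr (1 / p)"
      using p1 by (intro powr_mono2) auto
    then have "r * d \<le> a powr (1 / p) * b powr ((p - 1) / p)"
      using pos p1 ab by (simp add: powr_powr powr_mult)
    also have "\<dots> \<le> (1 / p) * a + ((p - 1) / p) * b"
      using Youngs_inequality_0[of "1 / p" "(p - 1) / p" a b] p1 ab by (simp add: field_simps)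
    also have "(1 / p) * a = p powr (- p) * (\<zeta> powr (1 - p) * \<rho> powr (2 - p)) * r powr p"
    proof -
      have "(1 / p) * p powr (1 - p) = p powr (- p)" using p1 by (simp add: powr_diff powr_minus_divide)
      then show ?thesis unfolding a_def by (simp only: mult.assoc[symmetric])
    qed
    also have "((p - 1) / p) * b = (p - 1) * \<zeta> * d\<^sup>2" using p1 by (simp add: b_def)
    finally show ?thesis by (simp add: \<rho>2 \<zeta>1)
  qed
qed

subsection \<open>The coupling term\<close>

text \<open>Each pair that is not known to be orthogonal is split by Young's inequality with weight
  \<open>w l k\<close>. As \<open>w k l\<close> is the reciprocal, the two halves are mirror images,
  and exchanging the sums merges them.\<close>

lemma norm2_sum_le_weighted:
  fixes u :: "'n::finite \<Rightarrow> 'a::real_inner"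
  assumes w: "\<And>l k. 0 < w l k" "\<And>l k. w l k = 1 / w k l"
    and V: "\<And>l k. k \<notin> V l \<Longrightarrow> u l \<bullet> u k = 0" and sym: "\<And>l k. k \<in> V l \<Longrightarrow> l \<in> V k"
  shows "(norm (\<Sum>l\<in>UNIV. u l))\<^sup>2 \<le> (\<Sum>l\<in>UNIV. (\<Sum>k\<in>V l. w l k) * (norm (u l))\<^sup>2)"
proof -
  have "(norm (\<Sum>l\<in>UNIV. u l))\<^sup>2 = (\<Sum>l\<in>UNIV. \<Sum>k\<in>UNIV. u l \<bullet> u k)"
    by (simp add: power2_norm_eq_inner inner_sum_left inner_sum_right) (rule sum.swap)
  also have "\<dots> \<le> (\<Sum>l\<in>UNIV. \<Sum>k\<in>UNIV. if k \<in> V l then w l k / 2 * (norm (u l))\<^sup>2 + w k l / 2 * (norm (u k))\<^sup>2 else 0)"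
  proof (intro sum_mono)
    fix l k
    have e: "1 / (2 * w l k) = w k l / 2" using w(2)[of k l] by simp
    show "u l \<bullet> u k \<le> (if k \<in> V l then w l k / 2 * (norm (u l))\<^sup>2 + w k l / 2 * (norm (u k))\<^sup>2 else 0)"
      using V[of k l] inner_young[OF w(1)[of l k], of "u l" "u k"] unfolding e by auto
  qed
  also have "\<dots> = (\<Sum>l\<in>UNIV. \<Sum>k\<in>UNIV. if k \<in> V l then w l k / 2 * (norm (u l))\<^sup>2 else 0)
      + (\<Sum>l\<in>UNIV. \<Sum>k\<in>UNIV. if k \<in> V l then w k l / 2 * (norm (u k))\<^sup>2 else 0)"
    by (simp add: if_distrib sum.distrib[symmetric] cong: if_cong)
  also have "(\<Sum>l\<in>UNIV. \<Sum>k\<in>UNIV. if k \<in> V l then w k l / 2 * (norm (u k))\<^sup>2 else 0) =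
      (\<Sum>l\<in>UNIV. \<Sum>k\<in>UNIV. if k \<in> V l then w l k / 2 * (norm (u l))\<^sup>2 else 0)"
    by (subst sum.swap) (intro sum.cong refl if_cong, use sym in blast)
  also have "(\<Sum>l\<in>UNIV. \<Sum>k\<in>UNIV. if k \<in> V l then w l k / 2 * (norm (u l))\<^sup>2 else 0)
      = (\<Sum>l\<in>UNIV. (\<Sum>k\<in>V l. w l k) * (norm (u l))\<^sup>2) / 2"
    by (simp add: sum.If_cases sum_distrib_right sum_divide_distrib)
  finally show ?thesis by simp
qed

text \<open>\<open>V_bar\<close> lists the pairs (l, k) whose contributions to block
  \<open>j\<close> may fail to be orthogonal; it is symmetric because the operators for (l, k) and
  (k, l) are adjoint to each other.\<close>

lemma norm2_proj_adj_le:
  fixes K' :: "'x::{real_inner, banach} \<Rightarrow> 'x \<Rightarrow>\<^sub>L 'y::{real_inner, banach}"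
  assumes P: "orth_resolution P" and Q: "orth_resolution Q"
    and w: "\<And>l k. 0 < w j l k" "\<And>l k. w j l k = 1 / w j k l" and j: "j \<in> S"
  shows "(norm (P j (adj (K' x) v)))\<^sup>2 \<le>
    (\<Sum>l\<in>UNIV. block_weight w K' P Q S x j l * (norm (P j (adj (K' x) (Q l v))))\<^sup>2)"
proof -
  define u where "u l = P j (adj (K' x) (Q l v))" for l
  define V where "V l = V_bar K' P Q S x j l" for l
  have move: "a \<bullet> Q l (K' x (P j b)) = P j (adj (K' x) (Q l a)) \<bullet> b" for a b l
    by (simp add: proj_sym[OF P] proj_sym[OF Q, symmetric] adj_works')
  have "(\<Sum>l\<in>UNIV. u l) = P j (\<Sum>l\<in>UNIV. adj (K' x) (Q l v))"
    by (simp add: u_def blinfun.sum_right)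
  also have "(\<Sum>l\<in>UNIV. adj (K' x) (Q l v)) = adj (K' x) (\<Sum>l\<in>UNIV. Q l v)"
    by (rule linear_sum[OF linear_adj, symmetric])
  finally have sum: "P j (adj (K' x) v) = (\<Sum>l\<in>UNIV. u l)" by (simp add: proj_sum[OF Q])
  have "(norm (\<Sum>l\<in>UNIV. u l))\<^sup>2 \<le> (\<Sum>l\<in>UNIV. (\<Sum>k\<in>V l. w j l k) * (norm (u l))\<^sup>2)"
  proof (rule norm2_sum_le_weighted[OF w])
    fix l k assume "k \<notin> V l"
    then have "Q l (K' x (P j (adj (K' x) (Q k v)))) = 0"
      using j unfolding V_def V_bar_def by (auto dest: fun_cong)
    then have "v \<bullet> Q l (K' x (P j (adj (K' x) (Q k v)))) = 0" by simp
    then show "u l \<bullet> u k = 0" unfolding move u_def by (simp add: proj_inner[OF P])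
  next
    fix l k assume k: "k \<in> V l"
    show "l \<in> V k"
    proof (rule ccontr)
      assume "l \<notin> V k"
      then have 0: "Q k (K' x (P j (adj (K' x) (Q l y)))) = 0" for y
        using j unfolding V_def V_bar_def by (auto dest: fun_cong)
      have "Q l (K' x (P j (adj (K' x) (Q k y)))) = 0" for y
      proof (rule vector_eq_ldot[THEN iffD1], rule allI)
        fix a
        have "a \<bullet> Q l (K' x (P j (adj (K' x) (Q k y)))) = P j (adj (K' x) (Q l a)) \<bullet> adj (K' x) (Q k y)"
          by (rule move)
        also have "\<dots> = y \<bullet> Q k (K' x (P j (adj (K' x) (Q l a))))"
          unfolding move by (metis inner_commute proj_sym[OF P])
        also have "\<dots> = a \<bullet> 0" by (simp add: 0)
        finally show "a \<bullet> Q l (K' x (P j (adj (K' x) (Q k y)))) = a \<bullet> 0" .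
      qed
      with k show False by (auto simp: V_def V_bar_def)
    qed
  qed
  also have "\<dots> = (\<Sum>l\<in>UNIV. block_weight w K' P Q S x j l * (norm (u l))\<^sup>2)"
  proof (intro sum.cong refl)
    fix l
    \<comment> \<open>Where the operator block vanishes so does \<open>u l\<close>, so the default
      weight 0 loses nothing.\<close>
    have "u l = 0" if "Q l o\<^sub>L K' x o\<^sub>L P j = 0"
    proof -
      have "Q l (K' x (P j b)) = 0" for b using arg_cong[OF that, of "\<lambda>f. blinfun_apply f b"] by simp
      then have "u l \<bullet> u l = 0" using move[of v l "u l"] by (simp add: u_def)
      then show ?thesis by simp
    qed
    then show "(\<Sum>k\<in>V l. w j l k) * (norm (u l))\<^sup>2 = block_weight w K' P Q S x j l * (norm (u l))\<^sup>2"
      by (auto simp: block_weight_def V_def)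
  qed
  finally show ?thesis by (simp add: sum u_def)
qed

text \<open>Young's inequality on each primal block spends the share 1 - \<delta> of the proximal
  weight; the squares left for a fixed dual block are controlled by the operator norm in the
  \<kappa>-condition.\<close>

lemma coupling_le:
  fixes K' :: "'x::{real_inner, banach} \<Rightarrow> 'x \<Rightarrow>\<^sub>L 'y::{real_inner, banach}"
  assumes P: "orth_resolution P" and Q: "orth_resolution Q"
    and w: "\<And>j l k. 0 < w j l k" "\<And>j l k. w j l k = 1 / w j k l"
    and pos: "\<And>j. 0 < \<pi> j" "\<And>j. 0 < t j" "\<And>l. 0 < s l" "\<delta> < 1"
    and \<kappa>: "\<And>l. (norm (\<Sum>j\<in>S. sqrt (block_weight w K' P Q S x j l * s l * t j / \<pi> j)
                   *\<^sub>R (Q l o\<^sub>L K' x o\<^sub>L P j)))\<^sup>2 \<le> 1 - \<kappa>"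
  shows "(\<Sum>j\<in>S. (1 / \<pi> j) * (K' x (P j u) \<bullet> v)) \<le>
      (\<Sum>j\<in>S. (1 - \<delta>) / (2 * \<pi> j * t j) * (norm (P j u))\<^sup>2)
      + (\<Sum>l\<in>UNIV. (1 - \<kappa>) / (1 - \<delta>) / (2 * s l) * (norm (Q l v))\<^sup>2)"
proof -
  define W where "W j l = block_weight w K' P Q S x j l" for j l
  define z where "z j l = P j (adj (K' x) (Q l v))" for j l
  have W0: "0 \<le> W j l" for j l
    unfolding W_def block_weight_def by (simp add: sum_nonneg less_imp_le w(1))
  have block: "(1 / \<pi> j) * (K' x (P j u) \<bullet> v) \<le> (1 - \<delta>) / (2 * \<pi> j * t j) * (norm (P j u))\<^sup>2
      + (\<Sum>l\<in>UNIV. 1 / ((1 - \<delta>) * (2 * s l)) * (W j l * s l * t j / \<pi> j * (norm (z j l))\<^sup>2))"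
    if j: "j \<in> S" for j
  proof -
    have c: "0 < (1 - \<delta>) / t j" using pos by simp
    have "K' x (P j u) \<bullet> v = P j u \<bullet> P j (adj (K' x) v)"
      by (simp only: adj_works[of "K' x"] proj_inner[OF P])
    also have "\<dots> \<le> (1 - \<delta>) / t j / 2 * (norm (P j u))\<^sup>2 + 1 / (2 * ((1 - \<delta>) / t j)) * (norm (P j (adj (K' x) v)))\<^sup>2"
      by (rule inner_young[OF c])
    also have "\<dots> \<le> (1 - \<delta>) / t j / 2 * (norm (P j u))\<^sup>2 + 1 / (2 * ((1 - \<delta>) / t j)) * (\<Sum>l\<in>UNIV. W j l * (norm (z j l))\<^sup>2)"
      unfolding W_def z_def using c
      by (intro add_left_mono mult_left_mono norm2_proj_adj_le P Q w j) (simp add: less_imp_le pos)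
    finally have "(1 / \<pi> j) * (K' x (P j u) \<bullet> v) \<le> (1 / \<pi> j) * \<dots>"
      using pos by (intro mult_left_mono) (auto intro: less_imp_le)
    also have "(1 / \<pi> j) * ((1 - \<delta>) / t j / 2 * (norm (P j u))\<^sup>2 + 1 / (2 * ((1 - \<delta>) / t j)) * (\<Sum>l\<in>UNIV. W j l * (norm (z j l))\<^sup>2))
      = (1 - \<delta>) / (2 * \<pi> j * t j) * (norm (P j u))\<^sup>2
      + (\<Sum>l\<in>UNIV. (1 / \<pi> j) * (1 / (2 * ((1 - \<delta>) / t j)) * (W j l * (norm (z j l))\<^sup>2)))"
      unfolding distrib_left sum_distrib_left by (simp add: mult_ac)
    also have "(\<Sum>l\<in>UNIV. (1 / \<pi> j) * (1 / (2 * ((1 - \<delta>) / t j)) * (W j l * (norm (z j l))\<^sup>2))) =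
      (\<Sum>l\<in>UNIV. 1 / ((1 - \<delta>) * (2 * s l)) * (W j l * s l * t j / \<pi> j * (norm (z j l))\<^sup>2))"
    proof (intro sum.cong refl)
      fix l
      show "(1 / \<pi> j) * (1 / (2 * ((1 - \<delta>) / t j)) * (W j l * (norm (z j l))\<^sup>2)) =
        1 / ((1 - \<delta>) * (2 * s l)) * (W j l * s l * t j / \<pi> j * (norm (z j l))\<^sup>2)"
        using pos(1)[of j] pos(2)[of j] pos(3)[of l] pos(4) by (simp add: divide_simps)
    qed
    finally show ?thesis .
  qed
  have op: "(\<Sum>j\<in>S. W j l * s l * t j / \<pi> j * (norm (z j l))\<^sup>2) \<le> (1 - \<kappa>) * (norm (Q l v))\<^sup>2" for l
  proof -
    \<comment> \<open>\<open>B\<close> is the operator of the \<kappa>-condition. The ranges of the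
      \<open>P j\<close> are orthogonal, so the squared norm of its adjoint collects the weighted
      squares over \<open>j\<close> without cross terms.\<close>
    define c where "c j = sqrt (W j l * s l * t j / \<pi> j)" for j
    define B where "B = (\<Sum>j\<in>S. c j *\<^sub>R (Q l o\<^sub>L K' x o\<^sub>L P j))"
    define d where "d j = (if j \<in> S then c j else 0)" for j
    have c2: "(c j)\<^sup>2 = W j l * s l * t j / \<pi> j" for j
      unfolding c_def using W0[of j l] pos(1)[of j] pos(2)[of j] pos(3)[of l] by simp
    have "a \<bullet> adj B (Q l v) = a \<bullet> (\<Sum>j\<in>S. c j *\<^sub>R z j l)" for a
    proof -
      have "a \<bullet> adj B (Q l v) = (\<Sum>j\<in>S. c j * (Q l (K' x (P j a)) \<bullet> Q l v))"
        by (simp add: adj_works[symmetric] B_def blinfun.sum_left blinfun.scaleR_left inner_sum_left)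
      also have "\<dots> = (\<Sum>j\<in>S. c j * (a \<bullet> z j l))"
        by (simp only: proj_inner(1)[OF Q] proj_sym[OF Q] proj_idem[OF Q] adj_works[of "K' x"] z_def proj_sym[OF P])
      finally show ?thesis by (simp add: inner_sum_right)
    qed
    then have "adj B (Q l v) = (\<Sum>j\<in>S. c j *\<^sub>R z j l)" by (metis vector_eq_ldot)
    also have "\<dots> = (\<Sum>j\<in>UNIV. d j *\<^sub>R P j (adj (K' x) (Q l v)))"
      by (rule sum.mono_neutral_cong_left) (auto simp: d_def z_def)
    finally have B: "adj B (Q l v) = \<dots>" .
    have "(norm (adj B (Q l v)))\<^sup>2 = (\<Sum>j\<in>UNIV. (d j)\<^sup>2 * (norm (z j l))\<^sup>2)"
      unfolding B norm2_blocks[OF P, of "sum _ _"] proj_scaled_sum[OF P]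
      by (simp add: power_mult_distrib z_def)
    also have "\<dots> = (\<Sum>j\<in>S. (c j)\<^sup>2 * (norm (z j l))\<^sup>2)"
      by (rule sum.mono_neutral_cong_right) (auto simp: d_def)
    finally have "(\<Sum>j\<in>S. W j l * s l * t j / \<pi> j * (norm (z j l))\<^sup>2) = (norm (adj B (Q l v)))\<^sup>2"
      by (simp add: c2)
    also have "\<dots> \<le> (norm B * norm (Q l v))\<^sup>2" by (intro power_mono norm_adj_le) auto
    also have "\<dots> = (norm B)\<^sup>2 * (norm (Q l v))\<^sup>2" by (rule power_mult_distrib)
    also have "\<dots> \<le> (1 - \<kappa>) * (norm (Q l v))\<^sup>2"
      unfolding B_def c_def W_def by (intro mult_right_mono \<kappa>) auto
    finally show ?thesis .
  qed
  have "(\<Sum>j\<in>S. (1 / \<pi> j) * (K' x (P j u) \<bullet> v)) \<le>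
      (\<Sum>j\<in>S. (1 - \<delta>) / (2 * \<pi> j * t j) * (norm (P j u))\<^sup>2
      + (\<Sum>l\<in>UNIV. 1 / ((1 - \<delta>) * (2 * s l)) * (W j l * s l * t j / \<pi> j * (norm (z j l))\<^sup>2)))"
    by (intro sum_mono block)
  also have "\<dots> = (\<Sum>j\<in>S. (1 - \<delta>) / (2 * \<pi> j * t j) * (norm (P j u))\<^sup>2)
      + (\<Sum>l\<in>UNIV. 1 / ((1 - \<delta>) * (2 * s l)) * (\<Sum>j\<in>S. W j l * s l * t j / \<pi> j * (norm (z j l))\<^sup>2))"
    unfolding sum.distrib sum_distrib_left by (subst (2) sum.swap) simp
  also have "\<dots> \<le> (\<Sum>j\<in>S. (1 - \<delta>) / (2 * \<pi> j * t j) * (norm (P j u))\<^sup>2)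
      + (\<Sum>l\<in>UNIV. 1 / ((1 - \<delta>) * (2 * s l)) * ((1 - \<kappa>) * (norm (Q l v))\<^sup>2))"
    using pos by (intro add_left_mono sum_mono mult_left_mono op) (simp add: less_imp_le)
  finally show ?thesis by simp
qed

subsection \<open>Descent in one iteration\<close>

text \<open>Here c is the sampling probability, g the strong monotonicity and t the gain demanded by
  the step length rule; the monotonicity left over at the new error \<open>u\<close> is moved to the
  old error \<open>d\<close>. The two sides differ by a square divided by \<open>k\<close>, and the
  factor at the squared step is the fraction in the \<delta>-condition.\<close>

lemma strong_monotonicity_split:
  fixes u d :: "'a::real_inner"
  assumes c: "0 < c" "c \<le> 1" and t: "0 < t" "t < c * g"
  shows "(1 - c) * g * (norm d)\<^sup>2 \<le>
    (g - t) * (norm u)\<^sup>2 + (1 - c) * g * ((g - t) / (c * g - t)) * (norm (u - d))\<^sup>2"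
proof -
  define k m where "k = c * g - t" and "m = (1 - c) * g"
  have k: "0 < k" using t by (simp add: k_def)
  have gt: "g - t = k + m" by (simp add: k_def m_def algebra_simps)
  have "0 \<le> (norm (k *\<^sub>R u + m *\<^sub>R (u - d)))\<^sup>2 / k" using k by simp
  also have "\<dots> = (k + m) * (norm u)\<^sup>2 + m * ((k + m) / k) * (norm (u - d))\<^sup>2 - m * (norm d)\<^sup>2"
    unfolding power2_norm_eq_inner using k
    by (simp add: inner_diff_left inner_diff_right inner_add_left inner_add_right inner_commute field_simps)
  finally show ?thesis by (simp add: gt flip: k_def m_def)
qed

lemma inner_diff_self: "(a - b) \<bullet> b = ((norm a)\<^sup>2 - (norm b)\<^sup>2 - (norm (b - a))\<^sup>2) / 2"
  for a b :: "'a::real_inner"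
  by (simp add: power2_norm_eq_inner inner_diff_left inner_diff_right inner_commute)

text \<open>The deterministic hypotheses, common to all trajectories. That \<pi> is at most 1 is an
  assumption here; in the theorem it follows from \<pi> being a probability.\<close>

locale block_pdps =
  fixes K :: "'x::{real_inner, banach} \<Rightarrow> 'y::{real_inner, banach}"
    and K' :: "'x \<Rightarrow> 'x \<Rightarrow>\<^sub>L 'y"
    and P :: "'m::finite \<Rightarrow> 'x \<Rightarrow>\<^sub>L 'x" and Q :: "'n::finite \<Rightarrow> 'y \<Rightarrow>\<^sub>L 'y"
    and G :: "'m \<Rightarrow> 'x \<Rightarrow> ereal" and F :: "'n \<Rightarrow> 'y \<Rightarrow> ereal"
    and xh :: 'x and yh :: 'y
    and XK XG :: "'x set" and YF :: "'y set"
    and L L3 p \<alpha>y \<delta> \<kappa> \<rho>x wb Lb :: real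
    and \<gamma>K \<gamma>G \<gamma>Gt \<pi> \<tau>0 :: "'m \<Rightarrow> real" and \<gamma>F \<gamma>Fb \<zeta> \<rho> \<sigma>0 :: "'n \<Rightarrow> real"
    and \<theta> :: "('x \<Rightarrow>\<^sub>L 'x) \<Rightarrow> real"
    and w :: "'m \<Rightarrow> 'n \<Rightarrow> 'n \<Rightarrow> real"
  assumes deriv_K: "\<And>x. (K has_derivative blinfun_apply (K' x)) (at x)"
    and proj_P: "orth_resolution P" and proj_Q: "orth_resolution Q"
    and G: "\<And>j. convex_fun (G j) \<and> proper_fun (G j)"
    and F: "\<And>l. proper_fun (F l)"
    and crit_x: "- adj (K' xh) yh \<in> subdiff (block_sum G P) xh"
    and crit_y: "K xh \<in> subdiff (block_sum (\<lambda>l. fenchel_conj (F l)) Q) yh"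
    and Lipschitz: "L-lipschitz_on XK K'"
    and three_point: "three_point_property K K' P xh yh XK \<gamma>K \<theta> L3 p"
    and L3: "0 \<le> L3" and p: "1 \<le> p" "p \<le> 2"
    and mono_G: "monotonicity_property (block_sum G P) P xh XG \<gamma>G"
    and mono_F: "monotonicity_property (block_sum (\<lambda>l. fenchel_conj (F l)) Q) Q yh YF \<gamma>F"
    and \<alpha>y: "0 < \<alpha>y" and \<zeta>: "\<And>l. 0 \<le> \<zeta> l" "\<And>l. 1 < p \<Longrightarrow> 0 < \<zeta> l"
    and \<gamma>Fb_def: "\<And>l. \<gamma>Fb l = (if \<forall>v. Q l (P_NL K v) = 0 then \<gamma>F l
                                 else \<gamma>F l - (p - 1) * \<zeta> l - \<alpha>y)"
    and \<gamma>Gt: "\<And>j. 0 < \<gamma>Gt j" "\<And>j. \<gamma>Gt j < \<pi> j * (\<gamma>G j + \<gamma>K j)"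
    and \<pi>: "\<And>j. 0 < \<pi> j" "\<And>j. \<pi> j \<le> 1"
    and \<tau>0: "\<And>j. 0 < \<tau>0 j" and \<sigma>0: "\<And>l. 0 < \<sigma>0 l"
    and wb: "0 < wb"
    and w: "\<And>j l k. 0 < w j l k" "\<And>j l k. w j l k = 1 / w j k l"
    and \<delta>\<kappa>: "0 < \<delta>" "\<delta> < \<kappa>" "\<kappa> < 1"
    and \<rho>: "0 \<le> \<rho>x" "\<And>l. 0 \<le> \<rho> l"
    and Lb_def: "Lb = L3 + L / wb * ((MAX j. (wb / \<pi> j + 1)\<^sup>2) * (\<Sum>l\<in>UNIV. \<rho> l)
                                     + real CARD('n) * L / (2 * \<alpha>y) * \<rho>x\<^sup>2)"
begin

definition sampled :: "'m set \<Rightarrow> 'x \<Rightarrow>\<^sub>L 'x" where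
  "sampled S = (\<Sum>j\<in>S. (1 / \<pi> j) *\<^sub>R P j)"

definition kappa_cond :: "'m set \<Rightarrow> 'x \<Rightarrow> bool" where
  "kappa_cond S x \<longleftrightarrow> (\<forall>l. (norm (\<Sum>j\<in>S. sqrt (block_weight w K' P Q S x j l * \<sigma>0 l * \<tau>0 j / \<pi> j)
                      *\<^sub>R (Q l o\<^sub>L K' x o\<^sub>L P j)))\<^sup>2 \<le> 1 - \<kappa>)"

definition delta_cond :: "'m set \<Rightarrow> bool" where
  "delta_cond S \<longleftrightarrow> (\<forall>j\<in>S. \<tau>0 j * (Lb + 2 * (1 - \<pi> j) * (\<gamma>G j + \<gamma>K j)
      * ((\<gamma>G j + \<gamma>K j - \<gamma>Gt j) / (\<pi> j * (\<gamma>G j + \<gamma>K j) - \<gamma>Gt j))) \<le> \<delta>)"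

text \<open>The lower bound asked of the conditional mean of \<theta>; up to the factor
  \<open>wb\<close> it is the coefficient with which the Taylor remainder at \<open>xh\<close>
  enters the nonlinear errors.\<close>

definition c\<theta> :: real where
  "c\<theta> = p powr (- p) * (\<Sum>l\<in>UNIV. rpow (\<zeta> l) (1 - p) * rpow (\<rho> l) (2 - p) / wb)"

definition remainder :: "'x \<Rightarrow> 'y" where
  "remainder x = K xh - K x - K' x (xh - x)"

lemma G_not_MInf: "G j u \<noteq> -\<infinity>"
  using G[of j] by (auto simp: proper_fun_def)

lemma F_conj_not_MInf: "fenchel_conj (F l) v \<noteq> -\<infinity>"
  using F[of l] fenchel_conj_not_MInf by (auto simp: proper_fun_def)

lemma F_conj_convex: "convex_fun (fenchel_conj (F l))"
  using F[of l] by (intro convex_fenchel_conj) (auto simp: proper_fun_def)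

text \<open>Like \<open>F_conj_finite_at_yh\<close>, this provides the point of finite value
  required by the characterisation of proximal points.\<close>

lemma G_finite_at_xh: "G j (P j xh) \<noteq> \<infinity>"
proof -
  have "P j (- adj (K' xh) yh) \<in> subdiff (\<lambda>x. G j (P j x)) xh"
    using crit_x subdiff_block_sum_iff[of P G, OF proj_P G_not_MInf] by blast
  then show ?thesis by (auto simp: subdiff_def)
qed

lemma F_conj_finite_at_yh: "fenchel_conj (F l) (Q l yh) \<noteq> \<infinity>"
proof -
  have "Q l (K xh) \<in> subdiff (\<lambda>y. fenchel_conj (F l) (Q l y)) yh"
    using crit_y subdiff_block_sum_iff[of Q "\<lambda>l. fenchel_conj (F l)", OF proj_Q F_conj_not_MInf] by blast
  then show ?thesis by (auto simp: subdiff_def)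
qed

lemma sampled_apply: "sampled S u = (\<Sum>j\<in>S. (1 / \<pi> j) *\<^sub>R P j u)"
  by (simp add: sampled_def blinfun.sum_left blinfun.scaleR_left)

lemma sampled_alt: "sampled S = (\<Sum>j\<in>UNIV. (if j \<in> S then 1 / \<pi> j else 0) *\<^sub>R P j)"
  unfolding sampled_def by (rule sum.mono_neutral_cong_left) auto

lemma proj_sampled: "P j (sampled S u) = (if j \<in> S then (1 / \<pi> j) *\<^sub>R P j u else 0)"
proof -
  have "sampled S u = (\<Sum>j\<in>UNIV. (if j \<in> S then 1 / \<pi> j else 0) *\<^sub>R P j u)"
    unfolding sampled_alt by (simp add: blinfun.sum_left blinfun.scaleR_left)
  then show ?thesis by (simp add: proj_scaled_sum[OF proj_P])
qed

lemma inner_sampled: "sampled S u \<bullet> v = (\<Sum>j\<in>S. (1 / \<pi> j) * (P j u \<bullet> P j v))"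
  by (simp add: sampled_apply inner_sum_left proj_inner[OF proj_P])

lemma coupling_sampled:
  assumes "kappa_cond S x"
  shows "K' x (sampled S u) \<bullet> v \<le> (\<Sum>j\<in>S. (1 - \<delta>) / (2 * \<pi> j * \<tau>0 j) * (norm (P j u))\<^sup>2)
      + (\<Sum>l\<in>UNIV. (1 - \<kappa>) / (1 - \<delta>) / (2 * \<sigma>0 l) * (norm (Q l v))\<^sup>2)"
proof -
  have "K' x (sampled S u) \<bullet> v = (\<Sum>j\<in>S. (1 / \<pi> j) * (K' x (P j u) \<bullet> v))"
    by (simp add: sampled_apply blinfun.sum_right blinfun.scaleR_right inner_sum_left)
  also have "\<dots> \<le> (\<Sum>j\<in>S. (1 - \<delta>) / (2 * \<pi> j * \<tau>0 j) * (norm (P j u))\<^sup>2)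
      + (\<Sum>l\<in>UNIV. (1 - \<kappa>) / (1 - \<delta>) / (2 * \<sigma>0 l) * (norm (Q l v))\<^sup>2)"
    using \<delta>\<kappa> assms unfolding kappa_cond_def
    by (intro coupling_le[where w = w] proj_P proj_Q w(1) w(2) \<pi> \<tau>0 \<sigma>0) (linarith, blast)
  finally show ?thesis .
qed

lemma three_point_sampled:
  assumes x: "x \<in> XK" "x' \<in> XK"
  shows "(\<Sum>j\<in>S. \<gamma>K j / \<pi> j * (norm (P j (x' - xh)))\<^sup>2) + \<theta> (sampled S) * norm (remainder x) powr p
      - L3 / 2 * (\<Sum>j\<in>S. (1 / \<pi> j) * (norm (P j (x' - x)))\<^sup>2)
    \<le> adj (K' x - K' xh) yh \<bullet> sampled S (x' - xh)"
proof -
  define a where "a j = (if j \<in> S then 1 / \<pi> j else 0)" for j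
  have a0: "\<forall>j. 0 \<le> a j" using \<pi> by (simp add: a_def less_imp_le)
  have A: "(\<Sum>j\<in>UNIV. a j *\<^sub>R P j) = sampled S" unfolding sampled_alt a_def ..
  let ?\<Gamma> = "(\<Sum>j\<in>UNIV. \<gamma>K j *\<^sub>R P j)"
  have \<Gamma>: "P j (?\<Gamma> u) = \<gamma>K j *\<^sub>R P j u" for j u
    by (simp add: blinfun.sum_left blinfun.scaleR_left proj_scaled_sum[OF proj_P])
  have 1: "sampled S u \<bullet> v = u \<bullet> sampled S v" for u v
  proof -
    have "sampled S u \<bullet> v = (\<Sum>j\<in>S. (1 / \<pi> j) * (P j v \<bullet> P j u))"
      unfolding inner_sampled by (intro sum.cong refl arg_cong2[of _ _ _ _ "(*)"] inner_commute)
    also have "\<dots> = sampled S v \<bullet> u" by (rule inner_sampled[symmetric])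
    finally show ?thesis by (simp only: inner_commute)
  qed
  have 2: "sqnorm_op (sampled S o\<^sub>L ?\<Gamma>) u = (\<Sum>j\<in>S. \<gamma>K j / \<pi> j * (norm (P j u))\<^sup>2)" for u
    by (simp add: sqnorm_op_def inner_sampled \<Gamma> power2_norm_eq_inner)
  have 3: "sqnorm_op (sampled S) u = (\<Sum>j\<in>S. (1 / \<pi> j) * (norm (P j u))\<^sup>2)" for u
    by (simp add: sqnorm_op_def inner_sampled power2_norm_eq_inner)
  have "inner_op (sampled S) (adj (K' x - K' xh) yh) (x' - xh)
                \<ge> sqnorm_op (sampled S o\<^sub>L ?\<Gamma>) (x' - xh)
                   + \<theta> (sampled S) * norm (K xh - K x - K' x (xh - x)) powr p
                   - L3 / 2 * sqnorm_op (sampled S) (x' - x)"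
    using three_point[unfolded three_point_property_def Let_def, THEN spec, of a, THEN mp, OF a0] x
    unfolding A by blast
  then show ?thesis unfolding inner_op_def 1 2 3 remainder_def .
qed

end

text \<open>\<open>\<tau>\<close> carries the index i of the old iterate, whereas \<open>s\<close>
  is \<sigma> at i + 1. The dual inequality is divided by \<open>wb\<close>, so the dual proximal
  weight is governed by \<open>wb * s\<close>, and this product is compared with the initial
  step.\<close>

locale block_pdps_step = block_pdps +
  fixes S :: "'c set" and x x1 xb :: 'a and y y1 :: 'b and \<tau> :: "'c \<Rightarrow> real" and s :: "'d \<Rightarrow> real"
  assumes \<tau>: "\<And>j. 0 < \<tau> j" "\<And>j. \<tau> j \<le> \<tau>0 j"
    and s: "\<And>l. 0 < s l" "\<And>l. wb * s l \<le> \<sigma>0 l"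
    and x_prox: "\<And>j. j \<in> S \<Longrightarrow> prox_point (G j) (range (P j)) (\<tau> j)
                 (P j x - \<tau> j *\<^sub>R P j (adj (K' x) y)) (P j x1)"
    and xb_upd: "\<And>j. j \<in> S \<Longrightarrow> P j xb = P j x1 + (wb / \<pi> j) *\<^sub>R (P j x1 - P j x)"
    and x_keep: "\<And>j. j \<notin> S \<Longrightarrow> P j x1 = P j x" "\<And>j. j \<notin> S \<Longrightarrow> P j xb = P j x"
    and y_prox: "\<And>l. prox_point (fenchel_conj (F l)) (range (Q l)) (s l)
            (Q l y + s l *\<^sub>R Q l (K xb)) (Q l y1)"
    and seg: "closed_segment x xb \<subseteq> XK" and x1_XK: "x1 \<in> XK"
    and XG: "\<And>j. j \<in> S \<Longrightarrow> xh + P j (x1 - xh) \<in> XG" and YF: "y1 \<in> YF"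
    and kappa: "kappa_cond S x" and delta: "delta_cond S"
    and \<rho>x_bound: "norm (x1 - xh) \<le> \<rho>x"
    and \<rho>_bound: "\<And>l. norm_op (P_NL K) (Q l (y1 - yh)) \<le> \<rho> l"
begin

text \<open>The implicit step produces a subgradient on the sampled blocks only, so monotonicity is
  used blockwise, with test weight 1 / \<pi>.\<close>

lemma primal_monotonicity:
  assumes j: "j \<in> S"
  shows "(1 / \<pi> j) * (\<gamma>G j * (norm (P j (x1 - xh)))\<^sup>2 + (adj (K' x) y - adj (K' xh) yh) \<bullet> P j (x1 - xh))
    \<le> 1 / (2 * \<pi> j * \<tau> j) * ((norm (P j (x - xh)))\<^sup>2 - (norm (P j (x1 - xh)))\<^sup>2 - (norm (P j (x1 - x)))\<^sup>2)"
proof -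
  define q where "q = (1 / \<tau> j) *\<^sub>R (x - \<tau> j *\<^sub>R adj (K' x) y - x1)"
  have "P j q \<in> subdiff (\<lambda>x. G j (P j x)) x1"
    unfolding q_def using G[of j] G_finite_at_xh x_prox[OF j]
    by (intro prox_point_block_subdiff[OF proj_P _ G_not_MInf])
       (auto simp: \<tau> blinfun.diff_right blinfun.scaleR_right)
  from monotonicity_block[where f = G, OF proj_P G_not_MInf mono_G crit_x this XG[OF j]]
  have "\<gamma>G j * (norm (P j (x1 - xh)))\<^sup>2 \<le> P j (q + adj (K' xh) yh) \<bullet> P j (x1 - xh)" by simp
  also have "q = (1 / \<tau> j) *\<^sub>R ((x - xh) - (x1 - xh)) - adj (K' x) y"
    using \<tau>(1)[of j] by (simp add: q_def algebra_simps)
  also have "P j ((1 / \<tau> j) *\<^sub>R ((x - xh) - (x1 - xh)) - adj (K' x) y + adj (K' xh) yh) \<bullet> P j (x1 - xh) =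
      (1 / \<tau> j) * ((P j (x - xh) - P j (x1 - xh)) \<bullet> P j (x1 - xh))
      - (adj (K' x) y - adj (K' xh) yh) \<bullet> P j (x1 - xh)"
  proof -
    have "((x - xh) - (x1 - xh)) \<bullet> P j (x1 - xh) = (P j (x - xh) - P j (x1 - xh)) \<bullet> P j (x1 - xh)"
      by (simp only: blinfun.diff_right[symmetric] proj_inner(2)[OF proj_P])
    then show ?thesis
      by (simp only: proj_inner(2)[OF proj_P] inner_diff_left inner_add_left inner_scaleR_left)
  qed
  also have "(P j (x - xh) - P j (x1 - xh)) \<bullet> P j (x1 - xh) =
     ((norm (P j (x - xh)))\<^sup>2 - (norm (P j (x1 - xh)))\<^sup>2 - (norm (P j (x1 - x)))\<^sup>2) / 2"
    unfolding inner_diff_self by (simp add: blinfun.diff_right)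
  finally have "\<gamma>G j * (norm (P j (x1 - xh)))\<^sup>2 + (adj (K' x) y - adj (K' xh) yh) \<bullet> P j (x1 - xh)
    \<le> (1 / \<tau> j) * (((norm (P j (x - xh)))\<^sup>2 - (norm (P j (x1 - xh)))\<^sup>2 - (norm (P j (x1 - x)))\<^sup>2) / 2)"
    by simp
  from mult_left_mono[OF this, of "1 / \<pi> j"] \<pi>(1)[of j] show ?thesis by simp
qed

text \<open>All dual blocks are updated, so the blockwise subgradients assemble to a single one at
  \<open>y1\<close> and the monotonicity property applies to the whole vector.\<close>

lemma dual_monotonicity:
  "(\<Sum>l\<in>UNIV. \<gamma>F l * (norm (Q l (y1 - yh)))\<^sup>2) + (K xh - K xb) \<bullet> (y1 - yh)
    \<le> (\<Sum>l\<in>UNIV. 1 / (2 * s l) * ((norm (Q l (y - yh)))\<^sup>2 - (norm (Q l (y1 - yh)))\<^sup>2 - (norm (Q l (y1 - y)))\<^sup>2))"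
proof -
  define r where "r = (\<Sum>l\<in>UNIV. (1 / s l) *\<^sub>R Q l (y - y1)) + K xb"
  have Qr: "Q l r = (1 / s l) *\<^sub>R Q l (y - y1) + Q l (K xb)" for l
    by (simp add: r_def blinfun.add_right proj_scaled_sum[OF proj_Q])
  have "Q l r \<in> subdiff (\<lambda>y. fenchel_conj (F l) (Q l y)) y1" for l
  proof -
    have "Q l ((1 / s l) *\<^sub>R (y + s l *\<^sub>R K xb - y1)) \<in> subdiff (\<lambda>y. fenchel_conj (F l) (Q l y)) y1"
      using y_prox[of l] F_conj_finite_at_yh[of l] F_conj_convex
      by (intro prox_point_block_subdiff[OF proj_Q _ F_conj_not_MInf])
         (auto simp: s blinfun.add_right blinfun.scaleR_right)
    also have "Q l ((1 / s l) *\<^sub>R (y + s l *\<^sub>R K xb - y1)) = Q l r"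
      unfolding Qr using s(1)[of l] by (simp add: blinfun.diff_right blinfun.add_right blinfun.scaleR_right algebra_simps)
    finally show ?thesis .
  qed
  then have "r \<in> subdiff (block_sum (\<lambda>l. fenchel_conj (F l)) Q) y1"
    using subdiff_block_sum_iff[of Q "\<lambda>l. fenchel_conj (F l)", OF proj_Q F_conj_not_MInf] by blast
  with mono_F crit_y YF have "(\<Sum>l\<in>UNIV. \<gamma>F l * (norm (Q l (y1 - yh)))\<^sup>2) \<le> (r - K xh) \<bullet> (y1 - yh)"
    unfolding monotonicity_property_def by blast
  also have "(r - K xh) \<bullet> (y1 - yh) = (\<Sum>l\<in>UNIV. (1 / s l) * ((Q l (y - yh) - Q l (y1 - yh)) \<bullet> Q l (y1 - yh)))
       - (K xh - K xb) \<bullet> (y1 - yh)"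
  proof -
    have "(\<Sum>l\<in>UNIV. (1 / s l) *\<^sub>R Q l (y - y1)) \<bullet> (y1 - yh) =
      (\<Sum>l\<in>UNIV. (1 / s l) * (Q l (y - y1) \<bullet> Q l (y1 - yh)))"
      by (simp add: inner_sum_left proj_inner[OF proj_Q])
    moreover have "Q l (y - y1) = Q l (y - yh) - Q l (y1 - yh)" for l by (simp add: blinfun.diff_right)
    ultimately show ?thesis by (simp add: r_def inner_diff_left inner_add_left)
  qed
  also have "(\<Sum>l\<in>UNIV. (1 / s l) * ((Q l (y - yh) - Q l (y1 - yh)) \<bullet> Q l (y1 - yh))) =
     (\<Sum>l\<in>UNIV. 1 / (2 * s l) * ((norm (Q l (y - yh)))\<^sup>2 - (norm (Q l (y1 - yh)))\<^sup>2 - (norm (Q l (y1 - y)))\<^sup>2))"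
    unfolding inner_diff_self by (intro sum.cong refl) (simp add: blinfun.diff_right)
  finally show ?thesis by simp
qed

end

section \<open>Coupling terms and nonlinear errors of one step\<close>

context block_pdps_step
begin

lemma proj_x_diff: "j \<notin> S \<Longrightarrow> P j (x1 - x) = 0"
  by (simp add: blinfun.diff_right x_keep)

lemma norm2_x_diff: "(norm (x1 - x))\<^sup>2 = (\<Sum>j\<in>S. (norm (P j (x1 - x)))\<^sup>2)"
  unfolding norm2_blocks[OF proj_P, of "x1 - x"]
  by (rule sum.mono_neutral_right) (auto simp: proj_x_diff)

lemma xb_diff: "xb - xh = (x1 - xh) + wb *\<^sub>R sampled S (x1 - x)"
proof (rule eq_by_blocks[OF proj_P])
  fix j
  show "P j (xb - xh) = P j ((x1 - xh) + wb *\<^sub>R sampled S (x1 - x))"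
    using xb_upd[of j] x_keep[of j]
    by (cases "j \<in> S") (simp_all add: blinfun.diff_right blinfun.add_right blinfun.scaleR_right proj_sampled scaleR_diff_right)
qed

lemma norm2_xb_diff_le: "(norm (xb - x))\<^sup>2 \<le> (MAX j. (wb / \<pi> j + 1)\<^sup>2) * (norm (x1 - x))\<^sup>2"
proof -
  have "(norm (P j (xb - x)))\<^sup>2 \<le> (MAX j. (wb / \<pi> j + 1)\<^sup>2) * (norm (P j (x1 - x)))\<^sup>2" for j
  proof (cases "j \<in> S")
    case True
    then have "P j (xb - x) = (wb / \<pi> j + 1) *\<^sub>R P j (x1 - x)"
      by (simp add: xb_upd blinfun.diff_right algebra_simps)
    then have "(norm (P j (xb - x)))\<^sup>2 = (wb / \<pi> j + 1)\<^sup>2 * (norm (P j (x1 - x)))\<^sup>2"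
      by (simp add: power_mult_distrib)
    also have "\<dots> \<le> (MAX j. (wb / \<pi> j + 1)\<^sup>2) * (norm (P j (x1 - x)))\<^sup>2"
      by (intro mult_right_mono Max_ge) auto
    finally show ?thesis .
  next
    case False
    then show ?thesis by (simp add: blinfun.diff_right x_keep)
  qed
  then show ?thesis
    unfolding norm2_blocks[OF proj_P, of "xb - x"] norm2_blocks[OF proj_P, of "x1 - x"] sum_distrib_left
    by (intro sum_mono)
qed

lemma x_XK: "x \<in> XK"
  using seg by auto

definition rem_xb :: 'b where
  "rem_xb = K xb - K x - K' x (xb - x)"

text \<open>The sampled step \<open>x1 - x\<close> meets \<open>y1 - yh\<close> from the dual side
  and \<open>y - yh\<close> from the primal side, so only the dual increment survives. The terms at
  (x, y) and (x1, y1) are the bilinear parts of consecutive Lyapunov values, up to the sampling and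
  to the derivative being taken at \<open>x\<close>.\<close>

lemma cross_terms:
  "(adj (K' x) y - adj (K' xh) yh) \<bullet> sampled S (x1 - xh) + (1 / wb) * ((K xh - K xb) \<bullet> (y1 - yh)) =
    adj (K' x - K' xh) yh \<bullet> sampled S (x1 - xh)
    - K' x (sampled S (x1 - x)) \<bullet> (y1 - y) + K' x (sampled S (x - xh)) \<bullet> (y - yh)
    - (1 / wb) * (K' x (x1 - xh) \<bullet> (y1 - yh)) - (1 / wb) * ((rem_xb - remainder x) \<bullet> (y1 - yh))"
proof -
  let ?T = "K' x" and ?A = "sampled S" and ?e = "y - yh" and ?e1 = "y1 - yh"
  have "K xh - K xb = remainder x - rem_xb - ?T (xb - xh)"
    by (simp add: remainder_def rem_xb_def blinfun.diff_right)
  also have "?T (xb - xh) = ?T (x1 - xh) + wb *\<^sub>R ?T (?A (x1 - x))"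
    unfolding xb_diff by (simp add: blinfun.add_right blinfun.scaleR_right)
  finally have "(1 / wb) * ((K xh - K xb) \<bullet> ?e1) = - (1 / wb) * ((rem_xb - remainder x) \<bullet> ?e1)
      - (1 / wb) * (?T (x1 - xh) \<bullet> ?e1) - ?T (?A (x1 - x)) \<bullet> ?e1"
    using wb by (simp add: inner_diff_left inner_add_left diff_divide_distrib add_divide_distrib)
  moreover have "(adj ?T y - adj (K' xh) yh) \<bullet> ?A (x1 - xh) =
      adj (?T - K' xh) yh \<bullet> ?A (x1 - xh) + ?T (?A (x1 - xh)) \<bullet> ?e"
    unfolding adj_diff_blinfun
    by (simp add: inner_diff_left inner_diff_right adj_works' inner_commute[of y] inner_commute[of yh])
  moreover have "?T (?A (x1 - xh)) \<bullet> ?e = ?T (?A (x1 - x)) \<bullet> ?e + ?T (?A (x - xh)) \<bullet> ?e"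
    by (simp add: blinfun.diff_right inner_diff_left)
  moreover have "?T (?A (x1 - x)) \<bullet> (y1 - y) = ?T (?A (x1 - x)) \<bullet> ?e1 - ?T (?A (x1 - x)) \<bullet> ?e"
    by (simp add: inner_diff_right)
  ultimately show ?thesis by simp
qed

text \<open>The projection acts after \<open>Q l\<close>, since this is the seminorm in which \<rho>
  is given.\<close>

lemma inner_Y_NL_le:
  assumes "v \<in> orthogonal_comp (Y_L K)" "\<And>l. v \<bullet> P_NL K (Q l u) \<le> B l"
  shows "v \<bullet> u \<le> (\<Sum>l\<in>UNIV. B l)"
proof -
  have "v \<bullet> u = v \<bullet> (\<Sum>l\<in>UNIV. Q l u)" by (simp only: proj_sum[OF proj_Q])
  also have "\<dots> = (\<Sum>l\<in>UNIV. v \<bullet> P_NL K (Q l u))"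
    unfolding inner_sum_right by (intro sum.cong refl inner_P_NL assms)
  also have "\<dots> \<le> (\<Sum>l\<in>UNIV. B l)" by (intro sum_mono assms)
  finally show ?thesis .
qed

text \<open>Three errors with separate sources of payment: the remainder at \<open>xh\<close> is
  paid by \<theta> and \<zeta>, the remainder at the extrapolated point by the \<rho>-part of
  \<open>Lb\<close>, and the change of derivative from \<open>x\<close> to \<open>x1\<close> by
  \<alpha>y and the \<rho>x-part of \<open>Lb\<close>.\<close>

lemma nonlinear_errors:
  "(rem_xb - remainder x) \<bullet> (y1 - yh) - (K' x1 (x1 - xh) - K' x (x1 - xh)) \<bullet> (y1 - yh) \<le>
    wb * c\<theta> * norm (remainder x) powr p + (\<Sum>l\<in>UNIV. (\<gamma>F l - \<gamma>Fb l) * (norm (Q l (y1 - yh)))\<^sup>2)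
    + wb * ((Lb - L3) / 2) * (norm (x1 - x))\<^sup>2"
proof -
  let ?M = "MAX j. (wb / \<pi> j + 1)\<^sup>2" and ?e1 = "y1 - yh"
  let ?v = "K' x1 (x1 - xh) - K' x (x1 - xh)"
  define c where "c l = p powr (- p) * (rpow (\<zeta> l) (1 - p) * rpow (\<rho> l) (2 - p))" for l
  define n where "n l = norm (P_NL K (Q l ?e1))" for l
  define r where "r = norm (remainder x)"
  define D where "D = norm (x1 - x)"
  have L0: "0 \<le> L" using Lipschitz lipschitz_on_nonneg by blast
  have n: "0 \<le> n l" "n l \<le> \<rho> l" for l
    using \<rho>_bound[of l] by (simp_all add: n_def norm_op_P_NL)
  have 1: "(- remainder x) \<bullet> P_NL K (Q l ?e1) \<le> c l * r powr p + (p - 1) * \<zeta> l * (n l)\<^sup>2" for l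
  proof -
    have "(- remainder x) \<bullet> P_NL K (Q l ?e1) \<le> r * n l"
      using norm_cauchy_schwarz[of "- remainder x"] by (simp add: r_def n_def)
    also have "\<dots> \<le> c l * r powr p + (p - 1) * \<zeta> l * (n l)\<^sup>2"
      unfolding c_def by (intro young_rpow p \<zeta> n) (auto simp: r_def)
    finally show ?thesis .
  qed
  have 2: "rem_xb \<bullet> P_NL K (Q l ?e1) \<le> L / 2 * (?M * D\<^sup>2) * \<rho> l" for l
  proof -
    have "rem_xb \<bullet> P_NL K (Q l ?e1) \<le> L / 2 * (norm (xb - x))\<^sup>2 * n l"
      unfolding rem_xb_def n_def by (rule taylor_remainder_inner_le[OF deriv_K Lipschitz seg])
    also have "\<dots> \<le> L / 2 * (?M * D\<^sup>2) * \<rho> l"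
      using L0 n norm2_xb_diff_le unfolding D_def
      by (intro mult_mono mult_left_mono mult_nonneg_nonneg order_trans[OF zero_le_power2 norm2_xb_diff_le]) auto
    finally show ?thesis .
  qed
  have 3: "(- ?v) \<bullet> P_NL K (Q l ?e1) \<le> \<alpha>y * (n l)\<^sup>2 + L\<^sup>2 * \<rho>x\<^sup>2 / (4 * \<alpha>y) * D\<^sup>2" for l
  proof -
    have "(- ?v) \<bullet> P_NL K (Q l ?e1) \<le> norm ((K' x1 - K' x) (x1 - xh)) * n l"
      using norm_cauchy_schwarz[of "- ?v"] unfolding norm_minus_cancel by (simp add: n_def blinfun.diff_left)
    also have "\<dots> \<le> (L * D * \<rho>x) * n l"
    proof -
      have "norm ((K' x1 - K' x) (x1 - xh)) \<le> norm (K' x1 - K' x) * norm (x1 - xh)"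
        by (rule norm_blinfun)
      also have "\<dots> \<le> (L * D) * \<rho>x"
        using lipschitz_onD[OF Lipschitz x1_XK x_XK] \<rho>x_bound L0
        by (intro mult_mono) (auto simp: dist_norm D_def)
      finally show ?thesis using n by (intro mult_right_mono)
    qed
    also have "\<dots> = n l * (L * D * \<rho>x)" by simp
    also have "\<dots> \<le> \<alpha>y * (n l)\<^sup>2 + (L * D * \<rho>x)\<^sup>2 / (4 * \<alpha>y)" by (rule young_real[OF \<alpha>y])
    finally show ?thesis by (simp add: power_mult_distrib mult_ac)
  qed
  \<comment> \<open>If \<open>Q l\<close> annihilates the range of \<open>P_NL K\<close>, then by
    symmetry \<open>n l = 0\<close>; this is the reason for the two cases of \<gamma>Fb.\<close>
  have 4: "((p - 1) * \<zeta> l + \<alpha>y) * (n l)\<^sup>2 \<le> (\<gamma>F l - \<gamma>Fb l) * (norm (Q l ?e1))\<^sup>2" for l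
  proof (cases "\<forall>v. Q l (P_NL K v) = 0")
    case True
    have "(n l)\<^sup>2 = P_NL K (Q l ?e1) \<bullet> P_NL K (Q l ?e1)" by (simp add: n_def power2_norm_eq_inner)
    also have "\<dots> = Q l (P_NL K (P_NL K (Q l ?e1))) \<bullet> ?e1"
      by (simp only: P_NL_symmetric[of K "P_NL K _", symmetric] proj_sym[OF proj_Q])
    also have "\<dots> = 0" by (simp add: True)
    finally show ?thesis using True by (simp add: \<gamma>Fb_def)
  next
    case False
    have "(n l)\<^sup>2 \<le> (norm (Q l ?e1))\<^sup>2" unfolding n_def by (intro power_mono norm_P_NL_le) auto
    moreover have "0 \<le> (p - 1) * \<zeta> l + \<alpha>y" using p \<zeta>(1) \<alpha>y by (simp add: less_imp_le)
    moreover have "\<gamma>F l - \<gamma>Fb l = (p - 1) * \<zeta> l + \<alpha>y" unfolding \<gamma>Fb_def[of l] if_not_P[OF False] by simp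
    ultimately show ?thesis by (simp only: mult_left_mono)
  qed
  have "(- remainder x) \<bullet> ?e1 \<le> (\<Sum>l\<in>UNIV. c l * r powr p + (p - 1) * \<zeta> l * (n l)\<^sup>2)"
    using taylor_remainder_Y_NL[of K K', OF deriv_K, of xh x] 1
    by (intro inner_Y_NL_le subspace_neg subspace_orthogonal_comp) (simp_all add: remainder_def)
  moreover have "rem_xb \<bullet> ?e1 \<le> (\<Sum>l\<in>UNIV. L / 2 * (?M * D\<^sup>2) * \<rho> l)"
    using taylor_remainder_Y_NL[of K K', OF deriv_K, of xb x] 2
    by (intro inner_Y_NL_le) (simp_all add: rem_xb_def)
  moreover have "(- ?v) \<bullet> ?e1 \<le> (\<Sum>l\<in>UNIV. \<alpha>y * (n l)\<^sup>2 + L\<^sup>2 * \<rho>x\<^sup>2 / (4 * \<alpha>y) * D\<^sup>2)"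
    using 3 by (intro inner_Y_NL_le subspace_neg subspace_orthogonal_comp deriv_diff_Y_NL deriv_K)
  ultimately have "(rem_xb - remainder x) \<bullet> ?e1 - ?v \<bullet> ?e1 \<le>
      (\<Sum>l\<in>UNIV. c l * r powr p + (p - 1) * \<zeta> l * (n l)\<^sup>2) + (\<Sum>l\<in>UNIV. L / 2 * (?M * D\<^sup>2) * \<rho> l)
      + (\<Sum>l\<in>UNIV. \<alpha>y * (n l)\<^sup>2 + L\<^sup>2 * \<rho>x\<^sup>2 / (4 * \<alpha>y) * D\<^sup>2)"
    unfolding inner_diff_left inner_minus_left by linarith
  also have "\<dots> = (\<Sum>l\<in>UNIV. c l) * r powr p + (\<Sum>l\<in>UNIV. ((p - 1) * \<zeta> l + \<alpha>y) * (n l)\<^sup>2)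
      + L / 2 * (?M * D\<^sup>2) * (\<Sum>l\<in>UNIV. \<rho> l) + real CARD('d) * (L\<^sup>2 * \<rho>x\<^sup>2 / (4 * \<alpha>y) * D\<^sup>2)"
    by (simp add: sum.distrib sum_distrib_left sum_distrib_right distrib_right)
  also have "\<dots> \<le> (\<Sum>l\<in>UNIV. c l) * r powr p + (\<Sum>l\<in>UNIV. (\<gamma>F l - \<gamma>Fb l) * (norm (Q l ?e1))\<^sup>2)
      + L / 2 * (?M * D\<^sup>2) * (\<Sum>l\<in>UNIV. \<rho> l) + real CARD('d) * (L\<^sup>2 * \<rho>x\<^sup>2 / (4 * \<alpha>y) * D\<^sup>2)"
    by (intro add_right_mono add_left_mono sum_mono 4)
  also have "(\<Sum>l\<in>UNIV. c l) = wb * c\<theta>"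
    using wb by (simp add: c\<theta>_def c_def sum_distrib_left)
  also have "wb * c\<theta> * r powr p + (\<Sum>l\<in>UNIV. (\<gamma>F l - \<gamma>Fb l) * (norm (Q l ?e1))\<^sup>2)
      + L / 2 * (?M * D\<^sup>2) * (\<Sum>l\<in>UNIV. \<rho> l) + real CARD('d) * (L\<^sup>2 * \<rho>x\<^sup>2 / (4 * \<alpha>y) * D\<^sup>2)
    = wb * c\<theta> * r powr p + (\<Sum>l\<in>UNIV. (\<gamma>F l - \<gamma>Fb l) * (norm (Q l ?e1))\<^sup>2)
      + wb * ((Lb - L3) / 2) * D\<^sup>2"
    using wb \<alpha>y unfolding Lb_def by (simp add: field_simps power2_eq_square)
  finally show ?thesis by (simp add: D_def r_def)
qed

text \<open>The squared primal step has the budget 1 / \<tau>, shared by the three-point loss, the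
  nonlinear errors, the transfer to the old error and the coupling.\<close>

lemma primal_block_bound:
  assumes j: "j \<in> S"
  shows "(1 / \<tau> j + 2 * \<gamma>Gt j) / (2 * \<pi> j) * (norm (P j (x1 - xh)))\<^sup>2
    \<le> 1 / (2 * \<pi> j * \<tau> j) * (norm (P j (x - xh)))\<^sup>2
      - (1 - \<pi> j) * (\<gamma>G j + \<gamma>K j) / \<pi> j * (norm (P j (x - xh)))\<^sup>2
      + (1 / \<pi> j) * (\<gamma>G j * (norm (P j (x1 - xh)))\<^sup>2) + \<gamma>K j / \<pi> j * (norm (P j (x1 - xh)))\<^sup>2
      - L3 / 2 * ((1 / \<pi> j) * (norm (P j (x1 - x)))\<^sup>2)
      - (1 - \<delta>) / (2 * \<pi> j * \<tau>0 j) * (norm (P j (x1 - x)))\<^sup>2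
      - (Lb - L3) / 2 * (norm (P j (x1 - x)))\<^sup>2
      - 1 / (2 * \<pi> j * \<tau> j) * ((norm (P j (x - xh)))\<^sup>2 - (norm (P j (x1 - xh)))\<^sup>2 - (norm (P j (x1 - x)))\<^sup>2)"
proof -
  define a b c where "a = (norm (P j (x1 - xh)))\<^sup>2" and "b = (norm (P j (x - xh)))\<^sup>2"
    and "c = (norm (P j (x1 - x)))\<^sup>2"
  define g where "g = \<gamma>G j + \<gamma>K j"
  define D where "D = (1 - \<pi> j) * g * ((g - \<gamma>Gt j) / (\<pi> j * g - \<gamma>Gt j))"
  have c0: "0 \<le> c" by (simp add: c_def)
  have "P j (x1 - x) = P j (x1 - xh) - P j (x - xh)" by (simp add: blinfun.diff_right)
  then have quad: "(1 - \<pi> j) * g * b \<le> (g - \<gamma>Gt j) * a + D * c"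
    unfolding a_def b_def c_def D_def g_def
    using strong_monotonicity_split[of "\<pi> j" "\<gamma>Gt j" "\<gamma>G j + \<gamma>K j" "P j (x - xh)" "P j (x1 - xh)"] \<gamma>Gt \<pi>
    by simp
  have LbL3: "0 \<le> Lb - L3"
  proof -
    have L0: "0 \<le> L" using Lipschitz lipschitz_on_nonneg by blast
    have "0 \<le> (MAX j. (wb / \<pi> j + 1)\<^sup>2)"
      by (rule order_trans[OF zero_le_power2[of "wb / \<pi> j + 1"] Max_ge]) auto
    then show ?thesis unfolding Lb_def using L0 wb \<alpha>y \<rho> by (simp add: sum_nonneg less_imp_le)
  qed
  \<comment> \<open>This is the \<delta>-condition as a budget: \<delta> pays for \<open>Lb\<close>
    and \<open>D\<close>, and 1 - \<delta> is reserved for the coupling. The nonlinear errors lack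
    the test weight 1 / \<pi>, hence the factor \<pi>.\<close>
  have step: "L3 + \<pi> j * (Lb - L3) + 2 * D \<le> 1 / \<tau> j - (1 - \<delta>) / \<tau>0 j"
  proof -
    have "\<tau>0 j * (Lb + 2 * D) \<le> \<delta>"
      using delta j unfolding delta_cond_def D_def g_def mult.assoc by blast
    then have "Lb + 2 * D \<le> \<delta> / \<tau>0 j" using \<tau>0[of j] by (simp add: field_simps)
    moreover have "\<pi> j * (Lb - L3) \<le> Lb - L3" using LbL3 \<pi>(2)[of j] by (simp add: mult_left_le_one_le \<pi> less_imp_le)
    moreover have "1 / \<tau>0 j \<le> 1 / \<tau> j" using \<tau>[of j] by (intro divide_left_mono) (auto intro: \<tau>0)
    ultimately show ?thesis by (simp add: diff_divide_distrib)
  qed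
  have "0 \<le> (1 / \<pi> j) * ((g - \<gamma>Gt j) * a + D * c - (1 - \<pi> j) * g * b)
      + c / (2 * \<pi> j) * (1 / \<tau> j - (1 - \<delta>) / \<tau>0 j - L3 - \<pi> j * (Lb - L3) - 2 * D)"
    using quad step c0 \<pi>(1)[of j] by (intro add_nonneg_nonneg mult_nonneg_nonneg) auto
  also have "\<dots> = 1 / (2 * \<pi> j * \<tau> j) * b - (1 - \<pi> j) * g / \<pi> j * b
      + (1 / \<pi> j) * (\<gamma>G j * a) + \<gamma>K j / \<pi> j * a - L3 / 2 * ((1 / \<pi> j) * c)
      - (1 - \<delta>) / (2 * \<pi> j * \<tau>0 j) * c - (Lb - L3) / 2 * c
      - 1 / (2 * \<pi> j * \<tau> j) * (b - a - c) - (1 / \<tau> j + 2 * \<gamma>Gt j) / (2 * \<pi> j) * a"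
    unfolding g_def using \<pi>(1)[of j] \<tau>(1)[of j] \<tau>0[of j] by (simp add: field_simps)
  finally show ?thesis by (simp add: a_def b_def c_def g_def)
qed

text \<open>Apart from the coupling this is an identity; the dual proximal term covers the coupling
  because \<delta> < \<kappa> and \<open>wb * s l \<le> \<sigma>0 l\<close>.\<close>

lemma dual_block_bound:
  "(1 / s l + 2 * \<gamma>Fb l) / (2 * wb) * (norm (Q l (y1 - yh)))\<^sup>2
    \<le> 1 / (2 * wb * s l) * (norm (Q l (y - yh)))\<^sup>2
      + (1 / wb) * (\<gamma>F l * (norm (Q l (y1 - yh)))\<^sup>2) - (1 / wb) * ((\<gamma>F l - \<gamma>Fb l) * (norm (Q l (y1 - yh)))\<^sup>2)
      - (1 - \<kappa>) / (1 - \<delta>) / (2 * \<sigma>0 l) * (norm (Q l (y1 - y)))\<^sup>2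
      - (1 / wb) * (1 / (2 * s l) * ((norm (Q l (y - yh)))\<^sup>2 - (norm (Q l (y1 - yh)))\<^sup>2 - (norm (Q l (y1 - y)))\<^sup>2))"
proof -
  define a b c where "a = (norm (Q l (y1 - yh)))\<^sup>2" and "b = (norm (Q l (y - yh)))\<^sup>2"
    and "c = (norm (Q l (y1 - y)))\<^sup>2"
  have "(1 - \<kappa>) / (1 - \<delta>) / (2 * \<sigma>0 l) \<le> 1 / (2 * \<sigma>0 l)"
    using \<delta>\<kappa> \<sigma>0[of l] by (intro divide_right_mono) auto
  also have "\<dots> \<le> 1 / (2 * (wb * s l))"
    using s[of l] wb \<sigma>0[of l] by (intro divide_left_mono) auto
  finally have "(1 - \<kappa>) / (1 - \<delta>) / (2 * \<sigma>0 l) * c \<le> 1 / (2 * (wb * s l)) * c"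
    by (intro mult_right_mono) (auto simp: c_def)
  moreover have "(1 / s l + 2 * \<gamma>Fb l) / (2 * wb) * a = 1 / (2 * wb * s l) * b
      + (1 / wb) * (\<gamma>F l * a) - (1 / wb) * ((\<gamma>F l - \<gamma>Fb l) * a)
      - 1 / (2 * (wb * s l)) * c - (1 / wb) * (1 / (2 * s l) * (b - a - c))"
    using s(1)[of l] wb by (simp add: field_simps)
  ultimately show ?thesis unfolding a_def b_def c_def by linarith
qed

text \<open>The last two summands on the right need not be nonpositive for a single draw
  \<open>S\<close>; only their means are. The coefficients on the left are the next weights divided
  by \<open>wb\<close>, by the step length rules.\<close>

theorem descent:
  "(\<Sum>j\<in>UNIV. (1 / \<tau> j + 2 * \<gamma>Gt j) / (2 * \<pi> j) * (norm (P j (x1 - xh)))\<^sup>2)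
    + (\<Sum>l\<in>UNIV. (1 / s l + 2 * \<gamma>Fb l) / (2 * wb) * (norm (Q l (y1 - yh)))\<^sup>2)
    - (1 / wb) * (K' x1 (x1 - xh) \<bullet> (y1 - yh))
   \<le> (\<Sum>j\<in>UNIV. 1 / (2 * \<pi> j * \<tau> j) * (norm (P j (x - xh)))\<^sup>2)
    + (\<Sum>l\<in>UNIV. 1 / (2 * wb * s l) * (norm (Q l (y - yh)))\<^sup>2)
    - K' x (sampled S (x - xh)) \<bullet> (y - yh)
    + (\<Sum>j\<in>UNIV. (if j \<in> S then - ((1 - \<pi> j) * (\<gamma>G j + \<gamma>K j)) else \<gamma>Gt j) / \<pi> j * (norm (P j (x - xh)))\<^sup>2)
    + (c\<theta> - \<theta> (sampled S)) * norm (remainder x) powr p"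
proof -
  define R where "R = norm (remainder x) powr p"
  define iw where "iw = 1 / wb"
  define pre where "pre j = (if j \<in> S then - ((1 - \<pi> j) * (\<gamma>G j + \<gamma>K j)) else \<gamma>Gt j) / \<pi> j * (norm (P j (x - xh)))\<^sup>2" for j
  define lx where "lx j = (1 / \<tau> j + 2 * \<gamma>Gt j) / (2 * \<pi> j) * (norm (P j (x1 - xh)))\<^sup>2" for j
  define rx where "rx j = 1 / (2 * \<pi> j * \<tau> j) * (norm (P j (x - xh)))\<^sup>2" for j
  define mx where "mx j = (1 / \<pi> j) * (\<gamma>G j * (norm (P j (x1 - xh)))\<^sup>2)" for j
  define kx where "kx j = \<gamma>K j / \<pi> j * (norm (P j (x1 - xh)))\<^sup>2" for j
  define tx where "tx j = (1 / \<pi> j) * (norm (P j (x1 - x)))\<^sup>2" for j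
  define cx where "cx j = (1 - \<delta>) / (2 * \<pi> j * \<tau>0 j) * (norm (P j (x1 - x)))\<^sup>2" for j
  define dx where "dx j = 1 / (2 * \<pi> j * \<tau> j) * ((norm (P j (x - xh)))\<^sup>2 - (norm (P j (x1 - xh)))\<^sup>2 - (norm (P j (x1 - x)))\<^sup>2)" for j
  define ly where "ly l = (1 / s l + 2 * \<gamma>Fb l) / (2 * wb) * (norm (Q l (y1 - yh)))\<^sup>2" for l
  define ry where "ry l = 1 / (2 * wb * s l) * (norm (Q l (y - yh)))\<^sup>2" for l
  define my where "my l = \<gamma>F l * (norm (Q l (y1 - yh)))\<^sup>2" for l
  define ny where "ny l = (\<gamma>F l - \<gamma>Fb l) * (norm (Q l (y1 - yh)))\<^sup>2" for l
  define cy where "cy l = (1 - \<kappa>) / (1 - \<delta>) / (2 * \<sigma>0 l) * (norm (Q l (y1 - y)))\<^sup>2" for l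
  define dy where "dy l = 1 / (2 * s l) * ((norm (Q l (y - yh)))\<^sup>2 - (norm (Q l (y1 - yh)))\<^sup>2 - (norm (Q l (y1 - y)))\<^sup>2)" for l
  let ?Z = "(adj (K' x) y - adj (K' xh) yh) \<bullet> sampled S (x1 - xh)"
  let ?E = "(K xh - K xb) \<bullet> (y1 - yh)"
  let ?N = "(rem_xb - remainder x) \<bullet> (y1 - yh)"
  let ?T = "adj (K' x - K' xh) yh \<bullet> sampled S (x1 - xh)"
  have iw: "0 < iw" using wb by (simp add: iw_def)
  have xpart: "sum lx UNIV \<le> sum rx UNIV + sum pre UNIV + sum mx S + sum kx S - L3 / 2 * sum tx S - sum cx S
      - (Lb - L3) / 2 * (norm (x1 - x))\<^sup>2 - sum dx S"
  proof -
    have "sum lx UNIV \<le> (\<Sum>j\<in>UNIV. rx j + pre j + (if j \<in> S then mx j + kx j - L3 / 2 * tx j - cx j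
      - (Lb - L3) / 2 * (norm (P j (x1 - x)))\<^sup>2 - dx j else 0))"
    proof (rule sum_mono)
      fix j
      show "lx j \<le> rx j + pre j + (if j \<in> S then mx j + kx j - L3 / 2 * tx j - cx j
        - (Lb - L3) / 2 * (norm (P j (x1 - x)))\<^sup>2 - dx j else 0)"
      proof (cases "j \<in> S")
        case True
        from primal_block_bound[OF this] True show ?thesis
          unfolding lx_def rx_def pre_def mx_def kx_def tx_def cx_def dx_def by simp
      next
        case False
        then have "P j (x1 - xh) = P j (x - xh)" by (simp add: blinfun.diff_right x_keep)
        with False show ?thesis using \<pi>(1)[of j] \<tau>(1)[of j]
          by (simp add: lx_def rx_def pre_def field_simps)
      qed
    qed
    also have "\<dots> = sum rx UNIV + sum pre UNIV + (\<Sum>j\<in>S. mx j + kx j - L3 / 2 * tx j - cx j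
      - (Lb - L3) / 2 * (norm (P j (x1 - x)))\<^sup>2 - dx j)"
      by (simp add: sum.distrib sum.If_cases)
    finally show ?thesis
      by (simp add: sum.distrib sum_subtractf norm2_x_diff sum_distrib_left)
  qed
  have ypart: "sum ly UNIV \<le> sum ry UNIV + iw * sum my UNIV - iw * sum ny UNIV - sum cy UNIV - iw * sum dy UNIV"
  proof -
    have "sum ly UNIV \<le> (\<Sum>l\<in>UNIV. ry l + iw * my l - iw * ny l - cy l - iw * dy l)"
      by (rule sum_mono) (unfold ly_def ry_def iw_def my_def ny_def cy_def dy_def, rule dual_block_bound)
    then show ?thesis by (simp add: sum.distrib sum_subtractf sum_distrib_left)
  qed
  have primal: "sum mx S + ?Z \<le> sum dx S"
  proof -
    have "?Z = (\<Sum>j\<in>S. (1 / \<pi> j) * ((adj (K' x) y - adj (K' xh) yh) \<bullet> P j (x1 - xh)))"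
      by (simp add: sampled_apply inner_sum_right)
    then have "sum mx S + ?Z = (\<Sum>j\<in>S. (1 / \<pi> j) * (\<gamma>G j * (norm (P j (x1 - xh)))\<^sup>2
        + (adj (K' x) y - adj (K' xh) yh) \<bullet> P j (x1 - xh)))"
      unfolding distrib_left sum.distrib mx_def by simp
    also have "\<dots> \<le> sum dx S" unfolding dx_def by (intro sum_mono primal_monotonicity)
    finally show ?thesis .
  qed
  have dual: "iw * sum my UNIV + iw * ?E \<le> iw * sum dy UNIV"
    unfolding distrib_left[symmetric] my_def dy_def
    by (intro mult_left_mono dual_monotonicity less_imp_le iw)
  have three: "sum kx S + \<theta> (sampled S) * R - L3 / 2 * sum tx S \<le> ?T"
    unfolding kx_def tx_def R_def by (rule three_point_sampled[OF x_XK x1_XK])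
  have coup: "K' x (sampled S (x1 - x)) \<bullet> (y1 - y) \<le> sum cx S + sum cy UNIV"
    unfolding cx_def cy_def by (rule coupling_sampled[OF kappa])
  have cross: "?Z + iw * ?E = ?T - K' x (sampled S (x1 - x)) \<bullet> (y1 - y) + K' x (sampled S (x - xh)) \<bullet> (y - yh)
      - iw * (K' x (x1 - xh) \<bullet> (y1 - yh)) - iw * ?N"
    unfolding iw_def by (rule cross_terms)
  have nonlin: "iw * ?N - iw * (K' x1 (x1 - xh) \<bullet> (y1 - yh)) + iw * (K' x (x1 - xh) \<bullet> (y1 - yh))
      \<le> c\<theta> * R + iw * sum ny UNIV + (Lb - L3) / 2 * (norm (x1 - x))\<^sup>2"
  proof -
    have "iw * (?N - (K' x1 (x1 - xh) - K' x (x1 - xh)) \<bullet> (y1 - yh)) \<le>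
      iw * (wb * c\<theta> * R + sum ny UNIV + wb * ((Lb - L3) / 2) * (norm (x1 - x))\<^sup>2)"
      using nonlinear_errors unfolding R_def ny_def by (intro mult_left_mono less_imp_le[OF iw])
    also have "\<dots> = c\<theta> * R + iw * sum ny UNIV + (Lb - L3) / 2 * (norm (x1 - x))\<^sup>2"
      using wb by (simp add: iw_def field_simps)
    finally show ?thesis by (simp add: inner_diff_left right_diff_distrib)
  qed
  have "sum lx UNIV + sum ly UNIV - iw * (K' x1 (x1 - xh) \<bullet> (y1 - yh)) \<le> sum rx UNIV + sum ry UNIV
      - K' x (sampled S (x - xh)) \<bullet> (y - yh) + sum pre UNIV + (c\<theta> * R - \<theta> (sampled S) * R)"
    using xpart ypart primal dual three coup cross nonlin by linarith
  then show ?thesis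
    unfolding lx_def ly_def rx_def ry_def pre_def R_def iw_def by (simp add: left_diff_distrib)
qed

end

subsection \<open>Step lengths\<close>

text \<open>The steps decrease because \<open>(1 + 2 * t i * g) * wb \<ge> 1\<close> is invariant:
  if c denotes the bracket, the next value is wb + 1 - 1 / c, again at least 1 since wb \<ge> 1 / c.
  The last part turns the gain 2 g on the weight 1 / t into the factor \<open>wb\<close>.\<close>

lemma step_lengths:
  fixes t :: "nat \<Rightarrow> real"
  assumes t0: "0 < t 0" and g: "0 < g" and wb: "0 < wb" "1 / (1 + 2 * t 0 * g) \<le> wb"
    and t: "\<And>i. t (Suc i) = t i / ((1 + 2 * t i * g) * wb)"
  shows "0 < t i" "t i \<le> t 0" "wb * t (Suc i) \<le> t 0" "1 / t (Suc i) = wb * (1 / t i + 2 * g)"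
proof -
  have *: "0 < t i \<and> t i \<le> t 0 \<and> 1 \<le> (1 + 2 * t i * g) * wb" for i
  proof (induction i)
    case 0
    have "0 < 1 + 2 * t 0 * g" using t0 g by (simp add: add_pos_pos)
    with wb show ?case using t0 by (simp add: field_simps)
  next
    case (Suc i)
    let ?c = "1 + 2 * t i * g"
    have c: "0 < ?c" using Suc g by (simp add: add_pos_pos)
    have "t (Suc i) \<le> t i" unfolding t using Suc by (simp add: divide_le_eq)
    moreover have "0 < t (Suc i)" unfolding t using Suc c wb by simp
    moreover have "(1 + 2 * t (Suc i) * g) * wb = wb + (?c - 1) / ?c"
    proof -
      have "t (Suc i) * wb = t i / ?c" unfolding t using wb by simp
      moreover have "(1 + 2 * t (Suc i) * g) * wb = wb + 2 * g * (t (Suc i) * wb)"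
        by (simp add: algebra_simps)
      ultimately show ?thesis by simp
    qed
    moreover have "1 \<le> wb + (?c - 1) / ?c" using Suc c by (simp add: field_simps)
    ultimately show ?case using Suc by auto
  qed
  show ti: "0 < t i" "t i \<le> t 0" using * by auto
  have c: "1 \<le> 1 + 2 * t i * g" using ti g by simp
  have "wb * t (Suc i) = t i / (1 + 2 * t i * g)" unfolding t using wb by simp
  also have "\<dots> \<le> t i / 1" using ti c by (intro divide_left_mono mult_pos_pos) linarith+
  finally show "wb * t (Suc i) \<le> t 0" using ti by simp
  show "1 / t (Suc i) = wb * (1 / t i + 2 * g)" unfolding t using ti by (simp add: field_simps)
qed

context block_pdps
begin

text \<open>Since \<open>x\<close> and \<open>y\<close> after \<open>N\<close> iterations are functions of the finitely many possible values of
  \<open>S 0, \<dots>, S (N - 1)\<close>, all measurability and integrability questions become trivial.\<close>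

lemma iterates_determined:
  assumes it: "full_dual_iterates G F K K' P Q \<pi> \<tau> \<sigma> om S x xb y"
    and it': "full_dual_iterates G F K K' P Q \<pi> \<tau> \<sigma> om S' x' xb' y'"
    and pos: "\<And>i j. 0 < \<tau> i j" "\<And>i l. 0 < \<sigma> i l"
    and init: "x 0 = x' 0" "y 0 = y' 0" and S: "\<And>k. k < N \<Longrightarrow> S k = S' k"
  shows "x N = x' N \<and> y N = y' N"
  using S
proof (induction N)
  case 0
  then show ?case using init by simp
next
  case (Suc i)
  then have IH: "x i = x' i" "y i = y' i" and Si: "S i = S' i" by auto
  note 1 = it[unfolded full_dual_iterates_def, rule_format, of i]
  note 2 = it'[unfolded full_dual_iterates_def, rule_format, of i]
  have lin: "subspace (range (blinfun_apply T))" for T :: "'z::real_normed_vector \<Rightarrow>\<^sub>L 'z"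
    by (intro linear_subspace_image blinfun.bounded_linear_right[THEN bounded_linear.linear] subspace_UNIV)
  have Px: "P j (x (Suc i)) = P j (x' (Suc i))" for j
  proof (cases "j \<in> S i")
    case True
    then show ?thesis
      using 1[THEN conjunct1, THEN spec, of j] 2[THEN conjunct1, THEN spec, of j] G[of j]
      by (intro prox_point_unique[where f = "G j" and u = "P j xh", OF _ G_not_MInf lin rangeI G_finite_at_xh pos(1)[of i j]])
         (auto simp: IH Si)
  next
    case False
    then show ?thesis
      using 1[THEN conjunct1, THEN spec, of j] 2[THEN conjunct1, THEN spec, of j] by (simp add: IH Si)
  qed
  have xb: "xb (Suc i) = xb' (Suc i)"
  proof (rule eq_by_blocks[OF proj_P])
    fix j show "P j (xb (Suc i)) = P j (xb' (Suc i))"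
      using 1[THEN conjunct1, THEN spec, of j] 2[THEN conjunct1, THEN spec, of j] Px
      by (simp add: IH Si split: if_splits)
  qed
  have "Q l (y (Suc i)) = Q l (y' (Suc i))" for l
    using 1[THEN conjunct2, THEN spec, of l] 2[THEN conjunct2, THEN spec, of l]
    by (intro prox_point_unique[where f = "fenchel_conj (F l)" and u = "Q l yh",
          OF F_conj_convex F_conj_not_MInf lin rangeI F_conj_finite_at_yh pos(2)[of "Suc i" l]])
       (auto simp: IH xb)
  then show ?case using eq_by_blocks[OF proj_P] eq_by_blocks[OF proj_Q] Px by blast
qed

lemma descent_iterates:
  assumes it: "full_dual_iterates G F K K' P Q \<pi> \<tau> \<sigma> (\<lambda>i. wb) S x xb y"
    and stay: "stays_in_neighbourhoods P xh XK XG YF S x xb y" and i: "1 \<le> i"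
    and \<tau>: "\<And>j. 0 < \<tau> i j" "\<And>j. \<tau> i j \<le> \<tau>0 j"
    and \<sigma>: "\<And>l. 0 < \<sigma> (Suc i) l" "\<And>l. wb * \<sigma> (Suc i) l \<le> \<sigma>0 l"
    and kappa: "kappa_cond (S i) (x i)" and delta: "delta_cond (S i)"
    and \<rho>_bounds: "norm (x (Suc i) - xh) \<le> \<rho>x" "\<And>l. norm_op (P_NL K) (Q l (y (Suc i) - yh)) \<le> \<rho> l"
  shows "(\<Sum>j\<in>UNIV. (1 / \<tau> i j + 2 * \<gamma>Gt j) / (2 * \<pi> j) * (norm (P j (x (Suc i) - xh)))\<^sup>2)
    + (\<Sum>l\<in>UNIV. (1 / \<sigma> (Suc i) l + 2 * \<gamma>Fb l) / (2 * wb) * (norm (Q l (y (Suc i) - yh)))\<^sup>2)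
    - (1 / wb) * (K' (x (Suc i)) (x (Suc i) - xh) \<bullet> (y (Suc i) - yh))
   \<le> (\<Sum>j\<in>UNIV. 1 / (2 * \<pi> j * \<tau> i j) * (norm (P j (x i - xh)))\<^sup>2)
    + (\<Sum>l\<in>UNIV. 1 / (2 * wb * \<sigma> (Suc i) l) * (norm (Q l (y i - yh)))\<^sup>2)
    - K' (x i) (sampled (S i) (x i - xh)) \<bullet> (y i - yh)
    + (\<Sum>j\<in>UNIV. (if j \<in> S i then - ((1 - \<pi> j) * (\<gamma>G j + \<gamma>K j)) else \<gamma>Gt j) / \<pi> j * (norm (P j (x i - xh)))\<^sup>2)
    + (c\<theta> - \<theta> (sampled (S i))) * norm (remainder (x i)) powr p"
proof -
  note 1 = it[unfolded full_dual_iterates_def, rule_format, of i]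
  note 2 = stay[unfolded stays_in_neighbourhoods_def, rule_format, OF i]
  interpret block_pdps_step K K' P Q G F xh yh XK XG YF L L3 p \<alpha>y \<delta> \<kappa> \<rho>x wb Lb \<gamma>K \<gamma>G \<gamma>Gt \<pi> \<tau>0 \<gamma>F \<gamma>Fb \<zeta> \<rho> \<sigma>0 \<theta> w
    "S i" "x i" "x (Suc i)" "xb (Suc i)" "y i" "y (Suc i)" "\<tau> i" "\<sigma> (Suc i)"
  proof (unfold_locales, goal_cases)
    case (5 j) then show ?case using 1[THEN conjunct1, THEN spec, of j] by simp
  next
    case (6 j) then show ?case using 1[THEN conjunct1, THEN spec, of j] by simp
  next
    case (7 j) then show ?case using 1[THEN conjunct1, THEN spec, of j] by simp
  next
    case (8 j) then show ?case using 1[THEN conjunct1, THEN spec, of j] by simp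
  next
    case (9 l) then show ?case using 1[THEN conjunct2, THEN spec, of l] by simp
  qed (use 2 \<tau> \<sigma> kappa delta \<rho>_bounds in auto)
  show ?thesis by (rule descent)
qed

end

subsection \<open>Random variables determined by a finite sample history\<close>

locale finite_history = prob_space M for M :: "'w measure" +
  fixes \<O> :: "nat \<Rightarrow> 'w measure" and S :: "nat \<Rightarrow> 'w \<Rightarrow> 's::finite"
  assumes filtr: "filtration (space M) \<O>" "\<And>i. subalgebra M (\<O> i)"
    and S_meas: "\<And>i. S i \<in> \<O> (Suc i) \<rightarrow>\<^sub>M count_space UNIV"
begin

text \<open>The sigma-algebras are shifted by one, so the draws before \<open>i\<close> are
  measurable for \<open>\<O> i\<close>: determined functions are adapted. The notion is pathwise and
  passes to arbitrary compositions.\<close>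

definition determined :: "nat \<Rightarrow> ('w \<Rightarrow> 'z) \<Rightarrow> bool" where
  "determined i f \<longleftrightarrow> (\<forall>\<omega>\<in>space M. \<forall>\<omega>'\<in>space M. (\<forall>k<i. S k \<omega> = S k \<omega>') \<longrightarrow> f \<omega> = f \<omega>')"

lemma determined_factors:
  assumes "determined i f"
  shows "\<exists>g. \<forall>\<omega>\<in>space M. f \<omega> = g (map (\<lambda>k. S k \<omega>) [0..<i])"
proof (intro exI ballI)
  fix \<omega> assume \<omega>: "\<omega> \<in> space M"
  define \<omega>' where "\<omega>' = (SOME v. v \<in> space M \<and> map (\<lambda>k. S k v) [0..<i] = map (\<lambda>k. S k \<omega>) [0..<i])"
  have *: "\<omega>' \<in> space M \<and> map (\<lambda>k. S k \<omega>') [0..<i] = map (\<lambda>k. S k \<omega>) [0..<i]"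
    unfolding \<omega>'_def by (rule someI[where x = \<omega>]) (use \<omega> in simp)
  then have "\<forall>k<i. S k \<omega> = S k \<omega>'" by simp
  then have "f \<omega> = f \<omega>'" using assms \<omega> * unfolding determined_def by blast
  then show "f \<omega> = (\<lambda>h. f (SOME v. v \<in> space M \<and> map (\<lambda>k. S k v) [0..<i] = h)) (map (\<lambda>k. S k \<omega>) [0..<i])"
    by (simp add: \<omega>'_def)
qed

lemma space_\<O>: "space (\<O> i) = space M"
  using filtr(2) by (simp add: subalgebra_def)

lemma S_measurable: "k < i \<Longrightarrow> S k \<in> \<O> i \<rightarrow>\<^sub>M count_space UNIV"
proof -
  assume "k < i"
  then have "sets (\<O> (Suc k)) \<subseteq> sets (\<O> i)"
    using filtration.sets_F_mono[OF filtr(1), of "Suc k" i] by simp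
  then show ?thesis using S_meas[of k] by (auto simp: measurable_def space_\<O>)
qed

text \<open>The histories form a countable discrete space, on which every function is
  measurable.\<close>

lemma determined_measurable:
  fixes f :: "'w \<Rightarrow> 'z::topological_space"
  assumes "determined i f"
  shows "f \<in> borel_measurable (\<O> i)"
proof -
  let ?h = "\<lambda>\<omega>. map (\<lambda>k. S k \<omega>) [0..<i]"
  obtain g where g: "\<forall>\<omega>\<in>space M. f \<omega> = g (?h \<omega>)" using determined_factors[OF assms] by blast
  have "?h \<in> \<O> i \<rightarrow>\<^sub>M count_space UNIV"
    unfolding measurable_count_space_eq2_countable
  proof (intro conjI ballI)
    show "?h \<in> space (\<O> i) \<rightarrow> UNIV" by simp
  next
    fix h :: "'s list"
    have "?h \<omega> = h \<longleftrightarrow> length h = i \<and> (\<forall>k\<in>{..<i}. S k \<omega> = h ! k)" for \<omega>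
      by (simp add: list_eq_iff_nth_eq Ball_def) blast
    then have "?h -` {h} \<inter> space (\<O> i) = {\<omega> \<in> space (\<O> i). length h = i \<and> (\<forall>k\<in>{..<i}. S k \<omega> = h ! k)}"
      by blast
    also have "\<dots> \<in> sets (\<O> i)"
    proof (intro sets.sets_Collect_conj sets.sets_Collect_const sets.sets_Collect_finite_All)
      fix k assume "k \<in> {..<i}"
      then have "S k -` {h ! k} \<inter> space (\<O> i) \<in> sets (\<O> i)"
        by (intro measurable_sets[OF S_measurable]) auto
      also have "S k -` {h ! k} \<inter> space (\<O> i) = {\<omega> \<in> space (\<O> i). S k \<omega> = h ! k}" by auto
      finally show "{\<omega> \<in> space (\<O> i). S k \<omega> = h ! k} \<in> sets (\<O> i)" .
    qed simp
    finally show "?h -` {h} \<inter> space (\<O> i) \<in> sets (\<O> i)" .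
  qed
  then have "(\<lambda>\<omega>. g (?h \<omega>)) \<in> borel_measurable (\<O> i)" by (rule measurable_compose) simp
  then show ?thesis using g by (subst measurable_cong[where g = "\<lambda>\<omega>. g (?h \<omega>)"]) (auto simp: space_\<O>)
qed

lemma determined_measurable_M:
  fixes f :: "'w \<Rightarrow> 'z::topological_space"
  assumes "determined i f"
  shows "f \<in> borel_measurable M"
  using measurable_from_subalg[OF filtr(2) determined_measurable[OF assms]] .

text \<open>There are finitely many histories of length \<open>i\<close>, so the sum of the absolute
  values over all of them is a bound.\<close>

lemma determined_integrable:
  fixes f :: "'w \<Rightarrow> real"
  assumes "determined i f"
  shows "integrable M f"
proof -
  let ?h = "\<lambda>\<omega>. map (\<lambda>k. S k \<omega>) [0..<i]"
  obtain g where g: "\<forall>\<omega>\<in>space M. f \<omega> = g (?h \<omega>)" using determined_factors[OF assms] by blast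
  let ?A = "{xs :: 's list. set xs \<subseteq> UNIV \<and> length xs = i}"
  have A: "finite ?A" by (rule finite_lists_length_eq) simp
  have "AE \<omega> in M. norm (f \<omega>) \<le> (\<Sum>h\<in>?A. \<bar>g h\<bar>)"
  proof (rule AE_I2)
    fix \<omega> assume "\<omega> \<in> space M"
    then have "norm (f \<omega>) = \<bar>g (?h \<omega>)\<bar>" using g by simp
    also have "\<dots> \<le> (\<Sum>h\<in>?A. \<bar>g h\<bar>)" by (rule member_le_sum) (use A in auto)
    finally show "norm (f \<omega>) \<le> (\<Sum>h\<in>?A. \<bar>g h\<bar>)" .
  qed
  then show ?thesis by (rule integrable_const_bound) (rule determined_measurable_M[OF assms])
qed

lemma determined_comp: "determined i f \<Longrightarrow> determined i (\<lambda>\<omega>. g (f \<omega>))"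
  unfolding determined_def by metis

lemma determined_mono: "determined i f \<Longrightarrow> i \<le> k \<Longrightarrow> determined k f"
  unfolding determined_def by (metis order_less_le_trans)

lemma determined_S: "k < i \<Longrightarrow> determined i (S k)"
  unfolding determined_def by metis

lemma determined_comp2: "determined i f \<Longrightarrow> determined i g \<Longrightarrow> determined i (\<lambda>\<omega>. h (f \<omega>) (g \<omega>))"
  unfolding determined_def by metis

lemma determined_indicator:
  assumes "determined i E"
  shows "determined i (indicat_real {\<omega> \<in> space M. E \<omega>})"
  unfolding determined_def
proof (intro ballI impI)
  fix \<omega> \<omega>' assume *: "\<omega> \<in> space M" "\<omega>' \<in> space M" "\<forall>k<i. S k \<omega> = S k \<omega>'"
  then have "E \<omega> = E \<omega>'" using assms unfolding determined_def by blast
  with * show "indicat_real {\<omega> \<in> space M. E \<omega>} \<omega> = indicat_real {\<omega> \<in> space M. E \<omega>} \<omega>'"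
    by (simp add: indicator_def)
qed

lemma integral_cond_exp_eq:
  fixes f g :: "'w \<Rightarrow> real"
  assumes f: "determined i f" and g: "determined (Suc i) g"
  shows "integrable M (\<lambda>\<omega>. f \<omega> * real_cond_exp M (\<O> i) g \<omega>)"
    and "(\<integral>\<omega>. f \<omega> * real_cond_exp M (\<O> i) g \<omega> \<partial>M) = (\<integral>\<omega>. f \<omega> * g \<omega> \<partial>M)"
proof -
  interpret F: finite_measure_subalgebra M "\<O> i"
    by unfold_locales (rule filtr)
  have "determined (Suc i) (\<lambda>\<omega>. f \<omega> * g \<omega>)"
    by (rule determined_comp2[OF determined_mono[OF f] g]) simp
  then have "integrable M (\<lambda>\<omega>. f \<omega> * g \<omega>)" by (rule determined_integrable)
  note * = F.real_cond_exp_intg[OF this determined_measurable[OF f] determined_measurable_M[OF g]]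
  show "integrable M (\<lambda>\<omega>. f \<omega> * real_cond_exp M (\<O> i) g \<omega>)" by (rule *)
  show "(\<integral>\<omega>. f \<omega> * real_cond_exp M (\<O> i) g \<omega> \<partial>M) = (\<integral>\<omega>. f \<omega> * g \<omega> \<partial>M)" by (rule *)
qed

lemma integral_mult_cond_const:
  fixes f g :: "'w \<Rightarrow> real"
  assumes f: "determined i f" and g: "determined (Suc i) g"
    and c: "AE \<omega> in M. real_cond_exp M (\<O> i) g \<omega> = c"
  shows "(\<integral>\<omega>. f \<omega> * g \<omega> \<partial>M) = c * (\<integral>\<omega>. f \<omega> \<partial>M)"
proof -
  have "(\<integral>\<omega>. f \<omega> * g \<omega> \<partial>M) = (\<integral>\<omega>. f \<omega> * real_cond_exp M (\<O> i) g \<omega> \<partial>M)"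
    by (rule integral_cond_exp_eq(2)[OF f g, symmetric])
  also have "\<dots> = (\<integral>\<omega>. c * f \<omega> \<partial>M)"
    by (rule integral_cong_AE)
       (use c integral_cond_exp_eq(1)[OF f g] determined_measurable_M[OF f] in \<open>auto simp: mult.commute\<close>)
  finally show ?thesis by simp
qed

lemma integral_mult_cond_ge:
  fixes f g :: "'w \<Rightarrow> real"
  assumes f: "determined i f" and g: "determined (Suc i) g" and f0: "\<And>\<omega>. 0 \<le> f \<omega>"
    and c: "AE \<omega> in M. c \<le> real_cond_exp M (\<O> i) g \<omega>"
  shows "c * (\<integral>\<omega>. f \<omega> \<partial>M) \<le> (\<integral>\<omega>. f \<omega> * g \<omega> \<partial>M)"
proof -
  have "c * (\<integral>\<omega>. f \<omega> \<partial>M) = (\<integral>\<omega>. f \<omega> * c \<partial>M)" by simp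
  also have "\<dots> \<le> (\<integral>\<omega>. f \<omega> * real_cond_exp M (\<O> i) g \<omega> \<partial>M)"
    using c by (intro integral_mono_AE integral_cond_exp_eq(1)[OF f g] integrable_mult_left determined_integrable[OF f])
      (auto simp: f0 intro!: mult_left_mono)
  also have "\<dots> = (\<integral>\<omega>. f \<omega> * g \<omega> \<partial>M)" by (rule integral_cond_exp_eq(2)[OF f g])
  finally show ?thesis .
qed

lemma integral_mult_event:
  fixes f :: "'w \<Rightarrow> real"
  assumes f: "determined i f" and E: "determined (Suc i) E"
    and c: "AE \<omega> in M. prob_given M (\<O> i) E \<omega> = c"
  shows "(\<integral>\<omega>. (if E \<omega> then f \<omega> else 0) \<partial>M) = c * (\<integral>\<omega>. f \<omega> \<partial>M)"
proof -
  let ?I = "indicat_real {\<omega> \<in> space M. E \<omega>}"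
  have "determined (Suc i) ?I"
    by (rule determined_indicator[OF E])
  then have "(\<integral>\<omega>. f \<omega> * ?I \<omega> \<partial>M) = c * (\<integral>\<omega>. f \<omega> \<partial>M)"
    by (rule integral_mult_cond_const[OF f _ c[unfolded prob_given_def]])
  moreover have "(\<integral>\<omega>. f \<omega> * ?I \<omega> \<partial>M) = (\<integral>\<omega>. (if E \<omega> then f \<omega> else 0) \<partial>M)"
    by (intro Bochner_Integration.integral_cong) (auto simp: indicator_def)
  ultimately show ?thesis by simp
qed

text \<open>The conditional probability is integrated. With c = \<pi> this gives \<pi> \<le> 1; with
  c = 1 it turns a conditional statement into an almost sure one.\<close>

lemma prob_event:
  assumes E: "determined (Suc i) E" and c: "AE \<omega> in M. prob_given M (\<O> i) E \<omega> = c"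
  shows "{\<omega> \<in> space M. E \<omega>} \<in> sets M" "prob {\<omega> \<in> space M. E \<omega>} = c"
proof -
  let ?A = "{\<omega> \<in> space M. E \<omega>}"
  have "determined (Suc i) (indicat_real ?A)"
    by (rule determined_indicator[OF E])
  then have "indicat_real ?A \<in> borel_measurable M" by (rule determined_measurable_M)
  then show A: "?A \<in> sets M"
    unfolding borel_measurable_indicator_iff by (simp add: Int_absorb2)
  have "determined i (\<lambda>\<omega>. 1 :: real)" by (simp add: determined_def)
  from integral_mult_event[OF this E c] have "(\<integral>\<omega>. (if E \<omega> then 1 else 0 :: real) \<partial>M) = c"
    by (simp add: prob_space)
  also have "(\<integral>\<omega>. (if E \<omega> then 1 else 0 :: real) \<partial>M) = (\<integral>\<omega>. indicat_real ?A \<omega> \<partial>M)"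
    by (intro Bochner_Integration.integral_cong) (auto simp: indicator_def)
  also have "\<dots> = prob ?A" using A by simp
  finally show "prob ?A = c" .
qed

end

subsection \<open>Linear convergence\<close>

theorem theorem4p7:
  fixes K :: "'x::{real_inner, banach} \<Rightarrow> 'y::{real_inner, banach}"
    and K' :: "'x \<Rightarrow> 'x \<Rightarrow>\<^sub>L 'y"
    and P :: "'m::finite \<Rightarrow> 'x \<Rightarrow>\<^sub>L 'x" and Q :: "'n::finite \<Rightarrow> 'y \<Rightarrow>\<^sub>L 'y"
    and G :: "'m \<Rightarrow> 'x \<Rightarrow> ereal" and F :: "'n \<Rightarrow> 'y \<Rightarrow> ereal"
    and xh x0 :: 'x and yh y0 :: 'y
    and XK XG :: "'x set" and YF :: "'y set"
    and L L3 p \<alpha>y \<delta> \<kappa> \<rho>x wb Lb :: real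
    and \<gamma>K \<gamma>G \<gamma>Gt \<pi> :: "'m \<Rightarrow> real" and \<gamma>F \<gamma>Fb \<zeta> \<rho> :: "'n \<Rightarrow> real"
    and \<theta> :: "('x \<Rightarrow>\<^sub>L 'x) \<Rightarrow> real"
    and w :: "'m \<Rightarrow> 'n \<Rightarrow> 'n \<Rightarrow> real"
    and \<tau> :: "nat \<Rightarrow> 'm \<Rightarrow> real" and \<sigma> :: "nat \<Rightarrow> 'n \<Rightarrow> real"
    and M :: "'w measure"
    and \<O> :: "nat \<Rightarrow> 'w measure"  \<comment> \<open>shifted: \<open>\<O> i\<close> is the sigma-algebra with index \<open>i - 1\<close>\<close>
    and S :: "nat \<Rightarrow> 'w \<Rightarrow> 'm set"
    and x xb :: "nat \<Rightarrow> 'w \<Rightarrow> 'x" and y :: "nat \<Rightarrow> 'w \<Rightarrow> 'y"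
  assumes \<comment> \<open>setting\<close>
        deriv_K: "\<And>x. (K has_derivative blinfun_apply (K' x)) (at x)"
    and C1_K: "continuous_on UNIV K'"
    and proj_P: "orth_resolution P" and proj_Q: "orth_resolution Q"
    and G: "\<And>j. convex_fun (G j) \<and> proper_fun (G j) \<and> lsc_fun (G j)"
    and F: "\<And>l. convex_fun (F l) \<and> proper_fun (F l) \<and> lsc_fun (F l)"
    and crit_x: "- adj (K' xh) yh \<in> subdiff (block_sum G P) xh"
    and crit_y: "K xh \<in> subdiff (block_sum (\<lambda>l. fenchel_conj (F l)) Q) yh"
    \<comment> \<open>Lipschitz, three-point and monotonicity properties\<close>
    and nbhds: "xh \<in> interior XK" "xh \<in> interior XG" "yh \<in> interior YF"
    and Lipschitz: "L-lipschitz_on XK K'"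
    and three_point: "three_point_property K K' P xh yh XK \<gamma>K \<theta> L3 p"
    and L3: "0 \<le> L3" and p: "1 \<le> p" "p \<le> 2"
    and mono_G: "monotonicity_property (block_sum G P) P xh XG \<gamma>G"
    and mono_F: "monotonicity_property (block_sum (\<lambda>l. fenchel_conj (F l)) Q) Q yh YF \<gamma>F"
    and \<gamma>G: "\<And>j. 0 \<le> \<gamma>G j" and \<gamma>F: "\<And>l. 0 \<le> \<gamma>F l"
    and \<gamma>GK: "\<And>j. 0 < \<gamma>G j + \<gamma>K j"
    and \<alpha>y: "0 < \<alpha>y" and \<zeta>: "\<And>l. 0 \<le> \<zeta> l" "\<And>l. 1 < p \<Longrightarrow> 0 < \<zeta> l"
    and \<gamma>Fb_def: "\<And>l. \<gamma>Fb l = (if \<forall>v. Q l (P_NL K v) = 0 then \<gamma>F l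
                                 else \<gamma>F l - (p - 1) * \<zeta> l - \<alpha>y)"
    and \<gamma>Fb: "\<And>l. 0 < \<gamma>Fb l"
    and \<gamma>Gt: "\<And>j. 0 < \<gamma>Gt j" "\<And>j. \<gamma>Gt j < \<pi> j * (\<gamma>G j + \<gamma>K j)"
    \<comment> \<open>probability\<close>
    and prob: "prob_space M"
    and filtr: "filtration (space M) \<O>" "\<And>i. subalgebra M (\<O> i)"
    and S_meas: "\<And>i. S i \<in> \<O> (Suc i) \<rightarrow>\<^sub>M count_space UNIV"
    and \<pi>_pos: "\<And>j. 0 < \<pi> j"
    and \<pi>: "\<And>i j. AE \<omega> in M. prob_given M (\<O> i) (\<lambda>\<omega>. j \<in> S i \<omega>) \<omega> = \<pi> j"
    \<comment> \<open>step lengths and algorithm\<close>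
    and \<tau>0: "\<And>j. 0 < \<tau> 0 j" and \<sigma>0: "\<And>l. 0 < \<sigma> 0 l"
    and wb_def: "wb = max (MAX j. 1 / (1 + 2 * \<tau> 0 j * \<gamma>Gt j)) (MAX l. 1 / (1 + 2 * \<sigma> 0 l * \<gamma>Fb l))"
    and \<tau>: "\<And>i j. \<tau> (Suc i) j = \<tau> i j / ((1 + 2 * \<tau> i j * \<gamma>Gt j) * wb)"
    and \<sigma>: "\<And>i l. \<sigma> (Suc i) l = \<sigma> i l / ((1 + 2 * \<sigma> i l * \<gamma>Fb l) * wb)"
    and init: "\<And>\<omega>. \<omega> \<in> space M \<Longrightarrow> x 0 \<omega> = x0" "\<And>\<omega>. \<omega> \<in> space M \<Longrightarrow> y 0 \<omega> = y0"
    and iterates: "\<And>\<omega>. \<omega> \<in> space M \<Longrightarrow>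
        full_dual_iterates G F K K' P Q \<pi> \<tau> \<sigma> (\<lambda>i. wb)
          (\<lambda>i. S i \<omega>) (\<lambda>i. x i \<omega>) (\<lambda>i. xb i \<omega>) (\<lambda>i. y i \<omega>)"
    and local_iterates: "AE \<omega> in M. stays_in_neighbourhoods P xh XK XG YF
          (\<lambda>i. S i \<omega>) (\<lambda>i. x i \<omega>) (\<lambda>i. xb i \<omega>) (\<lambda>i. y i \<omega>)"
    \<comment> \<open>step length conditions\<close>
    and w: "\<And>j l k. 0 < w j l k" "\<And>j l k. w j l k = 1 / w j k l"
    and \<delta>\<kappa>: "0 < \<delta>" "\<delta> < \<kappa>" "\<kappa> < 1"
    and \<rho>: "0 \<le> \<rho>x" "\<And>l. 0 \<le> \<rho> l"
    and \<kappa>_bound: "\<And>i l. AE \<omega> in M.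
        1 - \<kappa> \<ge> (norm (\<Sum>j\<in>S i \<omega>.
                    sqrt (block_weight w K' P Q (S i \<omega>) (x i \<omega>) j l * \<sigma> 0 l * \<tau> 0 j / \<pi> j)
                      *\<^sub>R (Q l o\<^sub>L K' (x i \<omega>) o\<^sub>L P j)))\<^sup>2"
    and Lb_def: "Lb = L3 + L / wb * ((MAX j. (wb / \<pi> j + 1)\<^sup>2) * (\<Sum>l\<in>UNIV. \<rho> l)
                                     + real CARD('n) * L / (2 * \<alpha>y) * \<rho>x\<^sup>2)"
    and \<delta>_bound: "\<And>i. AE \<omega> in M. \<forall>j\<in>S i \<omega>.
        \<delta> \<ge> \<tau> 0 j * (Lb + 2 * (1 - \<pi> j) * (\<gamma>G j + \<gamma>K j)
                          * ((\<gamma>G j + \<gamma>K j - \<gamma>Gt j) / (\<pi> j * (\<gamma>G j + \<gamma>K j) - \<gamma>Gt j)))"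
    and \<theta>_bound: "\<And>i. AE \<omega> in M.
        real_cond_exp M (\<O> i) (\<lambda>\<omega>. \<theta> (\<Sum>j\<in>S i \<omega>. (1 / \<pi> j) *\<^sub>R P j)) \<omega>
          \<ge> p powr (- p) * (\<Sum>l\<in>UNIV. rpow (\<zeta> l) (1 - p) * rpow (\<rho> l) (2 - p) / wb)"
    and \<rho>_bound: "\<And>i. AE \<omega> in M.
        prob_given M (\<O> i) (\<lambda>\<omega>. norm (x (Suc i) \<omega> - xh) \<le> \<rho>x \<and>
            (\<forall>l. norm_op (P_NL K) (Q l (y (Suc i) \<omega> - yh)) \<le> \<rho> l)) \<omega> = 1"
  shows "(\<forall>j. (\<forall>N. integrable M (\<lambda>\<omega>. (norm (P j (x N \<omega> - xh)))\<^sup>2)) \<and>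
              (\<lambda>N. \<integral>\<omega>. (norm (P j (x N \<omega> - xh)))\<^sup>2 \<partial>M) \<longlonglongrightarrow> 0 \<and>
              (\<lambda>N. \<integral>\<omega>. (norm (P j (x N \<omega> - xh)))\<^sup>2 \<partial>M) \<in> O(\<lambda>N. wb ^ N)) \<and>
         (\<forall>l. (\<forall>N. integrable M (\<lambda>\<omega>. (norm (Q l (y N \<omega> - yh)))\<^sup>2)) \<and>
              (\<lambda>N. \<integral>\<omega>. (norm (Q l (y N \<omega> - yh)))\<^sup>2 \<partial>M) \<longlonglongrightarrow> 0 \<and>
              (\<lambda>N. \<integral>\<omega>. (norm (Q l (y N \<omega> - yh)))\<^sup>2 \<partial>M) \<in> O(\<lambda>N. wb ^ N))"
proof -
  interpret prob_space M by (rule prob)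
  interpret H: finite_history M \<O> S
    by (intro finite_history.intro finite_history_axioms.intro prob filtr S_meas)
  have S_det: "H.determined (Suc i) (\<lambda>\<omega>. j \<in> S i \<omega>)" for i j
    by (rule H.determined_comp[OF H.determined_S]) simp
  have \<pi>_le: "\<pi> j \<le> 1" for j
    using H.prob_event(2)[OF S_det \<pi>] prob_le_1 by metis

  \<comment> \<open>The rate and the step lengths\<close>
  have wb_ge: "1 / (1 + 2 * \<tau> 0 j * \<gamma>Gt j) \<le> wb" "1 / (1 + 2 * \<sigma> 0 l * \<gamma>Fb l) \<le> wb" for j l
    unfolding wb_def by (auto intro!: Max_ge simp: le_max_iff_disj)
  have wb_lt: "wb < 1"
    unfolding wb_def using \<tau>0 \<sigma>0 \<gamma>Gt(1) \<gamma>Fb by (auto simp: add_pos_pos)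
  have wb_pos: "0 < wb"
  proof -
    have "0 < 1 / (1 + 2 * \<tau> 0 j * \<gamma>Gt j)" for j using \<tau>0[of j] \<gamma>Gt(1)[of j] by (simp add: add_pos_pos)
    then show ?thesis using wb_ge(1) by (rule less_le_trans)
  qed
  note \<tau>_steps = step_lengths[of "\<lambda>i. \<tau> i j" for j, OF \<tau>0 \<gamma>Gt(1) wb_pos wb_ge(1) \<tau>]
  note \<sigma>_steps = step_lengths[of "\<lambda>i. \<sigma> i l" for l, OF \<sigma>0 \<gamma>Fb wb_pos wb_ge(2) \<sigma>]

  interpret B: block_pdps K K' P Q G F xh yh XK XG YF L L3 p \<alpha>y \<delta> \<kappa> \<rho>x wb Lb \<gamma>K \<gamma>G \<gamma>Gt \<pi> "\<tau> 0" \<gamma>F \<gamma>Fb \<zeta> \<rho> "\<sigma> 0" \<theta> w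
    by (unfold_locales; (fact | (use G F in blast)))

  \<comment> \<open>Dependence on the sample history\<close>
  have xy_det: "H.determined i (\<lambda>\<omega>. (x i \<omega>, y i \<omega>))" for i
    unfolding H.determined_def
  proof (intro ballI impI)
    fix \<omega> \<omega>' assume *: "\<omega> \<in> space M" "\<omega>' \<in> space M" "\<forall>k<i. S k \<omega> = S k \<omega>'"
    have "x i \<omega> = x i \<omega>' \<and> y i \<omega> = y i \<omega>'"
      by (rule B.iterates_determined[OF iterates[OF *(1)] iterates[OF *(2)] \<tau>_steps(1) \<sigma>_steps(1)])
         (use * init in auto)
    then show "(x i \<omega>, y i \<omega>) = (x i \<omega>', y i \<omega>')" by simp
  qed
  have det: "H.determined i (\<lambda>\<omega>. h (x i \<omega>) (y i \<omega>))" for i and h :: "'x \<Rightarrow> 'y \<Rightarrow> 'z"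
    using H.determined_comp[OF xy_det, where g = "\<lambda>(a, b). h a b"] by simp
  have detS: "H.determined (Suc i) (\<lambda>\<omega>. h (S i \<omega>) (x i \<omega>) (y i \<omega>))" for i and h :: "'m set \<Rightarrow> 'x \<Rightarrow> 'y \<Rightarrow> 'z"
    using H.determined_comp2[OF H.determined_S[of i "Suc i"] H.determined_mono[OF xy_det[of i]], where h = "\<lambda>s (a, b). h s a b"]
    by simp

  define X where "X i j \<omega> = (norm (P j (x i \<omega> - xh)))\<^sup>2" for i j \<omega>
  define Y where "Y i l \<omega> = (norm (Q l (y i \<omega> - yh)))\<^sup>2" for i l \<omega>
  define C where "C i \<omega> = K' (x i \<omega>) (x i \<omega> - xh) \<bullet> (y i \<omega> - yh)" for i \<omega>
  define CS where "CS i \<omega> = K' (x i \<omega>) (B.sampled (S i \<omega>) (x i \<omega> - xh)) \<bullet> (y i \<omega> - yh)" for i \<omega>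
  define R where "R i \<omega> = norm (B.remainder (x i \<omega>)) powr p" for i \<omega>
  define g where "g j = \<gamma>G j + \<gamma>K j" for j
  have detX: "H.determined i (X i j)" for i j
    unfolding X_def by (rule det[of i "\<lambda>a b. (norm (P j (a - xh)))\<^sup>2"])
  have detY: "H.determined i (Y i l)" for i l
    unfolding Y_def by (rule det[of i "\<lambda>a b. (norm (Q l (b - yh)))\<^sup>2"])
  have detC: "H.determined i (C i)" for i
    unfolding C_def by (rule det[of i "\<lambda>a b. K' a (a - xh) \<bullet> (b - yh)"])
  have detR: "H.determined i (R i)" for i
    unfolding R_def by (rule det[of i "\<lambda>a b. norm (B.remainder a) powr p"])
  have detCS: "H.determined (Suc i) (CS i)" for i
    unfolding CS_def by (rule detS[of i "\<lambda>s a b. K' a (B.sampled s (a - xh)) \<bullet> (b - yh)"])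
  have det\<theta>: "H.determined (Suc i) (\<lambda>\<omega>. \<theta> (B.sampled (S i \<omega>)))" for i
    by (rule detS[of i "\<lambda>s a b. \<theta> (B.sampled s)"])
  note [simp] = H.determined_integrable[OF detX] H.determined_integrable[OF detY]
    H.determined_integrable[OF detC] H.determined_integrable[OF detCS] H.determined_integrable[OF detR]
  have EX0: "0 \<le> (\<integral>\<omega>. X i j \<omega> \<partial>M)" for i j by (simp add: X_def)
  have EY0: "0 \<le> (\<integral>\<omega>. Y i l \<omega> \<partial>M)" for i l by (simp add: Y_def)

  \<comment> \<open>Means of the sampled quantities\<close>
  have ECS: "(\<integral>\<omega>. CS i \<omega> \<partial>M) = (\<integral>\<omega>. C i \<omega> \<partial>M)" for i
  proof -
    define c where "c j \<omega> = K' (x i \<omega>) (P j (x i \<omega> - xh)) \<bullet> (y i \<omega> - yh)" for j \<omega>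
    have detc: "H.determined i (c j)" for j
      unfolding c_def by (rule det[of i "\<lambda>a b. K' a (P j (a - xh)) \<bullet> (b - yh)"])
    have detc': "H.determined i (\<lambda>\<omega>. 1 / \<pi> j * c j \<omega>)" for j
      by (rule H.determined_comp[OF detc])
    have int: "integrable M (\<lambda>\<omega>. if j \<in> S i \<omega> then 1 / \<pi> j * c j \<omega> else 0)" for j
      unfolding c_def
      by (rule H.determined_integrable[OF detS[of i "\<lambda>s a b. if j \<in> s then 1 / \<pi> j * (K' a (P j (a - xh)) \<bullet> (b - yh)) else 0"]])
    have "CS i \<omega> = (\<Sum>j\<in>UNIV. if j \<in> S i \<omega> then 1 / \<pi> j * c j \<omega> else 0)" for \<omega>
      by (simp add: CS_def c_def B.sampled_apply blinfun.sum_right blinfun.scaleR_right inner_sum_left sum.If_cases)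
    then have "(\<integral>\<omega>. CS i \<omega> \<partial>M) = (\<Sum>j\<in>UNIV. \<integral>\<omega>. (if j \<in> S i \<omega> then 1 / \<pi> j * c j \<omega> else 0) \<partial>M)"
      by (simp add: Bochner_Integration.integral_sum int)
    also have "\<dots> = (\<Sum>j\<in>UNIV. \<integral>\<omega>. c j \<omega> \<partial>M)"
    proof (intro sum.cong refl)
      fix j
      \<comment> \<open>\<open>c j\<close> belongs to the past, so the draw contributes exactly the
        factor \<pi>, which cancels 1 / \<pi>.\<close>
      show "(\<integral>\<omega>. (if j \<in> S i \<omega> then 1 / \<pi> j * c j \<omega> else 0) \<partial>M) = (\<integral>\<omega>. c j \<omega> \<partial>M)"
        unfolding H.integral_mult_event[OF detc' S_det \<pi>] using \<pi>_pos[of j] by simp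
    qed
    also have "\<dots> = (\<integral>\<omega>. (\<Sum>j\<in>UNIV. c j \<omega>) \<partial>M)"
      by (simp add: Bochner_Integration.integral_sum H.determined_integrable[OF detc])
    also have "(\<lambda>\<omega>. \<Sum>j\<in>UNIV. c j \<omega>) = C i"
      unfolding c_def C_def
      by (simp only: blinfun.sum_right[symmetric] inner_sum_left[symmetric] proj_sum[OF proj_P])
    finally show ?thesis .
  qed

  define pre where "pre i j \<omega> = (if j \<in> S i \<omega> then - ((1 - \<pi> j) * g j) else \<gamma>Gt j) / \<pi> j * X i j \<omega>" for i j \<omega>
  have int_pre[simp]: "integrable M (pre i j)" for i j
    unfolding pre_def X_def
    by (rule H.determined_integrable[OF detS[of i "\<lambda>s a b. (if j \<in> s then - ((1 - \<pi> j) * g j) else \<gamma>Gt j) / \<pi> j * (norm (P j (a - xh)))\<^sup>2"]])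
  have Epre: "(\<integral>\<omega>. pre i j \<omega> \<partial>M) \<le> 0" for i j
  proof -
    \<comment> \<open>The jump of the coefficient of block \<open>j\<close> when it is drawn; only
      this part feels the sampling.\<close>
    define c where "c = - ((1 - \<pi> j) * g j) - \<gamma>Gt j"
    have detc: "H.determined i (\<lambda>\<omega>. c / \<pi> j * X i j \<omega>)" by (rule H.determined_comp[OF detX])
    have int: "integrable M (\<lambda>\<omega>. if j \<in> S i \<omega> then c / \<pi> j * X i j \<omega> else 0)"
      unfolding X_def
      by (rule H.determined_integrable[OF detS[of i "\<lambda>s a b. if j \<in> s then c / \<pi> j * (norm (P j (a - xh)))\<^sup>2 else 0"]])
    have "pre i j \<omega> = \<gamma>Gt j / \<pi> j * X i j \<omega> + (if j \<in> S i \<omega> then c / \<pi> j * X i j \<omega> else 0)" for \<omega>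
      by (simp add: pre_def c_def add_divide_distrib[symmetric] distrib_right[symmetric])
    then have "(\<integral>\<omega>. pre i j \<omega> \<partial>M) = \<gamma>Gt j / \<pi> j * (\<integral>\<omega>. X i j \<omega> \<partial>M)
        + (\<integral>\<omega>. (if j \<in> S i \<omega> then c / \<pi> j * X i j \<omega> else 0) \<partial>M)"
      using int by simp
    also have "(\<integral>\<omega>. (if j \<in> S i \<omega> then c / \<pi> j * X i j \<omega> else 0) \<partial>M) = c * (\<integral>\<omega>. X i j \<omega> \<partial>M)"
      unfolding H.integral_mult_event[OF detc S_det \<pi>] using \<pi>_pos[of j] by simp
    \<comment> \<open>Surplus and debt balance here: the sign is that of \<gamma>Gt - \<pi> g, which
      is negative by the choice of \<gamma>Gt, and the factor 1 - \<pi> is nonnegative.\<close>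
    also have "\<gamma>Gt j / \<pi> j * (\<integral>\<omega>. X i j \<omega> \<partial>M) + c * (\<integral>\<omega>. X i j \<omega> \<partial>M) =
        (1 - \<pi> j) * (\<gamma>Gt j - \<pi> j * g j) / \<pi> j * (\<integral>\<omega>. X i j \<omega> \<partial>M)"
      using \<pi>_pos[of j] by (simp add: c_def field_simps)
    also have "\<dots> \<le> 0"
      using \<pi>_pos[of j] \<pi>_le[of j] \<gamma>Gt(2)[of j] EX0[of i j]
      by (intro mult_nonpos_nonneg divide_nonpos_pos mult_nonneg_nonpos) (auto simp: g_def)
    finally show ?thesis .
  qed

  define T where "T i \<omega> = (B.c\<theta> - \<theta> (B.sampled (S i \<omega>))) * R i \<omega>" for i \<omega>
  have int_T[simp]: "integrable M (T i)" for i
    unfolding T_def R_def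
    by (rule H.determined_integrable[OF detS[of i "\<lambda>s a b. (B.c\<theta> - \<theta> (B.sampled s)) * norm (B.remainder a) powr p"]])
  \<comment> \<open>\<open>R i\<close> is nonnegative and determined by the past, so \<theta> may be
    replaced by its conditional mean.\<close>
  have ET: "(\<integral>\<omega>. T i \<omega> \<partial>M) \<le> 0" for i
  proof -
    have int: "integrable M (\<lambda>\<omega>. R i \<omega> * \<theta> (B.sampled (S i \<omega>)))"
      unfolding R_def
      by (rule H.determined_integrable[OF detS[of i "\<lambda>s a b. norm (B.remainder a) powr p * \<theta> (B.sampled s)"]])
    have "B.c\<theta> * (\<integral>\<omega>. R i \<omega> \<partial>M) \<le> (\<integral>\<omega>. R i \<omega> * \<theta> (B.sampled (S i \<omega>)) \<partial>M)"
      using \<theta>_bound[of i] by (intro H.integral_mult_cond_ge[OF detR det\<theta>])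
        (simp_all add: R_def B.c\<theta>_def B.sampled_def)
    moreover have "(\<integral>\<omega>. T i \<omega> \<partial>M) = B.c\<theta> * (\<integral>\<omega>. R i \<omega> \<partial>M) - (\<integral>\<omega>. R i \<omega> * \<theta> (B.sampled (S i \<omega>)) \<partial>M)"
      using int by (simp add: T_def left_diff_distrib mult.commute[of "\<theta> _"])
    ultimately show ?thesis by simp
  qed

  \<comment> \<open>Almost sure conditions along the trajectories\<close>
  have kappa: "AE \<omega> in M. B.kappa_cond (S i \<omega>) (x i \<omega>)" for i
    unfolding B.kappa_cond_def using \<kappa>_bound[of i] by (intro eventually_all_finite) simp
  have delta: "AE \<omega> in M. B.delta_cond (S i \<omega>)" for i
    using \<delta>_bound[of i] by (simp add: B.delta_cond_def)
  have rho: "AE \<omega> in M. norm (x (Suc i) \<omega> - xh) \<le> \<rho>x \<and> (\<forall>l. norm_op (P_NL K) (Q l (y (Suc i) \<omega> - yh)) \<le> \<rho> l)" for i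
  proof -
    have "H.determined (Suc i) (\<lambda>\<omega>. norm (x (Suc i) \<omega> - xh) \<le> \<rho>x \<and> (\<forall>l. norm_op (P_NL K) (Q l (y (Suc i) \<omega> - yh)) \<le> \<rho> l))"
      by (rule det[of "Suc i" "\<lambda>a b. norm (a - xh) \<le> \<rho>x \<and> (\<forall>l. norm_op (P_NL K) (Q l (b - yh)) \<le> \<rho> l)"])
    from AE_prob_1[OF H.prob_event(2)[OF this \<rho>_bound]] show ?thesis by (rule AE_mp) simp
  qed

  \<comment> \<open>Decay and coercivity of the Lyapunov function\<close>
  define U where "U i = (\<Sum>j\<in>UNIV. 1 / (2 * \<pi> j * \<tau> i j) * (\<integral>\<omega>. X i j \<omega> \<partial>M))
    + (\<Sum>l\<in>UNIV. 1 / (2 * wb * \<sigma> (Suc i) l) * (\<integral>\<omega>. Y i l \<omega> \<partial>M)) - (\<integral>\<omega>. C i \<omega> \<partial>M)" for i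

  \<comment> \<open>The local properties are at hand for the steps from index 1 on, so descent
    starts there. The dual weight uses \<sigma> at i + 1 because this step length produces the next
    \<open>y\<close>.\<close>
  have U_step: "U (Suc i) \<le> wb * U i" if i: "1 \<le> i" for i
  proof -
    have AE: "AE \<omega> in M. (\<Sum>j\<in>UNIV. (1 / \<tau> i j + 2 * \<gamma>Gt j) / (2 * \<pi> j) * X (Suc i) j \<omega>)
      + (\<Sum>l\<in>UNIV. (1 / \<sigma> (Suc i) l + 2 * \<gamma>Fb l) / (2 * wb) * Y (Suc i) l \<omega>) - (1 / wb) * C (Suc i) \<omega>
     \<le> (\<Sum>j\<in>UNIV. 1 / (2 * \<pi> j * \<tau> i j) * X i j \<omega>)
      + (\<Sum>l\<in>UNIV. 1 / (2 * wb * \<sigma> (Suc i) l) * Y i l \<omega>) - CS i \<omega> + (\<Sum>j\<in>UNIV. pre i j \<omega>) + T i \<omega>"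
      using AE_space local_iterates kappa[of i] delta[of i] rho[of i]
    proof eventually_elim
      case (elim \<omega>)
      show ?case
        unfolding X_def Y_def C_def CS_def pre_def T_def R_def g_def
        by (rule B.descent_iterates[OF iterates[OF elim(1)] elim(2) i])
           (use \<tau>_steps(1,2) \<sigma>_steps(1,3) elim in auto)
    qed
    have "(\<integral>\<omega>. (\<Sum>j\<in>UNIV. (1 / \<tau> i j + 2 * \<gamma>Gt j) / (2 * \<pi> j) * X (Suc i) j \<omega>)
      + (\<Sum>l\<in>UNIV. (1 / \<sigma> (Suc i) l + 2 * \<gamma>Fb l) / (2 * wb) * Y (Suc i) l \<omega>) - (1 / wb) * C (Suc i) \<omega> \<partial>M)
     \<le> (\<integral>\<omega>. (\<Sum>j\<in>UNIV. 1 / (2 * \<pi> j * \<tau> i j) * X i j \<omega>)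
      + (\<Sum>l\<in>UNIV. 1 / (2 * wb * \<sigma> (Suc i) l) * Y i l \<omega>) - CS i \<omega> + (\<Sum>j\<in>UNIV. pre i j \<omega>) + T i \<omega> \<partial>M)"
      by (rule integral_mono_AE[OF _ _ AE])
         (intro Bochner_Integration.integrable_add Bochner_Integration.integrable_diff
            Bochner_Integration.integrable_sum integrable_mult_right; simp)+
    also have "\<dots> = (\<Sum>j\<in>UNIV. 1 / (2 * \<pi> j * \<tau> i j) * (\<integral>\<omega>. X i j \<omega> \<partial>M))
      + (\<Sum>l\<in>UNIV. 1 / (2 * wb * \<sigma> (Suc i) l) * (\<integral>\<omega>. Y i l \<omega> \<partial>M)) - (\<integral>\<omega>. CS i \<omega> \<partial>M)
      + (\<Sum>j\<in>UNIV. \<integral>\<omega>. pre i j \<omega> \<partial>M) + (\<integral>\<omega>. T i \<omega> \<partial>M)"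
      by simp
    also have "\<dots> \<le> U i"
      using ET[of i] sum_nonpos[of UNIV "\<lambda>j. \<integral>\<omega>. pre i j \<omega> \<partial>M", OF Epre] by (simp add: U_def ECS)
    also have "(\<integral>\<omega>. (\<Sum>j\<in>UNIV. (1 / \<tau> i j + 2 * \<gamma>Gt j) / (2 * \<pi> j) * X (Suc i) j \<omega>)
      + (\<Sum>l\<in>UNIV. (1 / \<sigma> (Suc i) l + 2 * \<gamma>Fb l) / (2 * wb) * Y (Suc i) l \<omega>) - (1 / wb) * C (Suc i) \<omega> \<partial>M) =
      (\<Sum>j\<in>UNIV. (1 / \<tau> i j + 2 * \<gamma>Gt j) / (2 * \<pi> j) * (\<integral>\<omega>. X (Suc i) j \<omega> \<partial>M))
      + (\<Sum>l\<in>UNIV. (1 / \<sigma> (Suc i) l + 2 * \<gamma>Fb l) / (2 * wb) * (\<integral>\<omega>. Y (Suc i) l \<omega> \<partial>M)) - (1 / wb) * (\<integral>\<omega>. C (Suc i) \<omega> \<partial>M)"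
      by simp
    also have "\<dots> = U (Suc i) / wb"
    proof -
      have "(1 / \<tau> i j + 2 * \<gamma>Gt j) / (2 * \<pi> j) = 1 / (2 * \<pi> j * \<tau> (Suc i) j) / wb" for j
      proof -
        have "1 / (2 * \<pi> j * \<tau> (Suc i) j) = (1 / \<tau> (Suc i) j) / (2 * \<pi> j)" by simp
        then show ?thesis using wb_pos by (simp add: \<tau>_steps(4))
      qed
      moreover have "(1 / \<sigma> (Suc i) l + 2 * \<gamma>Fb l) / (2 * wb) = 1 / (2 * wb * \<sigma> (Suc (Suc i)) l) / wb" for l
      proof -
        have "1 / (2 * wb * \<sigma> (Suc (Suc i)) l) / wb = (1 / \<sigma> (Suc (Suc i)) l) / (2 * wb) / wb" by simp
        also have "\<dots> = wb * (1 / \<sigma> (Suc i) l + 2 * \<gamma>Fb l) / (2 * wb) / wb"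
          by (simp only: \<sigma>_steps(4)[where i = "Suc i"])
        finally show ?thesis using wb_pos by simp
      qed
      ultimately show ?thesis
        by (simp only: U_def diff_divide_distrib add_divide_distrib sum_divide_distrib) simp
    qed
    finally show ?thesis using wb_pos by (simp add: field_simps)
  qed

  define q where "q = (1 - \<kappa>) / (1 - \<delta>)"
  have q1: "q < 1" using \<delta>\<kappa> by (simp add: q_def)
  \<comment> \<open>The weights are split into the shares \<delta> and 1 - \<delta>, and 1 - q and
    q. The second shares absorb the coupling, first for \<open>CS\<close> pathwise and then for
    \<open>C\<close> in mean; \<delta> < \<kappa> keeps 1 - q positive.\<close>
  have U_ge: "(\<Sum>j\<in>UNIV. \<delta> / (2 * \<pi> j * \<tau> 0 j) * (\<integral>\<omega>. X i j \<omega> \<partial>M))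
      + (\<Sum>l\<in>UNIV. (1 - q) / (2 * \<sigma> 0 l) * (\<integral>\<omega>. Y i l \<omega> \<partial>M)) \<le> U i" for i
  proof -
    have AE: "AE \<omega> in M. CS i \<omega> \<le> (\<Sum>j\<in>UNIV. (1 - \<delta>) / (2 * \<pi> j * \<tau> 0 j) * X i j \<omega>)
        + (\<Sum>l\<in>UNIV. q / (2 * \<sigma> 0 l) * Y i l \<omega>)"
      using kappa[of i]
    proof eventually_elim
      case (elim \<omega>)
      have "(\<Sum>j\<in>S i \<omega>. (1 - \<delta>) / (2 * \<pi> j * \<tau> 0 j) * X i j \<omega>) \<le> (\<Sum>j\<in>UNIV. (1 - \<delta>) / (2 * \<pi> j * \<tau> 0 j) * X i j \<omega>)"
        using \<delta>\<kappa> \<pi>_pos \<tau>0 by (intro sum_mono2) (auto simp: X_def less_imp_le)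
      then show ?case
        using B.coupling_sampled[OF elim, of "x i \<omega> - xh" "y i \<omega> - yh"] unfolding CS_def X_def Y_def q_def by linarith
    qed
    have "(\<integral>\<omega>. CS i \<omega> \<partial>M) \<le> (\<integral>\<omega>. (\<Sum>j\<in>UNIV. (1 - \<delta>) / (2 * \<pi> j * \<tau> 0 j) * X i j \<omega>)
        + (\<Sum>l\<in>UNIV. q / (2 * \<sigma> 0 l) * Y i l \<omega>) \<partial>M)"
      by (rule integral_mono_AE[OF _ _ AE]) simp_all
    then have "(\<integral>\<omega>. C i \<omega> \<partial>M) \<le> (\<Sum>j\<in>UNIV. (1 - \<delta>) / (2 * \<pi> j * \<tau> 0 j) * (\<integral>\<omega>. X i j \<omega> \<partial>M))
        + (\<Sum>l\<in>UNIV. q / (2 * \<sigma> 0 l) * (\<integral>\<omega>. Y i l \<omega> \<partial>M))"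
      by (simp add: ECS)
    moreover have "(\<Sum>j\<in>UNIV. \<delta> / (2 * \<pi> j * \<tau> 0 j) * (\<integral>\<omega>. X i j \<omega> \<partial>M))
        + (\<Sum>j\<in>UNIV. (1 - \<delta>) / (2 * \<pi> j * \<tau> 0 j) * (\<integral>\<omega>. X i j \<omega> \<partial>M))
      \<le> (\<Sum>j\<in>UNIV. 1 / (2 * \<pi> j * \<tau> i j) * (\<integral>\<omega>. X i j \<omega> \<partial>M))"
      unfolding sum.distrib[symmetric]
    proof (rule sum_mono)
      fix j
      have "\<delta> / (2 * \<pi> j * \<tau> 0 j) + (1 - \<delta>) / (2 * \<pi> j * \<tau> 0 j) = 1 / (2 * \<pi> j * \<tau> 0 j)"
        by (simp flip: add_divide_distrib)
      also have "\<dots> \<le> 1 / (2 * \<pi> j * \<tau> i j)"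
        using \<pi>_pos[of j] \<tau>_steps(1,2)[of i j] \<tau>0[of j] by (intro divide_left_mono mult_left_mono) auto
      finally show "\<delta> / (2 * \<pi> j * \<tau> 0 j) * (\<integral>\<omega>. X i j \<omega> \<partial>M) + (1 - \<delta>) / (2 * \<pi> j * \<tau> 0 j) * (\<integral>\<omega>. X i j \<omega> \<partial>M)
        \<le> 1 / (2 * \<pi> j * \<tau> i j) * (\<integral>\<omega>. X i j \<omega> \<partial>M)"
        unfolding distrib_right[symmetric] by (rule mult_right_mono[OF _ EX0])
    qed
    moreover have "(\<Sum>l\<in>UNIV. (1 - q) / (2 * \<sigma> 0 l) * (\<integral>\<omega>. Y i l \<omega> \<partial>M))
        + (\<Sum>l\<in>UNIV. q / (2 * \<sigma> 0 l) * (\<integral>\<omega>. Y i l \<omega> \<partial>M))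
      \<le> (\<Sum>l\<in>UNIV. 1 / (2 * wb * \<sigma> (Suc i) l) * (\<integral>\<omega>. Y i l \<omega> \<partial>M))"
      unfolding sum.distrib[symmetric]
    proof (rule sum_mono)
      fix l
      have "(1 - q) / (2 * \<sigma> 0 l) + q / (2 * \<sigma> 0 l) = 1 / (2 * \<sigma> 0 l)"
        by (simp flip: add_divide_distrib)
      also have "\<dots> \<le> 1 / (2 * wb * \<sigma> (Suc i) l)"
        using wb_pos \<sigma>_steps(1)[of "Suc i" l] \<sigma>_steps(3)[of i l] \<sigma>0[of l] by (intro divide_left_mono) auto
      finally show "(1 - q) / (2 * \<sigma> 0 l) * (\<integral>\<omega>. Y i l \<omega> \<partial>M) + q / (2 * \<sigma> 0 l) * (\<integral>\<omega>. Y i l \<omega> \<partial>M)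
        \<le> 1 / (2 * wb * \<sigma> (Suc i) l) * (\<integral>\<omega>. Y i l \<omega> \<partial>M)"
        unfolding distrib_right[symmetric] by (rule mult_right_mono[OF _ EY0])
    qed
    ultimately show ?thesis unfolding U_def by linarith
  qed

  \<comment> \<open>Rates of the individual blocks\<close>
  have U_rate: "U (Suc N) \<le> wb ^ N * U 1" for N
  proof (induction N)
    case (Suc N)
    have "U (Suc (Suc N)) \<le> wb * U (Suc N)" by (rule U_step) simp
    also have "\<dots> \<le> wb * (wb ^ N * U 1)" using wb_pos Suc by (intro mult_left_mono) auto
    finally show ?case by (simp add: mult_ac)
  qed simp

  have rate: "f \<longlonglongrightarrow> 0 \<and> f \<in> O(\<lambda>N. wb ^ N)"
    if c: "0 < c" and f0: "\<And>i. 0 \<le> f i" and le: "\<And>i. c * f i \<le> U i" for f :: "nat \<Rightarrow> real" and c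
  proof -
    \<comment> \<open>Descent starts at index 1, so one power of \<open>wb\<close> is missing and
      moves into the constant; index 0 does not affect the asymptotics.\<close>
    have bound: "norm (f N) \<le> (U 1 / (c * wb)) * norm (wb ^ N)" if N1: "1 \<le> N" for N
    proof -
      obtain k where N: "N = Suc k" using N1 by (cases N) auto
      have "c * f N \<le> wb ^ k * U 1" using le[of N] U_rate[of k] N by simp
      then show ?thesis using c wb_pos f0[of N] by (simp add: N field_simps)
    qed
    have ev: "\<forall>\<^sub>F N in sequentially. norm (f N) \<le> (U 1 / (c * wb)) * norm (wb ^ N)"
      by (rule eventually_sequentiallyI[of 1]) (rule bound)
    then have big: "f \<in> O(\<lambda>N. wb ^ N)"
      by (rule bigoI)
    have "(\<lambda>N. (U 1 / (c * wb)) * norm (wb ^ N)) \<longlonglongrightarrow> 0"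
      by (intro tendsto_mult_right_zero tendsto_norm_zero LIMSEQ_power_zero) (use wb_pos wb_lt in simp)
    then have "f \<longlonglongrightarrow> 0"
      by (rule Lim_null_comparison[OF ev])
    with big show ?thesis by blast
  qed

  have X_rate: "(\<lambda>N. \<integral>\<omega>. X N j \<omega> \<partial>M) \<longlonglongrightarrow> 0 \<and> (\<lambda>N. \<integral>\<omega>. X N j \<omega> \<partial>M) \<in> O(\<lambda>N. wb ^ N)" for j
  proof (rule rate[of "\<delta> / (2 * \<pi> j * \<tau> 0 j)"])
    show "0 < \<delta> / (2 * \<pi> j * \<tau> 0 j)" using \<delta>\<kappa> \<pi>_pos[of j] \<tau>0[of j] by simp
    fix i
    have "\<delta> / (2 * \<pi> j * \<tau> 0 j) * (\<integral>\<omega>. X i j \<omega> \<partial>M) \<le> (\<Sum>j\<in>UNIV. \<delta> / (2 * \<pi> j * \<tau> 0 j) * (\<integral>\<omega>. X i j \<omega> \<partial>M))"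
      using \<delta>\<kappa> \<pi>_pos \<tau>0 EX0 by (intro member_le_sum) (auto simp: less_imp_le)
    moreover have "0 \<le> (\<Sum>l\<in>UNIV. (1 - q) / (2 * \<sigma> 0 l) * (\<integral>\<omega>. Y i l \<omega> \<partial>M))"
      using q1 \<sigma>0 EY0 by (intro sum_nonneg mult_nonneg_nonneg) (auto simp: less_imp_le)
    ultimately show "\<delta> / (2 * \<pi> j * \<tau> 0 j) * (\<integral>\<omega>. X i j \<omega> \<partial>M) \<le> U i" using U_ge[of i] by linarith
  qed (rule EX0)
  have Y_rate: "(\<lambda>N. \<integral>\<omega>. Y N l \<omega> \<partial>M) \<longlonglongrightarrow> 0 \<and> (\<lambda>N. \<integral>\<omega>. Y N l \<omega> \<partial>M) \<in> O(\<lambda>N. wb ^ N)" for l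
  proof (rule rate[of "(1 - q) / (2 * \<sigma> 0 l)"])
    show "0 < (1 - q) / (2 * \<sigma> 0 l)" using q1 \<sigma>0[of l] by simp
    fix i
    have "(1 - q) / (2 * \<sigma> 0 l) * (\<integral>\<omega>. Y i l \<omega> \<partial>M) \<le> (\<Sum>l\<in>UNIV. (1 - q) / (2 * \<sigma> 0 l) * (\<integral>\<omega>. Y i l \<omega> \<partial>M))"
      using q1 \<sigma>0 EY0 by (intro member_le_sum) (auto simp: less_imp_le)
    moreover have "0 \<le> (\<Sum>j\<in>UNIV. \<delta> / (2 * \<pi> j * \<tau> 0 j) * (\<integral>\<omega>. X i j \<omega> \<partial>M))"
      using \<delta>\<kappa> \<pi>_pos \<tau>0 EX0 by (intro sum_nonneg mult_nonneg_nonneg) (auto simp: less_imp_le)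
    ultimately show "(1 - q) / (2 * \<sigma> 0 l) * (\<integral>\<omega>. Y i l \<omega> \<partial>M) \<le> U i" using U_ge[of i] by linarith
  qed (rule EY0)
  show ?thesis
    using X_rate Y_rate H.determined_integrable[OF detX] H.determined_integrable[OF detY]
    unfolding X_def Y_def by blast
qed

end
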